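(* Let $d\ge1$, $m\ge-d$, $\nu>0$, and let $\phi$ and $P_a^*$ be as defined in the context. Let $1<p<\infty$ and $a>0$ be fixed, and let $1/p+1/p'=1$. Then, for a weight $w(x)>0$ on $\mathbb{R}^d$, the condition $$\big\|w^{-\frac1p}\,\phi\big\|_{L^{p'}(\mathbb{R}^d)}<\infty$$ is equivalent to the existence of some other weight $v(x)>0$ on $\mathbb{R}^d$ such that $P_a^*:L^p(w)\to L^p(v)$ boundedly.
   Context: Fix $d\ge1$, $m\ge -d$, $\nu>0$, and let $L=-\Delta+|x|^2+m$ on $\mathbb{R}^d$. Its heat semigroup is $e^{-vL}f(x)=\int_{\mathbb{R}^d}h_v(x,y)f(y)\,dy$, $v>0$, with (positive) kernel $$h_v(x,y)=e^{-vm}\,[2\pi\sinh(2v)]^{-d/2}\,\exp\Big(-\frac{|x-y|^2}{2\tanh(2v)}-\tanh(v)\,x\cdot y\Big).$$ For measurable $f$ on $\mathbb{R}^d$, $$P_tf(x)=\frac{t^{2\nu}}{4^\nu\Gamma(\nu)}\int_0^\infty e^{-\frac{t^2}{4u}}\,\big[e^{-uL}f\big](x)\,\frac{du}{u^{1+\nu}},\quad t>0,\qquad P_a^*f(x)=\sup_{0<t<a}|P_tf(x)|.$$ For $f\ge0$ these quantities always make sense in $[0,\infty]$. The function $\phi:\mathbb{R}^d\to(0,\infty)$ is $$\phi(y)=\frac{e^{-|y|^2/2}}{(1+|y|)^{\frac{d+m}{2}}[\ln(e+|y|)]^{1+\nu}}\ \text{ if } m>-d,\qquad \phi(y)=\frac{e^{-|y|^2/2}}{[\ln(e+|y|)]^{\nu}}\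 \text{ if } m=-d.$$ A weight is a measurable function on $\mathbb{R}^d$ with values in $(0,\infty)$ a.e.; $L^p(w)$ is the space of measurable $f$ with $\|f\|_{L^p(w)}=(\int_{\mathbb{R}^d}|f|^p w\,dx)^{1/p}<\infty$. "$P_a^*:L^p(w)\to L^p(v)$ boundedly" means there is a constant $C$ with $\|P_a^*f\|_{L^p(v)}\le C\|f\|_{L^p(w)}$ for all $f\in L^p(w)$. *)

theory Defs
  imports "HOL-Analysis.Analysis"
begin

definition heat_kernel :: "real \<Rightarrow> real \<Rightarrow> real ^ 'n \<Rightarrow> real ^ 'n \<Rightarrow> real" where
  "heat_kernel m u x y =
     exp (- u * m) * (2 * pi * sinh (2 * u)) powr (- real CARD('n) / 2)
     * exp (- (norm (x - y))\<^sup>2 / (2 * tanh (2 * u)) - tanh u * (x \<bullet> y))"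

definition heat :: "real \<Rightarrow> real \<Rightarrow> (real ^ 'n \<Rightarrow> real) \<Rightarrow> real ^ 'n \<Rightarrow> real" where
  "heat m u f x = (LINT y|lebesgue. heat_kernel m u x y * f y)"

definition poisson ::
  "real \<Rightarrow> real \<Rightarrow> real \<Rightarrow> (real ^ 'n \<Rightarrow> real) \<Rightarrow> real ^ 'n \<Rightarrow> real" where
  "poisson m \<nu> t f x =
     t powr (2 * \<nu>) / (4 powr \<nu> * Gamma \<nu>)
     * (LBINT u:{0<..}. exp (- t\<^sup>2 / (4 * u)) * heat m u f x / u powr (1 + \<nu>))"

text \<open>The value in \<open>[0, \<infinity>]\<close> of \<open>P\<^sub>t |f| (x)\<close>; the integrals defining \<open>P\<^sub>t f (x)\<close>
  converge absolutely iff it is finite.\<close>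

definition poisson_nn ::
  "real \<Rightarrow> real \<Rightarrow> real \<Rightarrow> (real ^ 'n \<Rightarrow> real) \<Rightarrow> real ^ 'n \<Rightarrow> ennreal" where
  "poisson_nn m \<nu> t f x =
     ennreal (t powr (2 * \<nu>) / (4 powr \<nu> * Gamma \<nu>))
     * (\<integral>\<^sup>+u\<in>{0<..}. ennreal (exp (- t\<^sup>2 / (4 * u)) / u powr (1 + \<nu>))
          * (\<integral>\<^sup>+y. ennreal (heat_kernel m u x y * \<bar>f y\<bar>) \<partial>lebesgue) \<partial>lborel)"

text \<open>Bochner integrals that do not converge have the value \<open>0\<close>, so \<open>poisson\<close> alone would
  hide divergence. Where the defining integrals do not converge absolutely, \<open>|P\<^sub>t f (x)|\<close> is
  counted as \<open>\<infinity>\<close>. For \<open>f \<ge> 0\<close> this is the true value; for \<open>f\<close> of varying sign it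
  makes a finite bound on the maximal function include that \<open>P\<^sub>t f\<close> is defined.\<close>

definition poisson_max ::
  "real \<Rightarrow> real \<Rightarrow> real \<Rightarrow> (real ^ 'n \<Rightarrow> real) \<Rightarrow> real ^ 'n \<Rightarrow> ennreal" where
  "poisson_max m \<nu> a f x =
     (SUP t\<in>{0<..<a}. if poisson_nn m \<nu> t f x < \<infinity> then ennreal \<bar>poisson m \<nu> t f x\<bar> else \<infinity>)"

definition phi :: "real \<Rightarrow> real \<Rightarrow> real ^ 'n \<Rightarrow> real" where
  "phi m \<nu> y =
     (if m = - real CARD('n)
      then exp (- (norm y)\<^sup>2 / 2) / ln (exp 1 + norm y) powr \<nu>
      else exp (- (norm y)\<^sup>2 / 2)
           / ((1 + norm y) powr ((real CARD('n) + m) / 2) * ln (exp 1 + norm y) powr (1 + \<nu>)))"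

definition weight :: "(real ^ 'n \<Rightarrow> real) \<Rightarrow> bool" where
  "weight w \<longleftrightarrow> w \<in> borel_measurable lebesgue \<and> (AE x in lebesgue. 0 < w x)"

text \<open>Only used for exponents \<open>p > 0\<close>.\<close>

definition ennpowr :: "ennreal \<Rightarrow> real \<Rightarrow> ennreal" where
  "ennpowr x p = (if x = \<infinity> then \<infinity> else ennreal (enn2real x powr p))"

text \<open>The norm of \<open>L\<^sup>p(w)\<close>, as a function of the modulus \<open>F = |f|\<close> with values in
  \<open>[0, \<infinity>]\<close>, so that it also applies to maximal functions.\<close>

definition Lp_norm :: "real \<Rightarrow> (real ^ 'n \<Rightarrow> real) \<Rightarrow> (real ^ 'n \<Rightarrow> ennreal) \<Rightarrow> ennreal" where
  "Lp_norm p w F = ennpowr (\<integral>\<^sup>+x. ennpowr (F x) p * ennreal (w x) \<partial>lebesgue) (1 / p)"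

definition Lp_space :: "real \<Rightarrow> (real ^ 'n \<Rightarrow> real) \<Rightarrow> (real ^ 'n \<Rightarrow> real) set" where
  "Lp_space p w =
     {f. f \<in> borel_measurable lebesgue \<and> Lp_norm p w (\<lambda>x. ennreal \<bar>f x\<bar>) < \<infinity>}"

definition poisson_max_bounded ::
  "real \<Rightarrow> real \<Rightarrow> real \<Rightarrow> real \<Rightarrow> (real ^ 'n \<Rightarrow> real) \<Rightarrow> (real ^ 'n \<Rightarrow> real) \<Rightarrow> bool" where
  "poisson_max_bounded m \<nu> a p w v \<longleftrightarrow>
     (\<exists>C::real. \<forall>f\<in>Lp_space p w.
        poisson_max m \<nu> a f \<in> borel_measurable lebesgue \<and>
        Lp_norm p v (poisson_max m \<nu> a f) \<le> ennreal C * Lp_norm p w (\<lambda>x. ennreal \<bar>f x\<bar>))"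

end

theory Submission
  imports Defs
begin

text \<open>
  Write \<open>L\<^sup>1(\<phi>)\<close> for the functions with \<open>\<integral>\<bar>f\<bar> \<phi> < \<infinity>\<close>. The function \<open>\<phi>\<close> is, up to constants depending on
  \<open>x\<close> and \<open>t\<close>, the size of the Poisson kernel \<open>p\<^sub>t(x, y)\<close> as \<open>y\<close> goes to infinity, so \<open>L\<^sup>1(\<phi>)\<close> is the natural
  domain of \<open>P\<^sub>t\<close>. By duality, the condition \<open>w\<^bsup>-1/p\<^esup> \<phi> \<in> L\<^bsup>p'\<^esup>\<close> says exactly that \<open>L\<^sup>p(w) \<subseteq> L\<^sup>1(\<phi>)\<close>.

  Necessity. A lower bound \<open>c \<phi>(y) \<le> p\<^sub>t(x, y)\<close> for \<open>x\<close> in the unit ball and one fixed \<open>t < a\<close>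
  (\<open>poisson_nn_lower\<close>) turns boundedness from \<open>L\<^sup>p(w)\<close> to \<open>L\<^sup>p(v)\<close> into
  \<open>\<integral>f \<phi> \<le> C' \<parallel>f\<parallel>\<close> for \<open>f \<ge> 0\<close>, because the unit ball has positive \<open>v\<close>-mass. Testing this with
  truncations of the extremal function of Hoelder's inequality bounds \<open>w\<^bsup>-1/p\<^esup> \<phi>\<close> in \<open>L\<^bsup>p'\<^esup>\<close>
  (\<open>weight_condition_necessary\<close>).

  Sufficiency. The maximal operator \<open>T\<close> is of weak type \<open>(1, 1)\<close> from \<open>L\<^sup>1(\<phi>)\<close> to weak \<open>L\<^sup>1(\<rho>)\<close> for
  some weight \<open>\<rho> > 0\<close> (\<open>poisson_sup_weak_type\<close>): for \<open>x\<close> in a ball, the part of \<open>f\<close> far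
  from the ball is handled by the upper bound \<open>p\<^sub>t(x, y) \<le> C \<phi>(y)\<close> (\<open>poisson_nn_nonlocal\<close>), and the
  near part by the Hardy-Littlewood maximal function, since the heat kernel is dominated by a
  Gaussian (\<open>poisson_nn_le_hl_maximal\<close>). It remains to pass from this weak type bound to a strong type bound
  on \<open>L\<^sup>p(w)\<close>. Put \<open>\<sigma> = (\<phi> / w)\<^bsup>p' - 1\<^esup>\<close>; the hypothesis says that \<open>\<sigma> \<in> L\<^sup>1(\<phi>)\<close>. The quotient
  \<open>g \<mapsto> T(g \<sigma>) / T\<sigma>\<close> trivially maps bounded functions to bounded functions, and after damping the target measure by
  \<open>min(1, T\<sigma>)\<^sup>2\<close> it inherits a weak type \<open>(1, 1)\<close> bound from \<open>T\<close> (\<open>weak_type_ratio\<close>).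
  Marcinkiewicz interpolation then bounds it on \<open>L\<^sup>p\<close>, and undoing the substitution \<open>f = g \<sigma>\<close> gives the
  explicit weight \<open>v = \<rho> min(1, T\<sigma>)\<^sup>2 (T\<sigma>)\<^bsup>-p\<^esup>\<close> (\<open>factorized_strong_type\<close>).

  Both kernel bounds come from the variable \<open>s = tanh u\<close>, in which the exponent of the heat kernel is
  \<open>-(\<bar>x\<bar>\<^sup>2 + \<bar>y\<bar>\<^sup>2)/2 - (1 - s)\<^sup>2 (\<bar>x\<bar>\<^sup>2 + \<bar>y\<bar>\<^sup>2)/(4s) + (1 - s\<^sup>2) x \<bullet> y / (2s)\<close>. Since \<open>1 - s\<close> is
  comparable to \<open>e\<^bsup>-2u\<^esup>\<close>, the middle term suppresses all times \<open>u\<close> below \<open>ln \<bar>y\<bar> / 2\<close>; beyond it the kernel is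
  comparable to \<open>e\<^bsup>-(d+m)u\<^esup> e\<^bsup>-\<bar>y\<bar>\<^sup>2/2\<^esup>\<close>, and integrating against \<open>u\<^bsup>-1-\<nu>\<^esup> du\<close> produces the power and the
  logarithm in \<open>\<phi>\<close>.
\<close>

section \<open>Strong type bounds from weak type bounds by a change of weight\<close>

lemma nn_integral_powr_from_0:
  fixes q z :: real
  assumes "0 < q" "0 \<le> z"
  shows "(\<integral>\<^sup>+s. ennreal (s powr (q - 1)) * indicator {0<..<z} s \<partial>lborel) = ennreal (z powr q / q)"
proof -
  have "((\<lambda>s. s powr (q - 1)) has_integral z powr q / q) {0..z}"
    using has_integral_powr_from_0[of "q - 1" z] assms by simp
  from nn_integral_has_integral_lebesgue'[OF _ this]
  have "(\<integral>\<^sup>+s. ennreal (s powr (q - 1)) * indicator {0..z} s \<partial>lborel) = ennreal (z powr q / q)"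
    by (simp add: nn_integral_completion)
  moreover have "(\<integral>\<^sup>+s. ennreal (s powr (q - 1)) * indicator {0<..<z} s \<partial>lborel)
      = (\<integral>\<^sup>+s. ennreal (s powr (q - 1)) * indicator {0..z} s \<partial>lborel)"
    by (intro nn_integral_cong_AE, use AE_lborel_singleton[of 0] AE_lborel_singleton[of z] in eventually_elim)
       (auto simp: indicator_def)
  ultimately show ?thesis by simp
qed

text \<open>
  A monotone sublinear operator of weak type \<open>(1, 1)\<close> between two measure spaces. Values in
  \<open>[0, \<infinity>]\<close> are allowed, so that no domain has to be specified for \<open>T\<close>.
\<close>
locale weak_type_operator =
  M: sigma_finite_measure M + N: sigma_finite_measure N
  for M :: "'a measure" and N :: "'b measure" +
  fixes T :: "('a \<Rightarrow> real) \<Rightarrow> 'b \<Rightarrow> ennreal" and C :: real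
  assumes T_measurable: "f \<in> borel_measurable M \<Longrightarrow> T f \<in> borel_measurable N"
    and T_mono: "f \<in> borel_measurable M \<Longrightarrow> g \<in> borel_measurable M \<Longrightarrow> (\<And>y. \<bar>f y\<bar> \<le> \<bar>g y\<bar>) \<Longrightarrow> T f x \<le> T g x"
    and T_add: "f \<in> borel_measurable M \<Longrightarrow> g \<in> borel_measurable M \<Longrightarrow> T (\<lambda>y. f y + g y) x \<le> T f x + T g x"
    and T_scale: "f \<in> borel_measurable M \<Longrightarrow> 0 \<le> c \<Longrightarrow> T (\<lambda>y. c * f y) x \<le> ennreal c * T f x"
    and T_weak: "f \<in> borel_measurable M \<Longrightarrow> 0 < l \<Longrightarrow>
      ennreal l * emeasure N {x \<in> space N. ennreal l < T f x} \<le> ennreal C * (\<integral>\<^sup>+y. ennreal \<bar>f y\<bar> \<partial>M)"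
    and C_nonneg: "0 \<le> C"
begin

text \<open>
  The damping factor is \<open>min(1, T\<sigma>)\<^sup>2\<close> because \<open>\<integral>\<^sub>0\<^sup>1 2 s (1/s) ds\<close> converges: the extra factor \<open>s\<close> compensates the
  \<open>1/s\<close> of a weak type bound at height \<open>s\<close>. Where \<open>T\<sigma> = \<infinity>\<close> it is \<open>0\<close>.
\<close>
definition damp :: "('a \<Rightarrow> real) \<Rightarrow> 'b \<Rightarrow> real" where
  "damp \<sigma> x = (min 1 (enn2real (T \<sigma> x)))\<^sup>2"

lemma damp_measurable [measurable]:
  "\<sigma> \<in> borel_measurable M \<Longrightarrow> damp \<sigma> \<in> borel_measurable N"
proof -
  assume "\<sigma> \<in> borel_measurable M"
  note [measurable] = T_measurable[OF this]
  show ?thesis unfolding damp_def by measurable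
qed

text \<open>
  If \<open>l T\<sigma> < T f\<close> then \<open>l s < T f\<close> for every \<open>s \<le> T\<sigma>\<close>. Writing the damping factor as the integral of \<open>2 s\<close>
  over \<open>0 \<le> s \<le> min(1, T\<sigma>)\<close> and exchanging the integrals reduces the claim to the weak type bound at the
  heights \<open>l s\<close>.
\<close>
lemma weak_type_ratio:
  assumes f: "f \<in> borel_measurable M" and \<sigma>: "\<sigma> \<in> borel_measurable M" and l: "0 < l"
  shows "ennreal l * (\<integral>\<^sup>+x. (if ennreal l * T \<sigma> x < T f x then 1 else 0) * ennreal (damp \<sigma> x) \<partial>N)
    \<le> ennreal (2 * C) * (\<integral>\<^sup>+y. ennreal \<bar>f y\<bar> \<partial>M)"
proof -
  note [measurable] = T_measurable[OF f] T_measurable[OF \<sigma>]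
  interpret pair_sigma_finite lborel N ..
  have square: "ennreal ((min 1 z)\<^sup>2) = (\<integral>\<^sup>+s. ennreal (2 * s) * indicator {0..min 1 z} s \<partial>lborel)"
    if "0 \<le> z" for z :: real
    using that by (subst nn_integral_FTC_Icc[of _ _ _ "\<lambda>s. s\<^sup>2"])
       (auto intro!: derivative_eq_intros)
  let ?I = "\<lambda>s x. ennreal (2 * s) * indicator {0..1} s * (if ennreal (l * s) < T f x then 1 else 0)"
  have "ennreal l * (\<integral>\<^sup>+x. (if ennreal l * T \<sigma> x < T f x then 1 else 0) * ennreal (damp \<sigma> x) \<partial>N)
      \<le> ennreal l * (\<integral>\<^sup>+x. (\<integral>\<^sup>+s. ?I s x \<partial>lborel) \<partial>N)"
  proof (intro mult_left_mono nn_integral_mono)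
    fix x
    show "(if ennreal l * T \<sigma> x < T f x then 1 else 0) * ennreal (damp \<sigma> x) \<le> (\<integral>\<^sup>+s. ?I s x \<partial>lborel)"
    proof (cases "ennreal l * T \<sigma> x < T f x")
      case True
      then have fin: "T \<sigma> x < \<infinity>"
        using l by (cases "T \<sigma> x") (auto simp: ennreal_mult_top)
      have "ennreal (damp \<sigma> x) = (\<integral>\<^sup>+s. ennreal (2 * s) * indicator {0..min 1 (enn2real (T \<sigma> x))} s \<partial>lborel)"
        unfolding damp_def by (rule square) simp
      also have "\<dots> \<le> (\<integral>\<^sup>+s. ?I s x \<partial>lborel)"
      proof (intro nn_integral_mono)
        fix s :: real
        have "ennreal (l * s) < T f x" if "0 \<le> s" "s \<le> enn2real (T \<sigma> x)"
        proof -
          have "ennreal s \<le> T \<sigma> x"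
            using that fin by (metis ennreal_enn2real ennreal_leI infinity_ennreal_def)
          then have "ennreal (l * s) \<le> ennreal l * T \<sigma> x"
            using l that by (simp add: ennreal_mult' mult_left_mono)
          with True show ?thesis by simp
        qed
        then show "ennreal (2 * s) * indicator {0..min 1 (enn2real (T \<sigma> x))} s \<le> ?I s x"
          by (auto simp: indicator_def)
      qed
      finally show ?thesis using True by simp
    qed simp
  qed simp
  also have "\<dots> = ennreal l * (\<integral>\<^sup>+s. (\<integral>\<^sup>+x. ?I s x \<partial>N) \<partial>lborel)"
    by (subst Fubini'[of "?I"]) simp_all
  also have "\<dots> = (\<integral>\<^sup>+s. ennreal l * (ennreal (2 * s) * indicator {0..1} s *
      emeasure N {x \<in> space N. ennreal (l * s) < T f x}) \<partial>lborel)"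
  proof -
    have "(\<integral>\<^sup>+x. ?I s x \<partial>N) = ennreal (2 * s) * indicator {0..1} s * emeasure N {x \<in> space N. ennreal (l * s) < T f x}" for s
    proof -
      have "(\<integral>\<^sup>+x. ?I s x \<partial>N) = (\<integral>\<^sup>+x. ennreal (2 * s) * indicator {0..1} s * indicator {x \<in> space N. ennreal (l * s) < T f x} x \<partial>N)"
        by (intro nn_integral_cong) (auto simp: indicator_def)
      then show ?thesis
        by (simp add: nn_integral_cmult_indicator)
    qed
    moreover have "(\<lambda>s. \<integral>\<^sup>+x. ?I s x \<partial>N) \<in> borel_measurable lborel"
      by measurable
    ultimately show ?thesis
      by (simp add: nn_integral_cmult[symmetric])
  qed
  also have "\<dots> \<le> (\<integral>\<^sup>+s. (ennreal (2 * C) * (\<integral>\<^sup>+y. ennreal \<bar>f y\<bar> \<partial>M)) * indicator {0..1::real} s \<partial>lborel)"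
  proof (intro nn_integral_mono)
    fix s :: real
    let ?m = "emeasure N {x \<in> space N. ennreal (l * s) < T f x}"
    show "ennreal l * (ennreal (2 * s) * indicator {0..1} s * ?m)
       \<le> (ennreal (2 * C) * (\<integral>\<^sup>+y. ennreal \<bar>f y\<bar> \<partial>M)) * indicator {0..1} s"
    proof (cases "0 < s \<and> s \<le> 1")
      case True
      have "ennreal l * (ennreal (2 * s) * ?m) = 2 * (ennreal (l * s) * ?m)"
        using l True by (simp add: ennreal_mult mult_ac)
      also have "\<dots> \<le> 2 * (ennreal C * (\<integral>\<^sup>+y. ennreal \<bar>f y\<bar> \<partial>M))"
        using l True by (intro mult_left_mono T_weak[OF f]) auto
      finally show ?thesis
        using True C_nonneg by (simp add: ennreal_mult mult_ac)
    next
      case False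
      then show ?thesis by (cases "s = 0") (auto simp: indicator_def)
    qed
  qed
  also have "\<dots> = ennreal (2 * C) * (\<integral>\<^sup>+y. ennreal \<bar>f y\<bar> \<partial>M)"
    by (subst nn_integral_cmult_indicator) auto
  finally show ?thesis .
qed

text \<open>
  This is the truncation in the Marcinkiewicz interpolation theorem: the part of \<open>f\<close> below \<open>l \<sigma> / 2\<close> contributes at most \<open>l T\<sigma> / 2\<close>
  to \<open>T f\<close>, so only the part above it matters on the set where \<open>T f\<close> exceeds \<open>l T\<sigma>\<close>.
\<close>
lemma truncated_weak_type_ratio:
  assumes f: "f \<in> borel_measurable M" and \<sigma>: "\<sigma> \<in> borel_measurable M"
    and \<sigma>_pos: "\<And>y. 0 < \<sigma> y" and l: "0 < l"
  shows "ennreal l * (\<integral>\<^sup>+x. (if ennreal l * T \<sigma> x < T f x then 1 else 0) * ennreal (damp \<sigma> x) \<partial>N)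
    \<le> ennreal (4 * C) * (\<integral>\<^sup>+y. ennreal \<bar>f y\<bar> * indicator {..<2 * \<bar>f y\<bar> / \<sigma> y} l \<partial>M)"
proof -
  note [measurable] = f \<sigma> T_measurable[OF f] T_measurable[OF \<sigma>]
  define h where "h = (\<lambda>y. if l < 2 * \<bar>f y\<bar> / \<sigma> y then f y else 0)"
  have h [measurable]: "h \<in> borel_measurable M"
    unfolding h_def by measurable
  note [measurable] = T_measurable[OF h]
  have incl: "ennreal (l / 2) * T \<sigma> x < T h x" if "ennreal l * T \<sigma> x < T f x" for x
  proof (rule ccontr)
    assume "\<not> ?thesis"
    then have le: "T h x \<le> ennreal (l / 2) * T \<sigma> x" by simp
    have "T f x = T (\<lambda>y. h y + (f y - h y)) x" by simp
    also have "\<dots> \<le> T h x + T (\<lambda>y. f y - h y) x"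
      by (rule T_add) auto
    also have "T (\<lambda>y. f y - h y) x \<le> T (\<lambda>y. l / 2 * \<sigma> y) x"
    proof (rule T_mono)
      fix y
      show "\<bar>f y - h y\<bar> \<le> \<bar>l / 2 * \<sigma> y\<bar>"
        using \<sigma>_pos[of y] l by (auto simp: h_def field_simps)
    qed auto
    also have "\<dots> \<le> ennreal (l / 2) * T \<sigma> x"
      using l by (intro T_scale) auto
    finally have "T f x \<le> ennreal (l / 2) * T \<sigma> x + ennreal (l / 2) * T \<sigma> x"
      using le by (meson add_mono order_trans order_refl)
    also have "\<dots> = ennreal l * T \<sigma> x"
      using l by (simp add: distrib_right[symmetric] ennreal_plus[symmetric] del: ennreal_plus)
    finally show False using that by simp
  qed
  have "ennreal l * (\<integral>\<^sup>+x. (if ennreal l * T \<sigma> x < T f x then 1 else 0) * ennreal (damp \<sigma> x) \<partial>N)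
     \<le> 2 * (ennreal (l / 2) * (\<integral>\<^sup>+x. (if ennreal (l / 2) * T \<sigma> x < T h x then 1 else 0) * ennreal (damp \<sigma> x) \<partial>N))"
  proof -
    have "ennreal l = 2 * ennreal (l / 2)"
      using l by (simp flip: ennreal_numeral ennreal_mult')
    then show ?thesis
      using incl by (auto simp: mult.assoc indicator_def intro!: mult_left_mono nn_integral_mono)
  qed
  also have "\<dots> \<le> 2 * (ennreal (2 * C) * (\<integral>\<^sup>+y. ennreal \<bar>h y\<bar> \<partial>M))"
    using l by (intro mult_left_mono weak_type_ratio h \<sigma>) auto
  also have "\<dots> = ennreal (4 * C) * (\<integral>\<^sup>+y. ennreal \<bar>h y\<bar> \<partial>M)"
    using C_nonneg by (simp add: ennreal_mult mult.assoc[symmetric])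
  also have "(\<integral>\<^sup>+y. ennreal \<bar>h y\<bar> \<partial>M) = (\<integral>\<^sup>+y. ennreal \<bar>f y\<bar> * indicator {..<2 * \<bar>f y\<bar> / \<sigma> y} l \<partial>M)"
    by (intro nn_integral_cong) (auto simp: h_def indicator_def)
  finally show ?thesis .
qed

text \<open>This makes the quotient by \<open>T\<sigma>\<close> meaningful almost everywhere.\<close>
lemma finite_AE:
  assumes f: "f \<in> borel_measurable M" and int: "(\<integral>\<^sup>+y. ennreal \<bar>f y\<bar> \<partial>M) < \<infinity>"
  shows "AE x in N. T f x < \<infinity>"
proof -
  note [measurable] = T_measurable[OF f]
  define I where "I = enn2real (\<integral>\<^sup>+y. ennreal \<bar>f y\<bar> \<partial>M)"
  have I: "(\<integral>\<^sup>+y. ennreal \<bar>f y\<bar> \<partial>M) = ennreal I" "0 \<le> I" using int by (auto simp: I_def less_top)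
  let ?S = "{x \<in> space N. T f x = \<infinity>}"
  have bound: "ennreal l * emeasure N ?S \<le> ennreal (C * I)" if "0 < l" for l
  proof -
    have "ennreal l * emeasure N ?S \<le> ennreal l * emeasure N {x \<in> space N. ennreal l < T f x}"
      by (intro mult_left_mono emeasure_mono) auto
    also have "\<dots> \<le> ennreal C * ennreal I" unfolding I(1)[symmetric] by (rule T_weak[OF f that])
    finally show ?thesis using C_nonneg I by (simp add: ennreal_mult)
  qed
  have "emeasure N ?S = 0"
  proof (rule ccontr)
    assume nz: "emeasure N ?S \<noteq> 0"
    obtain e where e: "emeasure N ?S = ennreal e" "0 < e"
    proof (cases "emeasure N ?S")
      case (real r)
      then show thesis using nz that[of r] by (cases "r = 0") auto
    next
      case top
      then show thesis using bound[of 1] by (simp add: top_unique)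
    qed
    have "ennreal (((C * I + 1) / e) * e) \<le> ennreal (C * I)"
      using bound[of "(C * I + 1) / e"] e C_nonneg I by (simp add: add_nonneg_pos flip: ennreal_mult)
    then show False using e C_nonneg I by simp
  qed
  then have "AE x in N. x \<notin> ?S" by (intro AE_not_in null_setsI) auto
  then show ?thesis by (auto simp: less_top)
qed

text \<open>
  Integrating the truncated bound against \<open>p l\<^bsup>p-1\<^esup> dl\<close> gives the \<open>p\<close>-th power of \<open>T f / T\<sigma>\<close> on the left;
  on the right the integral over \<open>l < 2 \<bar>f\<bar> / \<sigma>\<close> converges at \<open>0\<close> because \<open>p > 1\<close>.
\<close>
theorem factorized_strong_type:
  assumes f: "f \<in> borel_measurable M" and \<sigma>: "\<sigma> \<in> borel_measurable M"
    and \<sigma>_pos: "\<And>y. 0 < \<sigma> y" and p: "1 < p"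
  shows "(\<integral>\<^sup>+x. ennpowr (T f x) p * ennreal (damp \<sigma> x / enn2real (T \<sigma> x) powr p) \<partial>N)
    \<le> ennreal (4 * C * p / (p - 1) * 2 powr (p - 1)) * (\<integral>\<^sup>+y. ennreal (\<bar>f y\<bar> powr p * \<sigma> y powr (1 - p)) \<partial>M)"
proof -
  note [measurable] = f \<sigma> T_measurable[OF f] T_measurable[OF \<sigma>]
  interpret LN: pair_sigma_finite lborel N ..
  interpret LM: pair_sigma_finite lborel M ..
  let ?J = "\<lambda>l x. ennreal (p * l powr (p - 1)) * indicator {0<..} l * ((if ennreal l * T \<sigma> x < T f x then 1 else 0) * ennreal (damp \<sigma> x))"
  have pointwise: "ennpowr (T f x) p * ennreal (damp \<sigma> x / enn2real (T \<sigma> x) powr p) \<le> (\<integral>\<^sup>+l. ?J l x \<partial>lborel)" for x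
  proof (cases "damp \<sigma> x = 0")
    case False
    define t where "t = enn2real (T \<sigma> x)"
    have t: "0 < t" "T \<sigma> x = ennreal t"
    proof -
      show "T \<sigma> x = ennreal t"
        using False by (cases "T \<sigma> x") (simp_all add: t_def damp_def)
      show "0 < t"
        using False enn2real_nonneg[of "T \<sigma> x"] unfolding t_def
        by (metis damp_def less_eq_real_def min.absorb2 power2_eq_iff zero_eq_power2 zero_le_one)
    qed
    have below: "ennreal (z powr p) * ennreal (damp \<sigma> x) \<le> (\<integral>\<^sup>+l. ?J l x \<partial>lborel)"
      if "0 \<le> z" "ennreal (z * t) \<le> T f x" for z
    proof -
      have "ennreal (z powr p) = ennreal p * ennreal (z powr p / p)"
        using p by (subst ennreal_mult[symmetric]) auto
      then have "ennreal (z powr p) * ennreal (damp \<sigma> x)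
          = (\<integral>\<^sup>+l. ennreal p * (ennreal (l powr (p - 1)) * indicator {0<..<z} l) \<partial>lborel) * ennreal (damp \<sigma> x)"
        using p that by (simp add: nn_integral_cmult nn_integral_powr_from_0)
      also have "\<dots> = (\<integral>\<^sup>+l. ennreal p * (ennreal (l powr (p - 1)) * indicator {0<..<z} l) * ennreal (damp \<sigma> x) \<partial>lborel)"
        by (rule nn_integral_multc[symmetric]) measurable
      also have "\<dots> \<le> (\<integral>\<^sup>+l. ?J l x \<partial>lborel)"
      proof (intro nn_integral_mono)
        fix l :: real
        have "ennreal l * T \<sigma> x < T f x" if l: "0 < l" "l < z"
        proof -
          have "ennreal l * T \<sigma> x < ennreal (z * t)"
            using t l by (simp add: ennreal_mult[symmetric] ennreal_lessI)
          with \<open>ennreal (z * t) \<le> T f x\<close> show ?thesis by simp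
        qed
        then show "ennreal p * (ennreal (l powr (p - 1)) * indicator {0<..<z} l) * ennreal (damp \<sigma> x) \<le> ?J l x"
          using p by (auto simp: indicator_def ennreal_mult')
      qed
      finally show ?thesis .
    qed
    show ?thesis
    proof (cases "T f x")
      case (real F)
      define z where "z = F / t"
      have "ennpowr (T f x) p * ennreal (damp \<sigma> x / enn2real (T \<sigma> x) powr p) = ennreal (z powr p) * ennreal (damp \<sigma> x)"
        using real t by (auto simp: ennpowr_def z_def powr_divide ennreal_mult'[symmetric])
      also have "\<dots> \<le> (\<integral>\<^sup>+l. ?J l x \<partial>lborel)"
        using real t by (intro below) (auto simp: z_def)
      finally show ?thesis .
    next
      case top
      have "(\<integral>\<^sup>+l. ?J l x \<partial>lborel) = \<infinity>"
      proof (rule ccontr)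
        assume "\<not> ?thesis"
        then obtain r where r: "0 \<le> r" "(\<integral>\<^sup>+l. ?J l x \<partial>lborel) = ennreal r"
          by (cases "\<integral>\<^sup>+l. ?J l x \<partial>lborel") auto
        have d: "0 < damp \<sigma> x" using False by (auto simp: damp_def)
        define z where "z = ((r + 1) / damp \<sigma> x) powr (1 / p)"
        have "z powr p = (r + 1) / damp \<sigma> x"
          using p d r by (simp add: z_def powr_powr)
        then have "ennreal (r + 1) \<le> ennreal r"
          using below[of z] top r d by (simp add: z_def flip: ennreal_mult')
        then show False using r by simp
      qed
      then show ?thesis by simp
    qed
  qed simp
  have "(\<integral>\<^sup>+x. ennpowr (T f x) p * ennreal (damp \<sigma> x / enn2real (T \<sigma> x) powr p) \<partial>N)
      \<le> (\<integral>\<^sup>+x. (\<integral>\<^sup>+l. ?J l x \<partial>lborel) \<partial>N)"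
    by (intro nn_integral_mono pointwise)
  also have "\<dots> = (\<integral>\<^sup>+l. (\<integral>\<^sup>+x. ?J l x \<partial>N) \<partial>lborel)"
    by (subst LN.Fubini'[of ?J]) simp_all
  also have "\<dots> \<le> (\<integral>\<^sup>+l. (\<integral>\<^sup>+y. ennreal (4 * C * p) * ennreal (l powr (p - 1 - 1)) * ennreal \<bar>f y\<bar> * indicator {0<..<2 * \<bar>f y\<bar> / \<sigma> y} l \<partial>M) \<partial>lborel)"
  proof (intro nn_integral_mono)
    fix l :: real
    show "(\<integral>\<^sup>+x. ?J l x \<partial>N) \<le> (\<integral>\<^sup>+y. ennreal (4 * C * p) * ennreal (l powr (p - 1 - 1)) * ennreal \<bar>f y\<bar> * indicator {0<..<2 * \<bar>f y\<bar> / \<sigma> y} l \<partial>M)"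
    proof (cases "0 < l")
      case True
      have B: "indicator {..<2 * \<bar>f y\<bar> / \<sigma> y} l = (if l < 2 * \<bar>f y\<bar> / \<sigma> y then 1 else 0 :: ennreal)" for y
        by (simp add: indicator_def)
      have "ennreal (p * l powr (p - 1)) = ennreal (p * l powr (p - 1 - 1)) * ennreal l"
        using True p powr_add[of l "p - 1 - 1" 1] by (subst ennreal_mult[symmetric]) auto
      then have "(\<integral>\<^sup>+x. ?J l x \<partial>N) = ennreal (p * l powr (p - 1 - 1)) * (ennreal l *
          (\<integral>\<^sup>+x. (if ennreal l * T \<sigma> x < T f x then 1 else 0) * ennreal (damp \<sigma> x) \<partial>N))"
        using True by (simp add: nn_integral_cmult mult.assoc)
      also have "\<dots> \<le> ennreal (p * l powr (p - 1 - 1)) * (ennreal (4 * C) * (\<integral>\<^sup>+y. ennreal \<bar>f y\<bar> * indicator {..<2 * \<bar>f y\<bar> / \<sigma> y} l \<partial>M))"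
        by (intro mult_left_mono truncated_weak_type_ratio f \<sigma> \<sigma>_pos True) auto
      also have "\<dots> = (\<integral>\<^sup>+y. ennreal (p * l powr (p - 1 - 1)) * (ennreal (4 * C) * (ennreal \<bar>f y\<bar> * indicator {..<2 * \<bar>f y\<bar> / \<sigma> y} l)) \<partial>M)"
        unfolding B by (simp add: nn_integral_cmult)
      also have "\<dots> = (\<integral>\<^sup>+y. ennreal (4 * C * p) * ennreal (l powr (p - 1 - 1)) * ennreal \<bar>f y\<bar> * indicator {0<..<2 * \<bar>f y\<bar> / \<sigma> y} l \<partial>M)"
      proof (intro nn_integral_cong)
        fix y
        have "ennreal (p * l powr (p - 1 - 1)) * ennreal (4 * C) = ennreal (4 * C * p) * ennreal (l powr (p - 1 - 1))"
          using p C_nonneg by (simp add: ennreal_mult[symmetric] mult_ac)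
        then show "ennreal (p * l powr (p - 1 - 1)) * (ennreal (4 * C) * (ennreal \<bar>f y\<bar> * indicator {..<2 * \<bar>f y\<bar> / \<sigma> y} l))
          = ennreal (4 * C * p) * ennreal (l powr (p - 1 - 1)) * ennreal \<bar>f y\<bar> * indicator {0<..<2 * \<bar>f y\<bar> / \<sigma> y} l"
          using True by (simp add: mult.assoc[symmetric] indicator_def)
      qed
      finally show ?thesis .
    qed (simp add: indicator_def)
  qed
  also have "\<dots> = (\<integral>\<^sup>+y. (\<integral>\<^sup>+l. ennreal (4 * C * p) * ennreal (l powr (p - 1 - 1)) * ennreal \<bar>f y\<bar> * indicator {0<..<2 * \<bar>f y\<bar> / \<sigma> y} l \<partial>lborel) \<partial>M)"
    by (rule LM.Fubini'[symmetric]) (simp add: indicator_def)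
  also have "\<dots> = (\<integral>\<^sup>+y. ennreal (4 * C * p / (p - 1) * 2 powr (p - 1)) * ennreal (\<bar>f y\<bar> powr p * \<sigma> y powr (1 - p)) \<partial>M)"
  proof (intro nn_integral_cong)
    fix y
    have "(\<integral>\<^sup>+l. ennreal (4 * C * p) * ennreal (l powr (p - 1 - 1)) * ennreal \<bar>f y\<bar> * indicator {0<..<2 * \<bar>f y\<bar> / \<sigma> y} l \<partial>lborel)
       = (\<integral>\<^sup>+l. ennreal (4 * C * p) * ennreal \<bar>f y\<bar> * (ennreal (l powr (p - 1 - 1)) * indicator {0<..<2 * \<bar>f y\<bar> / \<sigma> y} l) \<partial>lborel)"
      by (simp add: mult_ac)
    also have "\<dots> = ennreal (4 * C * p) * ennreal \<bar>f y\<bar> * ennreal ((2 * \<bar>f y\<bar> / \<sigma> y) powr (p - 1) / (p - 1))"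
      using p \<sigma>_pos[of y]
      by (subst nn_integral_cmult, measurable, subst nn_integral_powr_from_0) auto
    also have "\<dots> = ennreal (4 * C * p / (p - 1) * 2 powr (p - 1)) * ennreal (\<bar>f y\<bar> powr p * \<sigma> y powr (1 - p))"
    proof (cases "f y = 0")
      case False
      have 1: "\<bar>f y\<bar> powr p = \<bar>f y\<bar> powr (p - 1) * \<bar>f y\<bar>"
        using False powr_add[of "\<bar>f y\<bar>" "p - 1" 1] by simp
      have 2: "\<sigma> y powr (1 - p) = 1 / \<sigma> y powr (p - 1)"
        using powr_minus_divide[of "\<sigma> y" "p - 1"] by simp
      have "4 * C * p * \<bar>f y\<bar> * ((2 * \<bar>f y\<bar> / \<sigma> y) powr (p - 1) / (p - 1))
          = 4 * C * p / (p - 1) * 2 powr (p - 1) * (\<bar>f y\<bar> powr p * \<sigma> y powr (1 - p))"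
        using \<sigma>_pos[of y] unfolding 1 2 by (simp add: powr_divide powr_mult mult_ac)
      then show ?thesis
        using p C_nonneg \<sigma>_pos[of y] by (simp add: ennreal_mult[symmetric])
    qed simp
    finally show "(\<integral>\<^sup>+l. ennreal (4 * C * p) * ennreal (l powr (p - 1 - 1)) * ennreal \<bar>f y\<bar> * indicator {0<..<2 * \<bar>f y\<bar> / \<sigma> y} l \<partial>lborel)
       = ennreal (4 * C * p / (p - 1) * 2 powr (p - 1)) * ennreal (\<bar>f y\<bar> powr p * \<sigma> y powr (1 - p))" .
  qed
  also have "\<dots> = ennreal (4 * C * p / (p - 1) * 2 powr (p - 1)) * (\<integral>\<^sup>+y. ennreal (\<bar>f y\<bar> powr p * \<sigma> y powr (1 - p)) \<partial>M)"
    by (subst nn_integral_cmult) auto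
  finally show ?thesis .
qed

end

section \<open>The Hardy-Littlewood maximal function\<close>

text \<open>The averages are normalised by \<open>r\<^bsup>d\<^esup>\<close> instead of the volume of the ball.\<close>
definition hl_maximal :: "('a::euclidean_space \<Rightarrow> ennreal) \<Rightarrow> 'a \<Rightarrow> ennreal" where
  "hl_maximal g x = (SUP r\<in>{0<..}. ennreal (1 / r ^ DIM('a)) * (\<integral>\<^sup>+y\<in>cball x r. g y \<partial>lborel))"

lemma ball_integral_le_hl_maximal:
  fixes x :: "'a::euclidean_space"
  assumes "0 < r"
  shows "(\<integral>\<^sup>+y\<in>cball x r. g y \<partial>lborel) \<le> ennreal (r ^ DIM('a)) * hl_maximal g x"
proof -
  have "(\<integral>\<^sup>+y\<in>cball x r. g y \<partial>lborel)
      = ennreal (r ^ DIM('a)) * (ennreal (1 / r ^ DIM('a)) * (\<integral>\<^sup>+y\<in>cball x r. g y \<partial>lborel))"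
    using assms by (simp add: mult.assoc[symmetric] ennreal_mult[symmetric])
  also have "\<dots> \<le> ennreal (r ^ DIM('a)) * hl_maximal g x"
    unfolding hl_maximal_def using assms by (intro mult_left_mono SUP_upper) auto
  finally show ?thesis .
qed

lemma emeasure_UN_le_nn_integral_count_space:
  assumes "sigma_finite_measure M" "countable I" and A: "\<And>i. i \<in> I \<Longrightarrow> A i \<in> sets M"
  shows "emeasure M (\<Union>i\<in>I. A i) \<le> (\<integral>\<^sup>+i. emeasure M (A i) \<partial>count_space I)"
proof -
  interpret M: sigma_finite_measure M by fact
  interpret I: sigma_finite_measure "count_space I"
    by (rule sigma_finite_measure_count_space_countable) fact
  interpret pair_sigma_finite "count_space I" M ..
  have [measurable]: "(\<lambda>(i, x). indicator (A i) x :: ennreal) \<in> borel_measurable (count_space I \<Otimes>\<^sub>M M)"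
    using assms by (intro measurable_pair_measure_countable1) auto
  have "emeasure M (\<Union>i\<in>I. A i) = (\<integral>\<^sup>+x. indicator (\<Union>i\<in>I. A i) x \<partial>M)"
    using assms by (intro nn_integral_indicator[symmetric] sets.countable_UN') auto
  also have "\<dots> \<le> (\<integral>\<^sup>+x. (\<integral>\<^sup>+i. indicator (A i) x \<partial>count_space I) \<partial>M)"
  proof (intro nn_integral_mono)
    fix x
    show "indicator (\<Union>i\<in>I. A i) x \<le> (\<integral>\<^sup>+i. indicator (A i) x \<partial>count_space I)"
    proof (cases "x \<in> (\<Union>i\<in>I. A i)")
      case True
      then obtain i where "i \<in> I" "x \<in> A i" by auto
      then show ?thesis
        using nn_integral_ge_point[of i I "\<lambda>i. indicator (A i) x"] by (simp add: indicator_def)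
    qed simp
  qed
  also have "\<dots> = (\<integral>\<^sup>+i. (\<integral>\<^sup>+x. indicator (A i) x \<partial>M) \<partial>count_space I)"
    by (rule Fubini') measurable
  also have "\<dots> = (\<integral>\<^sup>+i. emeasure M (A i) \<partial>count_space I)"
    by (intro nn_integral_cong) (simp add: A)
  finally show ?thesis .
qed

text \<open>
  Vitali's covering lemma selects disjoint balls on which the average of \<open>g\<close> exceeds \<open>l\<close> and whose fivefold
  enlargements cover the set \<open>l < hl_maximal g\<close>. The lemma asks for bounded radii; they are bounded because the
  total mass of \<open>g\<close> may be assumed finite. A measurable cover \<open>E\<close> in place of the set itself saves
  a proof that the maximal function is measurable.
\<close>
theorem hl_maximal_weak_type:
  fixes g :: "'a::euclidean_space \<Rightarrow> ennreal"
  assumes g [measurable]: "g \<in> borel_measurable borel" and l: "0 < l"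
  obtains E where "E \<in> sets lborel" "{x. ennreal l < hl_maximal g x} \<subseteq> E"
    "ennreal l * emeasure lborel E \<le> ennreal (5 ^ DIM('a) * unit_ball_vol DIM('a)) * (\<integral>\<^sup>+y. g y \<partial>lborel)"
proof (cases "(\<integral>\<^sup>+y. g y \<partial>lborel) = \<infinity>")
  case True
  have "ennreal (5 ^ DIM('a) * unit_ball_vol (real DIM('a))) \<noteq> 0"
    using unit_ball_vol_pos[of "real DIM('a)"] by (simp add: ennreal_eq_0_iff not_le)
  then show ?thesis
    using that[of UNIV] True by (simp add: ennreal_mult_eq_top_iff ennreal_mult_top)
next
  case False
  define I where "I = enn2real (\<integral>\<^sup>+y. g y \<partial>lborel)"
  have I: "(\<integral>\<^sup>+y. g y \<partial>lborel) = ennreal I" "0 \<le> I"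
    using False by (auto simp: I_def less_top)
  define S where "S = {x. ennreal l < hl_maximal g x}"
  have "\<forall>x\<in>S. \<exists>r. 0 < r \<and> ennreal (l * r ^ DIM('a)) < (\<integral>\<^sup>+y\<in>cball x r. g y \<partial>lborel)"
  proof
    fix x assume x: "x \<in> S"
    from x obtain r where r: "0 < r" "ennreal l < ennreal (1 / r ^ DIM('a)) * (\<integral>\<^sup>+y\<in>cball x r. g y \<partial>lborel)"
      unfolding S_def hl_maximal_def by (auto simp: less_SUP_iff)
    then have "ennreal (r ^ DIM('a)) * ennreal l < ennreal (r ^ DIM('a)) * (ennreal (1 / r ^ DIM('a)) * (\<integral>\<^sup>+y\<in>cball x r. g y \<partial>lborel))"
      by (intro ennreal_mult_strict_left_mono) auto
    also have "\<dots> = (\<integral>\<^sup>+y\<in>cball x r. g y \<partial>lborel)"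
      using r by (simp add: mult.assoc[symmetric] ennreal_mult[symmetric])
    finally show "\<exists>r. 0 < r \<and> ennreal (l * r ^ DIM('a)) < (\<integral>\<^sup>+y\<in>cball x r. g y \<partial>lborel)"
      using r l by (intro exI[of _ r]) (simp add: ennreal_mult[symmetric] mult.commute)
  qed
  from bchoice[OF this] obtain r where r: "\<And>x. x \<in> S \<Longrightarrow> 0 < r x"
    "\<And>x. x \<in> S \<Longrightarrow> ennreal (l * r x ^ DIM('a)) < (\<integral>\<^sup>+y\<in>cball x (r x). g y \<partial>lborel)"
    by blast
  have bounded: "r x \<le> max 1 (I / l)" if x: "x \<in> S" for x
  proof (cases "r x \<le> 1")
    case False
    have "ennreal (l * r x ^ DIM('a)) \<le> (\<integral>\<^sup>+y. g y \<partial>lborel)"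
      using r(2)[OF x] by (rule order.trans[OF less_imp_le nn_integral_mono]) (auto simp: indicator_def)
    then have "l * r x ^ DIM('a) \<le> I"
      using I by simp
    moreover have "r x ^ 1 \<le> r x ^ DIM('a)"
      using False by (intro power_increasing) (auto simp: Suc_le_eq)
    then have "l * r x \<le> l * r x ^ DIM('a)" using l by simp
    ultimately have "l * r x \<le> I" by (rule order.trans[rotated])
    then have "r x \<le> I / l"
      using l by (simp add: field_simps)
    then show ?thesis by simp
  qed auto
  have cover: "S \<subseteq> (\<Union>x\<in>S. cball x (r x))"
    using r(1) by (auto intro!: bexI simp: less_imp_le)
  have radii: "0 < r x \<and> r x \<le> max 1 (I / l)" if "x \<in> S" for x
    using r(1) bounded that by simp
  obtain D where D: "countable D" "D \<subseteq> S"
      "pairwise (\<lambda>i j. disjnt (cball i (r i)) (cball j (r j))) D"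
      "S \<subseteq> (\<Union>i\<in>D. cball i (5 * r i))"
    by (rule Vitali_covering_lemma_cballs[where a = "\<lambda>x. x", OF cover radii])
  define K where "K = 5 ^ DIM('a) * unit_ball_vol (real DIM('a))"
  have K: "0 \<le> K" by (simp add: K_def)
  show ?thesis
  proof (rule that[of "\<Union>i\<in>D. cball i (5 * r i)"])
    show "(\<Union>i\<in>D. cball i (5 * r i)) \<in> sets lborel"
      using D(1) by (intro sets.countable_UN'') auto
    show "{x. ennreal l < hl_maximal g x} \<subseteq> (\<Union>i\<in>D. cball i (5 * r i))"
      using D(4) by (simp add: S_def)
    have "ennreal l * emeasure lborel (\<Union>i\<in>D. cball i (5 * r i))
        \<le> ennreal l * (\<integral>\<^sup>+i. emeasure lborel (cball i (5 * r i)) \<partial>count_space D)"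
      by (intro mult_left_mono emeasure_UN_le_nn_integral_count_space D(1) lborel.sigma_finite_measure_axioms) auto
    also have "\<dots> = (\<integral>\<^sup>+i. ennreal l * emeasure lborel (cball i (5 * r i)) \<partial>count_space D)"
      by (simp add: nn_integral_cmult)
    also have "\<dots> \<le> (\<integral>\<^sup>+i. ennreal K * (\<integral>\<^sup>+y\<in>cball i (r i). g y \<partial>lborel) \<partial>count_space D)"
    proof (intro nn_integral_mono)
      fix i assume "i \<in> space (count_space D)"
      then have i: "i \<in> S" using D(2) by auto
      have "ennreal l * emeasure lborel (cball i (5 * r i)) = ennreal K * ennreal (l * r i ^ DIM('a))"
        using r(1)[OF i] l by (simp add: emeasure_cball K_def ennreal_mult[symmetric] power_mult_distrib mult_ac)
      also have "\<dots> \<le> ennreal K * (\<integral>\<^sup>+y\<in>cball i (r i). g y \<partial>lborel)"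
        using r(2)[OF i] by (intro mult_left_mono) auto
      finally show "ennreal l * emeasure lborel (cball i (5 * r i)) \<le> ennreal K * (\<integral>\<^sup>+y\<in>cball i (r i). g y \<partial>lborel)" .
    qed
    also have "\<dots> = ennreal K * (\<integral>\<^sup>+i. emeasure (density lborel g) (cball i (r i)) \<partial>count_space D)"
      by (simp add: nn_integral_cmult emeasure_density)
    also have "(\<integral>\<^sup>+i. emeasure (density lborel g) (cball i (r i)) \<partial>count_space D)
        = emeasure (density lborel g) (\<Union>i\<in>D. cball i (r i))"
      using D(3) by (intro emeasure_UN_countable[symmetric] D(1)) (auto simp: disjoint_family_on_def pairwise_def disjnt_def)
    also have "\<dots> \<le> emeasure (density lborel g) UNIV"
      by (rule emeasure_mono) auto
    also have "\<dots> = (\<integral>\<^sup>+y. g y \<partial>lborel)"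
      by (simp add: emeasure_density)
    finally show "ennreal l * emeasure lborel (\<Union>i\<in>D. cball i (5 * r i))
        \<le> ennreal (5 ^ DIM('a) * unit_ball_vol DIM('a)) * (\<integral>\<^sup>+y. g y \<partial>lborel)"
      by (simp add: K_def mult_left_mono)
  qed
qed

section \<open>Pointwise bounds for the heat kernel\<close>

lemma tanh_bounds:
  fixes u :: real
  assumes "0 < u"
  shows "0 < tanh u" "tanh u < 1" "tanh u \<le> 2 * u" "1 / tanh u \<le> 1 + 1 / u"
    "exp (- 2 * u) \<le> 1 - tanh u" "1 - tanh u \<le> 2 * exp (- 2 * u)"
proof -
  have t: "tanh u = (exp (2 * u) - 1) / (exp (2 * u) + 1)"
  proof -
    have "1 - exp (- 2 * u) = (exp (2 * u) - 1) / exp (2 * u)" "1 + exp (- 2 * u) = (exp (2 * u) + 1) / exp (2 * u)"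
      by (simp_all add: exp_minus field_simps)
    then show ?thesis
      unfolding tanh_real_altdef by simp
  qed
  have e: "1 + 2 * u \<le> exp (2 * u)" "1 < exp (2 * u)"
    using exp_ge_add_one_self[of "2 * u"] assms by auto
  show "0 < tanh u" "tanh u < 1"
    using assms tanh_real_lt_1 by auto
  show "tanh u \<le> 2 * u"
  proof -
    have "tanh u \<le> 1 - exp (- 2 * u)"
      unfolding tanh_real_altdef using assms by (subst pos_divide_le_eq) (auto simp: add_pos_pos algebra_simps)
    then show ?thesis
      using exp_ge_add_one_self[of "- 2 * u"] by simp
  qed
  show "1 / tanh u \<le> 1 + 1 / u"
  proof -
    have "1 / tanh u = 1 + 2 / (exp (2 * u) - 1)"
      using e by (simp add: t field_simps)
    also have "2 / (exp (2 * u) - 1) \<le> 2 / (2 * u)"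
    proof (intro divide_left_mono)
      show "2 * u \<le> exp (2 * u) - 1" using e(1) by linarith
    qed (use e assms in auto)
    finally show ?thesis by simp
  qed
  have d: "1 - tanh u = 2 / (exp (2 * u) + 1)"
  proof -
    have "1 - (E - 1) / (E + 1) = 2 / (E + 1)" if "1 < E" for E :: real
      using that by (simp add: field_simps)
    from this[OF e(2)] show ?thesis unfolding t .
  qed
  have E: "exp (- 2 * u) = 1 / exp (2 * u)" by (simp add: exp_minus inverse_eq_divide)
  have "1 / E \<le> 2 / (E + 1)" "2 / (E + 1) \<le> 2 * (1 / E)" if "1 < E" for E :: real
    using that by (simp_all add: field_simps)
  from this[OF e(2)] show "exp (- 2 * u) \<le> 1 - tanh u" "1 - tanh u \<le> 2 * exp (- 2 * u)"
    unfolding d E .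
qed

lemma tanh_double: "tanh (2 * u) = 2 * tanh u / (1 + (tanh u)\<^sup>2)" for u :: real
  using tanh_add[of u u] by (simp add: power2_eq_square)

text \<open>
  With \<open>s = tanh u\<close> one has \<open>tanh (2u) = 2s / (1 + s\<^sup>2)\<close>. The first form isolates the ground state
  \<open>e\<^bsup>-\<bar>y\<bar>\<^sup>2/2\<^esup>\<close> and governs large \<open>y\<close>; the second one exhibits a Gaussian in \<open>x - y\<close> and governs
  \<open>y\<close> near \<open>x\<close>.
\<close>
lemma mehler_exponent:
  fixes x y :: "'a::real_inner"
  assumes "0 < u"
  shows "- (norm (x - y))\<^sup>2 / (2 * tanh (2 * u)) - tanh u * (x \<bullet> y)
    = - (norm x ^ 2 + norm y ^ 2) / 2
      - (1 - tanh u)\<^sup>2 / (4 * tanh u) * (norm x ^ 2 + norm y ^ 2)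
      + (1 - (tanh u)\<^sup>2) / (2 * tanh u) * (x \<bullet> y)" (is ?A)
    "- (norm (x - y))\<^sup>2 / (2 * tanh (2 * u)) - tanh u * (x \<bullet> y)
    = - ((norm (x - y))\<^sup>2 / tanh u + tanh u * (norm (x + y))\<^sup>2) / 4" (is ?B)
proof -
  define s where "s = tanh u"
  have s: "0 < s" using assms by (simp add: s_def)
  have n: "(norm (x - y))\<^sup>2 = norm x ^ 2 + norm y ^ 2 - 2 * (x \<bullet> y)"
    "(norm (x + y))\<^sup>2 = norm x ^ 2 + norm y ^ 2 + 2 * (x \<bullet> y)"
    by (simp_all add: power2_norm_eq_inner inner_diff inner_add inner_commute)
  have "- (a - 2 * b) / (2 * (2 * s / (1 + s\<^sup>2))) - s * b
      = - a / 2 - (1 - s)\<^sup>2 / (4 * s) * a + (1 - s\<^sup>2) / (2 * s) * b" for a b :: real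
    using s by (simp add: field_simps power2_eq_square)
  then show ?A unfolding n tanh_double s_def[symmetric] .
  have "- (a - 2 * b) / (2 * (2 * s / (1 + s\<^sup>2))) - s * b
      = - ((a - 2 * b) / s + s * (a + 2 * b)) / 4" for a b :: real
    using s by (simp add: field_simps power2_eq_square)
  then show ?B unfolding n tanh_double s_def[symmetric] .
qed

text \<open>
  When \<open>d\<close> is the dimension, \<open>d + m\<close> is the bottom of the spectrum of \<open>L\<close>, and \<open>e\<^bsup>-u(d+m)\<^esup>\<close> is the decay of
  its ground state under the semigroup. The estimate amounts to \<open>tanh u \<cdot> e\<^bsup>2u\<^esup> \<le> 2 sinh (2u)\<close>, which follows from \<open>e\<^bsup>u\<^esup> \<le> 2 cosh u\<close>.
\<close>
lemma prefactor_upper: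
  fixes u m d :: real
  assumes "0 < u" "0 \<le> d"
  shows "exp (- u * m) * (2 * pi * sinh (2 * u)) powr (- d / 2)
    \<le> (pi * tanh u) powr (- d / 2) * exp (- u * (d + m))"
proof -
  have "pi * tanh u * exp (2 * u) \<le> 2 * pi * sinh (2 * u)"
  proof -
    have "tanh u * exp (2 * u) \<le> 2 * sinh (2 * u)"
    proof -
      have "2 * sinh (2 * u) = 4 * sinh u * cosh u" by (simp add: sinh_double)
      moreover have "exp (2 * u) \<le> 4 * (cosh u)\<^sup>2"
      proof -
        have "exp u \<le> 2 * cosh u" by (simp add: cosh_def)
        then have "(exp u)\<^sup>2 \<le> (2 * cosh u)\<^sup>2" by (intro power_mono) auto
        then show ?thesis by (simp add: power_mult_distrib exp_double)
      qed
      then have "sinh u * exp (2 * u) \<le> sinh u * (4 * (cosh u)\<^sup>2)"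
        using assms by (intro mult_left_mono) auto
      then have "sinh u * exp (2 * u) / cosh u \<le> sinh u * (4 * (cosh u)\<^sup>2) / cosh u"
        by (intro divide_right_mono) auto
      ultimately show ?thesis
        by (simp add: tanh_def power2_eq_square mult_ac)
    qed
    then show ?thesis by simp
  qed
  then have "(2 * pi * sinh (2 * u)) powr (- d / 2) \<le> (pi * tanh u * exp (2 * u)) powr (- d / 2)"
    using assms by (intro powr_mono2') auto
  also have "\<dots> = (pi * tanh u) powr (- d / 2) * exp (- u * d)"
    using assms by (simp add: powr_mult exp_powr_real)
  finally have "exp (- u * m) * (2 * pi * sinh (2 * u)) powr (- d / 2)
      \<le> exp (- u * m) * ((pi * tanh u) powr (- d / 2) * exp (- u * d))"
    by simp
  also have "\<dots> = (pi * tanh u) powr (- d / 2) * exp (- u * (d + m))"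
    by (simp add: algebra_simps flip: exp_add)
  finally show ?thesis .
qed

lemma prefactor_lower:
  fixes u m d :: real
  assumes "0 < u" "0 \<le> d"
  shows "pi powr (- d / 2) * exp (- u * (d + m))
    \<le> exp (- u * m) * (2 * pi * sinh (2 * u)) powr (- d / 2)"
proof -
  have "2 * pi * sinh (2 * u) \<le> pi * exp (2 * u)"
    by (simp add: sinh_def)
  then have "(pi * exp (2 * u)) powr (- d / 2) \<le> (2 * pi * sinh (2 * u)) powr (- d / 2)"
    using assms by (intro powr_mono2') auto
  also have "(pi * exp (2 * u)) powr (- d / 2) = pi powr (- d / 2) * exp (- u * d)"
    by (simp add: powr_mult exp_powr_real)
  finally have le: "exp (- u * m) * (pi powr (- d / 2) * exp (- u * d))
      \<le> exp (- u * m) * (2 * pi * sinh (2 * u)) powr (- d / 2)"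
    by simp
  have eq: "exp (- u * m) * (pi powr (- d / 2) * exp (- u * d)) = pi powr (- d / 2) * exp (- u * (d + m))"
    by (simp add: algebra_simps flip: exp_add)
  show ?thesis using le unfolding eq .
qed

lemma heat_kernel_pos: "0 < u \<Longrightarrow> 0 < heat_kernel m u x y"
  by (simp add: heat_kernel_def)

lemma heat_kernel_nonneg [simp]: "0 \<le> heat_kernel m u x y"
  by (simp add: heat_kernel_def)

lemma heat_kernel_le_gauss:
  fixes x y :: "real ^ 'n"
  assumes "0 < u" "- real CARD('n) \<le> m"
  shows "heat_kernel m u x y \<le> (pi * tanh u) powr (- real CARD('n) / 2) * exp (- (norm (x - y))\<^sup>2 / (4 * tanh u))"
proof -
  have "exp (- u * m) * (2 * pi * sinh (2 * u)) powr (- real CARD('n) / 2)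
      \<le> (pi * tanh u) powr (- real CARD('n) / 2) * exp (- u * (real CARD('n) + m))"
    using assms by (intro prefactor_upper) auto
  also have "\<dots> \<le> (pi * tanh u) powr (- real CARD('n) / 2) * 1"
    using assms by (intro mult_left_mono) auto
  finally have "exp (- u * m) * (2 * pi * sinh (2 * u)) powr (- real CARD('n) / 2)
      \<le> (pi * tanh u) powr (- real CARD('n) / 2)" by simp
  moreover have "exp (- (norm (x - y))\<^sup>2 / (2 * tanh (2 * u)) - tanh u * (x \<bullet> y))
      \<le> exp (- (norm (x - y))\<^sup>2 / (4 * tanh u))"
    unfolding mehler_exponent(2)[OF assms(1)] using assms by (simp add: field_simps)
  ultimately show ?thesis
    unfolding heat_kernel_def by (intro mult_mono) auto
qed

text \<open>
  The quantity \<open>z = (1 - tanh u) \<bar>y\<bar>\<close> is comparable to \<open>e\<^bsup>-2u\<^esup> \<bar>y\<bar>\<close> and measures whether the time \<open>u\<close> is short or long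
  for the point \<open>y\<close>.
\<close>
lemma mehler_exponent_upper:
  fixes x y :: "'a::real_inner" and k :: real
  assumes u: "0 < u" and x: "norm x \<le> k" 
  defines "s \<equiv> tanh u" and "z \<equiv> (1 - tanh u) * norm y"
  shows "- (norm (x - y))\<^sup>2 / (2 * tanh (2 * u)) - tanh u * (x \<bullet> y)
     \<le> - (norm y)\<^sup>2 / 2 + (k * z - z\<^sup>2 / 4) / s"
proof -
  have s: "0 < s" "s < 1" using tanh_bounds[OF u] by (auto simp: s_def)
  have "x \<bullet> y \<le> k * norm y"
    using norm_cauchy_schwarz[of x y] x by (meson mult_right_mono norm_ge_zero order_trans)
  then have "(1 - s\<^sup>2) / (2 * s) * (x \<bullet> y) \<le> (1 - s\<^sup>2) / (2 * s) * (k * norm y)"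
    using s by (intro mult_left_mono) (auto simp: power_le_one)
  also have "(1 - s\<^sup>2) / (2 * s) * (k * norm y) = (1 + s) / 2 * (k * z / s)"
    by (simp add: z_def s_def[symmetric] field_simps power2_eq_square)
  also have "\<dots> \<le> 1 * (k * z / s)"
    using s order.trans[OF norm_ge_zero x]
    by (intro mult_right_mono) (auto simp: z_def s_def[symmetric] intro!: divide_nonneg_pos mult_nonneg_nonneg)
  finally have A: "(1 - s\<^sup>2) / (2 * s) * (x \<bullet> y) \<le> k * z / s" by simp
  have B: "(1 - s)\<^sup>2 / (4 * s) * (norm x ^ 2 + norm y ^ 2) \<ge> z\<^sup>2 / 4 / s"
  proof -
    have "z\<^sup>2 / 4 / s = (1 - s)\<^sup>2 / (4 * s) * norm y ^ 2"
      by (simp add: z_def s_def[symmetric] power_mult_distrib)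
    also have "\<dots> \<le> (1 - s)\<^sup>2 / (4 * s) * (norm x ^ 2 + norm y ^ 2)"
      using s by (intro mult_left_mono) auto
    finally show ?thesis .
  qed
  have "- (X + Y) / 2 - Q + R \<le> - Y / 2 + (K - Z)" if "R \<le> K" "Z \<le> Q" "0 \<le> X" for X Y Q R K Z :: real
    using that by (simp add: field_simps)
  from this[OF A B zero_le_power2] show ?thesis
    unfolding mehler_exponent(1)[OF u] unfolding s_def[symmetric] diff_divide_distrib[of "k * z"] .
qed

text \<open>
  For times \<open>u \<ge> ln (1 + \<bar>y\<bar>) / 2\<close> the product \<open>(1 - tanh u) \<bar>y\<bar>\<close> is at most \<open>2\<close>, so the exponent differs
  from that of the ground state by a bounded amount; the value \<open>13\<close> is a crude bound for it.
\<close>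
lemma mehler_exponent_lower:
  fixes x y :: "'a::real_inner"
  assumes u: "1 / 2 \<le> u" and x: "norm x \<le> 1" and y: "1 + norm y \<le> exp (2 * u)"
  shows "- (norm y)\<^sup>2 / 2 - 13 \<le> - (norm (x - y))\<^sup>2 / (2 * tanh (2 * u)) - tanh u * (x \<bullet> y)"
proof -
  define s where "s = tanh u"
  have u0: "0 < u" using u by simp
  have s: "0 < s" "s < 1" using tanh_bounds[OF u0] by (auto simp: s_def)
  have "1 / u \<le> 2" using u by (simp add: field_simps)
  then have "1 / s \<le> 3"
    using tanh_bounds(4)[OF u0] by (simp add: s_def)
  then have s3: "1 / 3 \<le> s"
    using s by (simp add: field_simps)
  have "(1 - s) * (1 + norm y) \<le> 2 * exp (- 2 * u) * exp (2 * u)"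
    using tanh_bounds(6)[OF u0] y s by (intro mult_mono) (auto simp: s_def)
  then have z: "(1 - s) * norm y \<le> 2"
    using s by (simp add: exp_minus algebra_simps)
  have "- (x \<bullet> y) \<le> norm y"
    using Cauchy_Schwarz_ineq2[of x y] x mult_right_mono[of "norm x" 1 "norm y"] by simp
  then have "(1 - s\<^sup>2) / (2 * s) * (- (x \<bullet> y)) \<le> (1 - s\<^sup>2) / (2 * s) * norm y"
    using s by (intro mult_left_mono) (auto simp: power_le_one)
  also have "\<dots> = (1 + s) / (2 * s) * ((1 - s) * norm y)"
    by (simp add: field_simps power2_eq_square)
  also have "\<dots> \<le> 3 * 2"
  proof (intro mult_mono)
    show "(1 + s) / (2 * s) \<le> 3" using s s3 by (simp add: field_simps)
  qed (use s z in auto)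
  finally have A: "- 6 \<le> (1 - s\<^sup>2) / (2 * s) * (x \<bullet> y)" by simp
  have "((1 - s) * norm y)\<^sup>2 \<le> 2\<^sup>2"
    using z s by (intro power_mono) auto
  moreover have "((1 - s) * norm x)\<^sup>2 \<le> 1\<^sup>2"
    using x s by (intro power_mono mult_le_one) auto
  ultimately have "(1 - s)\<^sup>2 * (norm x ^ 2 + norm y ^ 2) \<le> 5"
    unfolding power_mult_distrib distrib_left by simp
  then have "1 / (4 * s) * ((1 - s)\<^sup>2 * (norm x ^ 2 + norm y ^ 2)) \<le> 1 * 5"
    using s s3 by (intro mult_mono) (auto simp: field_simps)
  then have B: "(1 - s)\<^sup>2 / (4 * s) * (norm x ^ 2 + norm y ^ 2) \<le> 5" by simp
  have C: "(norm x)\<^sup>2 \<le> 1" using x by (simp add: power_le_one)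
  have "- (norm y)\<^sup>2 / 2 - 13 \<le> - (norm x ^ 2 + norm y ^ 2) / 2 - 5 + - 6"
    using C by (simp add: field_simps)
  then show ?thesis
    unfolding mehler_exponent(1)[OF u0] unfolding s_def[symmetric] using A B by linarith
qed

section \<open>The radial profile of \<phi> and time integrals\<close>

lemma powr_exp_bounded:
  fixes N c :: real
  assumes "0 \<le> N" "0 < c"
  obtains C where "0 < C" "\<And>v. 0 < v \<Longrightarrow> v powr N * exp (- c * v) \<le> C"
proof
  fix v :: real assume v: "0 < v"
  define n where "n = nat \<lceil>N\<rceil>"
  have n: "N \<le> real n" using assms by (simp add: n_def)
  have "v powr N * exp (- c * v) \<le> (1 + v ^ n) * exp (- c * v)"
  proof (intro mult_right_mono)
    show "v powr N \<le> 1 + v ^ n"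
    proof (cases "v \<le> 1")
      case True
      have "v powr N \<le> 1 powr N" using v True assms by (intro powr_mono2) auto
      then show ?thesis using v by (simp add: add_increasing2)
    next
      case False
      then have "v powr N \<le> v powr real n" using n by (intro powr_mono) auto
      then show ?thesis using v by (simp add: powr_realpow)
    qed
  qed auto
  also have "\<dots> \<le> 1 + fact n / c ^ n"
  proof -
    have "(c * v) ^ n / fact n \<le> exp (c * v)"
    proof -
      have "(\<Sum>k\<in>{n}. (c * v) ^ k /\<^sub>R fact k) \<le> exp (c * v)"
        unfolding exp_def using assms v summable_exp_generic[of "c * v"]
        by (intro sum_le_suminf) auto
      then show ?thesis by (simp add: divide_inverse mult.commute)
    qed
    then have "v ^ n * exp (- c * v) \<le> fact n / c ^ n"
      using assms by (simp add: exp_minus field_simps power_mult_distrib)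
    moreover have "exp (- c * v) \<le> 1" using assms v by simp
    ultimately show ?thesis unfolding distrib_right by linarith
  qed
  finally show "v powr N * exp (- c * v) \<le> 1 + fact n / c ^ n" .
next
  show "0 < 1 + fact (nat \<lceil>N\<rceil>) / c ^ nat \<lceil>N\<rceil>"
    using assms by (simp add: add_pos_nonneg)
qed

lemma nn_integral_powr_to_infinity:
  fixes \<nu> c :: real
  assumes "0 < \<nu>" "0 < c"
  shows "(\<integral>\<^sup>+u. ennreal (u powr (- 1 - \<nu>)) * indicator {c..} u \<partial>lborel) = ennreal (c powr (- \<nu>) / \<nu>)"
proof -
  have "((\<lambda>u. u powr (- 1 - \<nu>)) has_integral c powr (- \<nu>) / \<nu>) {c..}"
    using has_integral_powr_to_inf[of "- 1 - \<nu>" c] assms by simp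
  from nn_integral_has_integral_lebesgue'[OF _ this] show ?thesis
    by (simp add: nn_integral_completion)
qed

lemma nn_integral_exp_abs:
  fixes b u0 :: real
  assumes "0 < b"
  shows "(\<integral>\<^sup>+u. ennreal (exp (- b * \<bar>u - u0\<bar>)) \<partial>lborel) \<le> ennreal (2 / b)"
proof -
  have half: "(\<integral>\<^sup>+u. ennreal (exp (- b * u)) * indicator {0..} u \<partial>lborel) = ennreal (1 / b)"
  proof -
    have "((\<lambda>u. exp (- b * u)) has_integral exp (- b * 0) / b) {0..}"
      using has_integral_exp_minus_to_infinity[of b 0] assms by simp
    from nn_integral_has_integral_lebesgue'[OF _ this] show ?thesis
      by (simp add: nn_integral_completion)
  qed
  have reflect: "(\<integral>\<^sup>+u. f (- u) \<partial>lborel) = (\<integral>\<^sup>+u. f u \<partial>lborel)"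
    if "f \<in> borel_measurable borel" for f :: "real \<Rightarrow> ennreal"
    using nn_integral_real_affine[of f "-1" 0] that by simp
  have "(\<integral>\<^sup>+u. ennreal (exp (- b * \<bar>u - u0\<bar>)) \<partial>lborel)
      = (\<integral>\<^sup>+u. ennreal (exp (- b * \<bar>u\<bar>)) \<partial>lborel)"
    by (subst nn_integral_real_affine[where c = 1 and t = u0]) auto
  also have "\<dots> \<le> (\<integral>\<^sup>+u. ennreal (exp (- b * u)) * indicator {0..} u
      + ennreal (exp (- b * (- u))) * indicator {0..} (- u) \<partial>lborel)"
    by (intro nn_integral_mono) (auto simp: indicator_def)
  also have "\<dots> = ennreal (1 / b) + (\<integral>\<^sup>+u. ennreal (exp (- b * (- u))) * indicator {0..} (- u) \<partial>lborel)"
    by (subst nn_integral_add, measurable, subst half, rule refl)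
  also have "(\<integral>\<^sup>+u. ennreal (exp (- b * (- u))) * indicator {0..} (- u) \<partial>lborel) = ennreal (1 / b)"
    by (rule trans[OF reflect half]) measurable
  also have "ennreal (1 / b) + ennreal (1 / b) = ennreal (2 / b)"
    using assms by (simp flip: ennreal_plus)
  finally show ?thesis .
qed

text \<open>
  The factor by which \<open>\<phi>\<close> differs from the ground state \<open>e\<^bsup>-\<bar>y\<bar>\<^sup>2/2\<^esup>\<close>, as a function of \<open>r = \<bar>y\<bar>\<close> and
  of the spectral bottom \<open>b = d + m\<close>.
\<close>
definition phi_radial :: "real \<Rightarrow> real \<Rightarrow> real \<Rightarrow> real" where
  "phi_radial b \<nu> r = (if b = 0 then ln (exp 1 + r) powr (- \<nu>)
     else (1 + r) powr (- b / 2) * ln (exp 1 + r) powr (- 1 - \<nu>))"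

lemma phi_eq_radial:
  fixes y :: "real ^ 'n"
  shows "phi m \<nu> y = exp (- (norm y)\<^sup>2 / 2) * phi_radial (real CARD('n) + m) \<nu> (norm y)"
proof -
  have "m = - real CARD('n) \<longleftrightarrow> real CARD('n) + m = 0" by auto
  moreover have "ln (exp 1 + norm y) powr (- 1 - \<nu>) = 1 / ln (exp 1 + norm y) powr (1 + \<nu>)"
    using powr_minus_divide[of "ln (exp 1 + norm y)" "1 + \<nu>"] by simp
  moreover have "(1 + norm y) powr (- (real CARD('n) + m) / 2) = 1 / (1 + norm y) powr ((real CARD('n) + m) / 2)"
    unfolding minus_divide_left[symmetric] by (rule powr_minus_divide)
  ultimately show ?thesis
    unfolding phi_def phi_radial_def by (simp only: powr_minus_divide) simp
qed

lemma ln_e_plus: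
  fixes r :: real
  assumes "0 \<le> r"
  shows "1 \<le> ln (exp 1 + r)" "ln (exp 1 + r) \<le> 3 * (1 + r)" "exp 1 + r \<le> exp 1 * (1 + r)"
proof -
  have e: "0 < exp 1 + r" using assms by (simp add: add_pos_nonneg)
  show "1 \<le> ln (exp 1 + r)"
    using assms e by (subst ln_ge_iff) auto
  have "ln (exp 1 + r) \<le> exp 1 + r - 1"
    using e by (rule ln_le_minus_one)
  also have "exp 1 \<le> (3::real)" by (rule exp_le)
  finally show "ln (exp 1 + r) \<le> 3 * (1 + r)" using assms by simp
  show "exp 1 + r \<le> exp 1 * (1 + r)"
    using assms mult_right_mono[of 1 "exp 1" r] by (simp add: algebra_simps)
qed

lemma phi_radial_pos: "0 \<le> r \<Longrightarrow> 0 < phi_radial b \<nu> r"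
  using ln_e_plus(1)[of r] by (auto simp: phi_radial_def)

lemma phi_pos: "0 < phi m \<nu> y"
  unfolding phi_eq_radial by (simp add: phi_radial_pos)

text \<open>
  \<open>phi_radial\<close> decays only polynomially, so every exponentially small contribution is absorbed by it.
  The rate \<open>1/32\<close> is the one that occurs in the kernel estimates below.
\<close>
lemma phi_radial_ge_exp:
  fixes b \<nu> :: real
  assumes "0 \<le> b" "0 < \<nu>"
  obtains C where "0 < C" "\<And>r. 0 \<le> r \<Longrightarrow> exp (- r / 32) \<le> C * phi_radial b \<nu> r"
proof -
  define N where "N = b / 2 + 1 + \<nu>"
  obtain C where C: "0 < C" "\<And>v. 0 < v \<Longrightarrow> v powr N * exp (- (1 / 32) * v) \<le> C"
    using powr_exp_bounded[of N "1 / 32"] assms by (auto simp: N_def)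
  have main: "exp (- r / 32) \<le> (exp (1 / 32) * C * 3 powr (1 + \<nu>)) * ((1 + r) powr (- b / 2) * ln (exp 1 + r) powr (- 1 - \<nu>))"
    if r: "0 \<le> r" for r
  proof -
    let ?l = "ln (exp 1 + r)"
    note l = ln_e_plus[OF r]
    have "(1 + r) powr (b / 2) * ?l powr (1 + \<nu>) \<le> (1 + r) powr (b / 2) * (3 * (1 + r)) powr (1 + \<nu>)"
      using assms l by (intro mult_left_mono powr_mono2) auto
    also have "\<dots> = 3 powr (1 + \<nu>) * (1 + r) powr N"
      unfolding powr_mult N_def by (simp add: powr_add[symmetric] add_ac mult_ac)
    finally have "exp (- r / 32) * ((1 + r) powr (b / 2) * ?l powr (1 + \<nu>))
        \<le> exp (- r / 32) * (3 powr (1 + \<nu>) * (1 + r) powr N)"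
      by simp
    also have "\<dots> = exp (1 / 32) * 3 powr (1 + \<nu>) * ((1 + r) powr N * exp (- (1 / 32) * (1 + r)))"
      by (simp add: field_simps flip: exp_add)
    also have "\<dots> \<le> exp (1 / 32) * 3 powr (1 + \<nu>) * C"
      using r by (intro mult_left_mono C(2)) auto
    finally have "exp (- r / 32) \<le> exp (1 / 32) * 3 powr (1 + \<nu>) * C / ((1 + r) powr (b / 2) * ?l powr (1 + \<nu>))"
      using r l by (subst pos_le_divide_eq) auto
    also have "\<dots> = (exp (1 / 32) * C * 3 powr (1 + \<nu>)) * ((1 + r) powr (- b / 2) * ?l powr (- 1 - \<nu>))"
      using powr_minus_divide[of ?l "1 + \<nu>"] by (simp add: powr_minus_divide)
    finally show ?thesis .
  qed
  show thesis
  proof (rule that)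
    show "0 < exp (1 / 32) * C * 3 powr (1 + \<nu>)" using C by simp
    fix r :: real assume r: "0 \<le> r"
    show "exp (- r / 32) \<le> (exp (1 / 32) * C * 3 powr (1 + \<nu>)) * phi_radial b \<nu> r"
    proof (cases "b = 0")
      case True
      have "ln (exp 1 + r) powr (- 1 - \<nu>) \<le> ln (exp 1 + r) powr (- \<nu>)"
        using ln_e_plus(1)[OF r] by (intro powr_mono) auto
      then have "(1 + r) powr (- b / 2) * ln (exp 1 + r) powr (- 1 - \<nu>) \<le> phi_radial b \<nu> r"
        using True r by (simp add: phi_radial_def)
      then show ?thesis
        using C(1) by (intro order.trans[OF main[OF r]] mult_left_mono) auto
    qed (use main[OF r] in \<open>simp add: phi_radial_def\<close>)
  qed
qed

text \<open>
  For \<open>u \<le> ln (e + r) / 4\<close> the factor with \<open>e\<^bsup>-4u\<^esup> r\<^sup>2\<close> is exponentially small in \<open>r\<close>. For larger \<open>u\<close>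
  one may freeze \<open>u\<^bsup>-1-\<nu>\<^esup>\<close> at the lower end point if \<open>b > 0\<close>: the rest decays exponentially on both sides of
  \<open>u\<^sub>0 = ln (1 + r) / 2\<close>, where it has size \<open>(1 + r)\<^bsup>-b/2\<^esup>\<close>. If \<open>b = 0\<close> there is no
  such decay, the tail of \<open>u\<^bsup>-1-\<nu>\<^esup>\<close> is integrated instead, and one logarithm is lost.
\<close>
lemma large_time_integral:
  fixes b \<nu> :: real
  assumes "0 \<le> b" "0 < \<nu>"
  obtains C where "0 < C" "\<And>r. 1 \<le> r \<Longrightarrow>
    (\<integral>\<^sup>+u. ennreal (exp (- u * b) * exp (- exp (- 4 * u) * r\<^sup>2 / 8) * u powr (- 1 - \<nu>)) * indicator {1 / 4..} u \<partial>lborel)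
      \<le> ennreal (C * phi_radial b \<nu> r)"
proof -
  let ?G = "\<lambda>r u. exp (- u * b) * exp (- exp (- 4 * u) * r\<^sup>2 / 8) * u powr (- 1 - \<nu>)"
  obtain C1 where C1: "0 < C1" "\<And>r. 0 \<le> r \<Longrightarrow> exp (- r / 32) \<le> C1 * phi_radial b \<nu> r"
    using phi_radial_ge_exp assms by blast
  have small: "(\<integral>\<^sup>+u. ennreal (?G r u) * indicator {1 / 4..<ln (exp 1 + r) / 4} u \<partial>lborel)
      \<le> ennreal (C1 * (4 powr \<nu> / \<nu>) * phi_radial b \<nu> r)" if r: "1 \<le> r" for r
  proof -
    have "(\<integral>\<^sup>+u. ennreal (?G r u) * indicator {1 / 4..<ln (exp 1 + r) / 4} u \<partial>lborel)
        \<le> (\<integral>\<^sup>+u. ennreal (C1 * phi_radial b \<nu> r) * (ennreal (u powr (- 1 - \<nu>)) * indicator {1 / 4..} u) \<partial>lborel)"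
    proof (intro nn_integral_mono)
      fix u :: real
      have "?G r u \<le> C1 * phi_radial b \<nu> r * u powr (- 1 - \<nu>)" if u: "1 / 4 \<le> u" "u < ln (exp 1 + r) / 4"
      proof -
        have "exp (4 * u) \<le> exp 1 + r"
        proof -
          have "exp (4 * u) \<le> exp (ln (exp 1 + r))" using u by simp
          also have "\<dots> = exp 1 + r" using r by (subst exp_ln) (auto simp: add_pos_pos)
          finally show ?thesis .
        qed
        also have "\<dots> \<le> 4 * r" using exp_le r by simp
        finally have e: "exp (4 * u) \<le> 4 * r" .
        have "r / 4 \<le> exp (- 4 * u) * r\<^sup>2"
        proof -
          have "exp (4 * u) * r \<le> 4 * r * r" using e r by (intro mult_right_mono) auto
          then show ?thesis
            using r by (simp add: exp_minus field_simps power2_eq_square)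
        qed
        then have "exp (- exp (- 4 * u) * r\<^sup>2 / 8) \<le> exp (- r / 32)" by simp
        also have "\<dots> \<le> C1 * phi_radial b \<nu> r" using r by (intro C1) auto
        finally have "exp (- u * b) * exp (- exp (- 4 * u) * r\<^sup>2 / 8) \<le> 1 * (C1 * phi_radial b \<nu> r)"
          using u assms by (intro mult_mono) auto
        then show ?thesis by (intro mult_right_mono) auto
      qed
      then show "ennreal (?G r u) * indicator {1 / 4..<ln (exp 1 + r) / 4} u
          \<le> ennreal (C1 * phi_radial b \<nu> r) * (ennreal (u powr (- 1 - \<nu>)) * indicator {1 / 4..} u)"
        using C1(1) phi_radial_pos[of r b \<nu>] r by (auto simp: indicator_def ennreal_mult[symmetric] intro!: ennreal_leI)
    qed
    also have "\<dots> = ennreal (C1 * phi_radial b \<nu> r) * ennreal ((1 / 4) powr (- \<nu>) / \<nu>)"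
      using assms by (subst nn_integral_cmult) (auto simp: nn_integral_powr_to_infinity)
    also have "\<dots> = ennreal (C1 * (4 powr \<nu> / \<nu>) * phi_radial b \<nu> r)"
      using assms C1(1) phi_radial_pos[of r b \<nu>] r by (simp add: ennreal_mult[symmetric] powr_minus_divide powr_divide)
    finally show ?thesis .
  qed
  obtain C2 where C2: "0 < C2" "\<And>r. 1 \<le> r \<Longrightarrow>
    (\<integral>\<^sup>+u. ennreal (?G r u) * indicator {ln (exp 1 + r) / 4..} u \<partial>lborel) \<le> ennreal (C2 * phi_radial b \<nu> r)"
  proof (cases "b = 0")
    case True
    show thesis
    proof (rule that)
      show "0 < 4 powr \<nu> / \<nu>" using assms by simp
      fix r :: real assume r: "1 \<le> r"
      have l: "1 \<le> ln (exp 1 + r)" using r by (intro ln_e_plus) auto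
      have "(\<integral>\<^sup>+u. ennreal (?G r u) * indicator {ln (exp 1 + r) / 4..} u \<partial>lborel)
        \<le> (\<integral>\<^sup>+u. ennreal (u powr (- 1 - \<nu>)) * indicator {ln (exp 1 + r) / 4..} u \<partial>lborel)"
        using True by (intro nn_integral_mono mult_right_mono ennreal_leI) (auto intro!: mult_left_le_one_le)
      also have "\<dots> = ennreal ((ln (exp 1 + r) / 4) powr (- \<nu>) / \<nu>)"
        using l assms by (intro nn_integral_powr_to_infinity) auto
      also have "\<dots> = ennreal (4 powr \<nu> / \<nu> * phi_radial b \<nu> r)"
        using True l by (simp add: phi_radial_def powr_divide powr_minus_divide mult.commute)
      finally show "(\<integral>\<^sup>+u. ennreal (?G r u) * indicator {ln (exp 1 + r) / 4..} u \<partial>lborel)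
        \<le> ennreal (4 powr \<nu> / \<nu> * phi_radial b \<nu> r)" .
    qed
  next
    case False
    then have b: "0 < b" using assms by simp
    obtain K where K: "0 < K" "\<And>v. 0 < v \<Longrightarrow> v powr (b / 2) * exp (- (1 / 32) * v) \<le> K"
      using powr_exp_bounded[of "b / 2" "1 / 32"] b by auto
    define D where "D = (max 1 K) * 4 powr (1 + \<nu>) * (2 / b)"
    show thesis
    proof (rule that)
      show "0 < D" using b by (simp add: D_def)
      fix r :: real assume r: "1 \<le> r"
      define l where "l = ln (exp 1 + r)"
      define u0 where "u0 = ln (1 + r) / 2"
      have l: "1 \<le> l" using r unfolding l_def by (intro ln_e_plus) auto
      have e0: "exp (2 * u0) = 1 + r" using r by (simp add: u0_def)
      \<comment> \<open>for \<open>u < u\<^sub>0\<close> the double exponential beats any power of \<open>v = e\<^bsup>4(u\<^sub>0-u)\<^esup>\<close>, in particular \<open>v\<^bsup>b/2\<^esup>\<close>\<close>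
      have key: "exp (- u * b) * exp (- exp (- 4 * u) * r\<^sup>2 / 8) \<le> max 1 K * (1 + r) powr (- b / 2) * exp (- b * \<bar>u - u0\<bar>)" for u
      proof -
        have split: "exp (- u * b) = (1 + r) powr (- b / 2) * exp (- b * (u - u0))"
        proof -
          have "(1 + r) powr (- b / 2) = exp (- b * u0)"
            unfolding e0[symmetric] exp_powr_real by simp
          then show ?thesis by (simp add: algebra_simps flip: exp_add)
        qed
        have "exp (- b * (u - u0)) * exp (- exp (- 4 * u) * r\<^sup>2 / 8) \<le> max 1 K * exp (- b * \<bar>u - u0\<bar>)"
        proof (cases "u0 \<le> u")
          case True
          then have "exp (- b * (u - u0)) * exp (- exp (- 4 * u) * r\<^sup>2 / 8) \<le> exp (- b * \<bar>u - u0\<bar>) * 1"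
            by (intro mult_mono) auto
          also have "\<dots> \<le> max 1 K * exp (- b * \<bar>u - u0\<bar>)" by simp
          finally show ?thesis .
        next
          case False
          define v where "v = exp (4 * (u0 - u))"
          have "v / 32 \<le> exp (- 4 * u) * r\<^sup>2 / 8"
          proof -
            have "v = exp (- 4 * u) * (exp (2 * u0))\<^sup>2"
              by (simp add: v_def exp_double[symmetric] flip: exp_add)
            also have "\<dots> = exp (- 4 * u) * (1 + r)\<^sup>2" by (simp only: e0)
            also have "\<dots> \<le> exp (- 4 * u) * (2 * r)\<^sup>2"
              using r by (intro mult_left_mono power_mono) auto
            finally show ?thesis by (simp add: power_mult_distrib)
          qed
          then have "exp (- exp (- 4 * u) * r\<^sup>2 / 8) \<le> exp (- (1 / 32) * v)" by simp
          also have "\<dots> \<le> K / v powr (b / 2)"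
            using K(2)[of v] by (simp add: v_def field_simps)
          also have "v powr (b / 2) = exp (2 * b * (u0 - u))"
            by (simp add: v_def exp_powr_real algebra_simps)
          finally have "exp (- b * (u - u0)) * exp (- exp (- 4 * u) * r\<^sup>2 / 8)
              \<le> exp (- b * (u - u0)) * (K / exp (2 * b * (u0 - u)))" by (rule mult_left_mono) simp
          also have "\<dots> = K * exp (- b * \<bar>u - u0\<bar>)"
            using False by (simp add: field_simps flip: exp_add exp_diff exp_minus)
          also have "\<dots> \<le> max 1 K * exp (- b * \<bar>u - u0\<bar>)" by (intro mult_right_mono) auto
          finally show ?thesis .
        qed
        then have "(1 + r) powr (- b / 2) * (exp (- b * (u - u0)) * exp (- exp (- 4 * u) * r\<^sup>2 / 8))
            \<le> (1 + r) powr (- b / 2) * (max 1 K * exp (- b * \<bar>u - u0\<bar>))"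
          by (intro mult_left_mono) auto
        then show ?thesis unfolding split by (simp add: mult_ac)
      qed
      have "(\<integral>\<^sup>+u. ennreal (?G r u) * indicator {l / 4..} u \<partial>lborel)
        \<le> (\<integral>\<^sup>+u. ennreal (max 1 K * (1 + r) powr (- b / 2) * (l / 4) powr (- 1 - \<nu>)) * ennreal (exp (- b * \<bar>u - u0\<bar>)) \<partial>lborel)"
      proof (intro nn_integral_mono)
        fix u :: real
        have "?G r u \<le> max 1 K * (1 + r) powr (- b / 2) * (l / 4) powr (- 1 - \<nu>) * exp (- b * \<bar>u - u0\<bar>)" if u: "l / 4 \<le> u"
        proof -
          have "u powr (- 1 - \<nu>) \<le> (l / 4) powr (- 1 - \<nu>)"
            using u l assms by (intro powr_mono2') auto
          then have "?G r u \<le> (max 1 K * (1 + r) powr (- b / 2) * exp (- b * \<bar>u - u0\<bar>)) * (l / 4) powr (- 1 - \<nu>)"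
            by (intro mult_mono[OF key[of u]]) auto
          then show ?thesis by (simp add: mult_ac)
        qed
        then show "ennreal (?G r u) * indicator {l / 4..} u
          \<le> ennreal (max 1 K * (1 + r) powr (- b / 2) * (l / 4) powr (- 1 - \<nu>)) * ennreal (exp (- b * \<bar>u - u0\<bar>))"
          by (auto simp: indicator_def ennreal_mult[symmetric] intro!: ennreal_leI)
      qed
      also have "\<dots> = ennreal (max 1 K * (1 + r) powr (- b / 2) * (l / 4) powr (- 1 - \<nu>)) * (\<integral>\<^sup>+u. ennreal (exp (- b * \<bar>u - u0\<bar>)) \<partial>lborel)"
        by (subst nn_integral_cmult) auto
      also have "\<dots> \<le> ennreal (max 1 K * (1 + r) powr (- b / 2) * (l / 4) powr (- 1 - \<nu>)) * ennreal (2 / b)"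
        using b by (intro mult_left_mono nn_integral_exp_abs) auto
      also have "\<dots> = ennreal (D * phi_radial b \<nu> r)"
      proof -
        have "(l / 4) powr (- 1 - \<nu>) = 4 powr (1 + \<nu>) * l powr (- 1 - \<nu>)"
          using l powr_minus_divide[of 4 "1 + \<nu>"] by (simp add: powr_divide)
        then show ?thesis
          using b by (simp add: D_def phi_radial_def l_def ennreal_mult[symmetric] mult_ac)
      qed
      finally show "(\<integral>\<^sup>+u. ennreal (?G r u) * indicator {ln (exp 1 + r) / 4..} u \<partial>lborel)
        \<le> ennreal (D * phi_radial b \<nu> r)" by (simp add: l_def)
    qed
  qed
  show thesis
  proof (rule that)
    show "0 < C1 * (4 powr \<nu> / \<nu>) + C2" using C1 C2 assms by (simp add: add_pos_pos)
    fix r :: real assume r: "1 \<le> r"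
    have "(\<integral>\<^sup>+u. ennreal (?G r u) * indicator {1 / 4..} u \<partial>lborel)
      \<le> (\<integral>\<^sup>+u. ennreal (?G r u) * indicator {1 / 4..<ln (exp 1 + r) / 4} u + ennreal (?G r u) * indicator {ln (exp 1 + r) / 4..} u \<partial>lborel)"
      by (intro nn_integral_mono) (auto simp: indicator_def)
    also have "\<dots> = (\<integral>\<^sup>+u. ennreal (?G r u) * indicator {1 / 4..<ln (exp 1 + r) / 4} u \<partial>lborel)
       + (\<integral>\<^sup>+u. ennreal (?G r u) * indicator {ln (exp 1 + r) / 4..} u \<partial>lborel)"
      by (rule nn_integral_add) auto
    also have "\<dots> \<le> ennreal (C1 * (4 powr \<nu> / \<nu>) * phi_radial b \<nu> r) + ennreal (C2 * phi_radial b \<nu> r)"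
      by (intro add_mono small C2 r)
    also have "\<dots> = ennreal ((C1 * (4 powr \<nu> / \<nu>) + C2) * phi_radial b \<nu> r)"
      using C1 C2 assms phi_radial_pos[of r b \<nu>] r by (simp add: algebra_simps flip: ennreal_plus)
    finally show "(\<integral>\<^sup>+u. ennreal (?G r u) * indicator {1 / 4..} u \<partial>lborel)
      \<le> ennreal ((C1 * (4 powr \<nu> / \<nu>) + C2) * phi_radial b \<nu> r)" .
  qed
qed

section \<open>The time integral of the heat kernel compared with \<phi>\<close>

lemma heat_kernel_measurable [measurable]:
  fixes f g :: "'a \<Rightarrow> real ^ 'n"
  assumes [measurable]: "h \<in> borel_measurable M" "f \<in> borel_measurable M" "g \<in> borel_measurable M"
  shows "(\<lambda>w. heat_kernel m (h w) (f w) (g w)) \<in> borel_measurable M"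
proof -
  have [measurable]: "(sinh :: real \<Rightarrow> real) \<in> borel_measurable borel" "(tanh :: real \<Rightarrow> real) \<in> borel_measurable borel"
    by (intro borel_measurable_continuous_onI continuous_intros; simp)+
  show ?thesis unfolding heat_kernel_def by measurable
qed

text \<open>
  The distance from \<open>y\<close> to the ball of radius \<open>k\<close> is of order \<open>\<bar>y\<bar>\<close>, and the Gaussian factor
  \<open>e\<^bsup>-c\<bar>y\<bar>\<^sup>2/u\<^esup>\<close> pays both for the singular powers of \<open>u\<close> and for an additional decay in \<open>y\<close>. The
  constant \<open>16\<close> lets the quadratic term in \<open>z\<close> absorb the linear term \<open>k z\<close>.
\<close>
lemma small_time_bound:
  fixes \<nu> k :: real
  assumes "0 < \<nu>" "0 \<le> k"
  obtains C where "0 < C" "\<And>m u :: real. \<And>x y :: real ^ 'n. - real CARD('n) \<le> m \<Longrightarrow> 0 < u \<Longrightarrow> u \<le> 1 / 4 \<Longrightarrow>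
      norm x \<le> k \<Longrightarrow> 1 \<le> norm y \<Longrightarrow> 16 * k \<le> norm y \<Longrightarrow>
      heat_kernel m u x y * u powr (- 1 - \<nu>) \<le> C * (exp (- (norm y)\<^sup>2 / 2) * exp (- norm y / 32))"
proof -
  define d where "d = real CARD('n)"
  \<comment> \<open>the total power of \<open>1 / u\<close>: \<open>d / 2\<close> from the prefactor and \<open>1 + \<nu>\<close> from the measure\<close>
  define N where "N = d / 2 + 1 + \<nu>"
  obtain K where K: "0 < K" "\<And>v. 0 < v \<Longrightarrow> v powr N * exp (- (1 / 128) * v) \<le> K"
    using powr_exp_bounded[of N "1 / 128"] assms by (auto simp: N_def d_def)
  show thesis
  proof (rule that)
    show "0 < 2 powr (d / 2) * K" using K by simp
    fix m u :: real and x y :: "real ^ 'n"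
    assume m: "- real CARD('n) \<le> m" and u: "0 < u" "u \<le> 1 / 4" and x: "norm x \<le> k"
      and y: "1 \<le> norm y" "16 * k \<le> norm y"
    define s where "s = tanh u"
    define r where "r = norm y"
    define z where "z = (1 - s) * r"
    have s: "0 < s" "s \<le> 2 * u" "1 / s \<le> 1 + 1 / u" using tanh_bounds[OF u(1)] by (auto simp: s_def)
    have "1 / 2 * r \<le> z" unfolding z_def using s u y by (intro mult_right_mono) (auto simp: r_def)
    then have z: "r / 2 \<le> z" by simp
    then have "8 * k * z \<le> z * z" using y by (intro mult_right_mono) (auto simp: r_def)
    moreover have "(r / 2) * (r / 2) \<le> z * z" using z y by (intro mult_mono) (auto simp: r_def)
    ultimately have num: "k * z - z\<^sup>2 / 4 \<le> - r\<^sup>2 / 32"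
      by (simp add: power2_eq_square)
    have "(k * z - z\<^sup>2 / 4) / s \<le> (- r\<^sup>2 / 32) / s"
      using num s by (intro divide_right_mono) auto
    also have "\<dots> \<le> (- r\<^sup>2 / 32) / (2 * u)"
      using s u by (intro divide_left_mono_neg) auto
    also have "\<dots> = - (1 / 128) * (1 / u) * r\<^sup>2 - (1 / 128) * (1 / u) * r\<^sup>2" by simp
    also have "\<dots> \<le> - (1 / 128) * (1 / u) * 1 - (1 / 128) * 4 * r"
    proof -
      have "1 * 1 \<le> r * r" "1 * r \<le> r * r"
        using y by (intro mult_mono; simp add: r_def)+
      then have "1 \<le> r\<^sup>2" "r \<le> r\<^sup>2" by (simp_all add: power2_eq_square)
      moreover have "4 \<le> 1 / u" using u by (simp add: field_simps)
      moreover have "1 / u * 1 \<le> 1 / u * r\<^sup>2"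
        using \<open>1 \<le> r\<^sup>2\<close> u by (intro mult_left_mono) auto
      moreover have "4 * r \<le> 1 / u * r\<^sup>2"
        using \<open>4 \<le> 1 / u\<close> \<open>r \<le> r\<^sup>2\<close> y u by (intro mult_mono) (auto simp: r_def)
      ultimately show ?thesis by simp
    qed
    finally have E: "(k * z - z\<^sup>2 / 4) / s \<le> - (1 / 128) * (1 / u) - r / 32" by simp
    have "exp (- u * m) * (2 * pi * sinh (2 * u)) powr (- d / 2) \<le> (pi * s) powr (- d / 2) * exp (- u * (d + m))"
      unfolding s_def using u by (intro prefactor_upper) (auto simp: d_def)
    also have "\<dots> \<le> (u / 2) powr (- d / 2) * 1"
    proof (intro mult_mono)
      have "1 / s \<le> 2 / u" using s(3) u by (simp add: field_simps)
      then have "u / 2 \<le> s" using s u by (simp add: field_simps)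
      also have "s \<le> pi * s" using s pi_ge_two by simp
      finally show "(pi * s) powr (- d / 2) \<le> (u / 2) powr (- d / 2)"
        using u by (intro powr_mono2') (auto simp: d_def)
      show "exp (- u * (d + m)) \<le> 1" using u m by (simp add: d_def)
    qed auto
    also have "\<dots> = 2 powr (d / 2) * (1 / u) powr (d / 2)"
      using u by (simp add: powr_divide powr_minus_divide)
    finally have pre: "exp (- u * m) * (2 * pi * sinh (2 * u)) powr (- d / 2) \<le> 2 powr (d / 2) * (1 / u) powr (d / 2)" .
    have "exp (- (norm (x - y))\<^sup>2 / (2 * tanh (2 * u)) - tanh u * (x \<bullet> y)) \<le> exp (- r\<^sup>2 / 2 + (- (1 / 128) * (1 / u) - r / 32))"
      using mehler_exponent_upper[OF u(1) x, of y] E by (simp add: s_def r_def z_def)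
    then have h: "heat_kernel m u x y \<le> 2 powr (d / 2) * (1 / u) powr (d / 2) * exp (- r\<^sup>2 / 2 + (- (1 / 128) * (1 / u) - r / 32))"
      unfolding heat_kernel_def d_def by (intro mult_mono[OF pre[unfolded d_def]]) auto
    have "u powr (- 1 - \<nu>) = (1 / u) powr (1 + \<nu>)"
      using u powr_minus_divide[of u "1 + \<nu>"] by (simp add: powr_divide)
    then have "heat_kernel m u x y * u powr (- 1 - \<nu>)
        \<le> 2 powr (d / 2) * (1 / u) powr (d / 2) * exp (- r\<^sup>2 / 2 + (- (1 / 128) * (1 / u) - r / 32)) * (1 / u) powr (1 + \<nu>)"
      using h by (simp add: mult_right_mono)
    also have "\<dots> = 2 powr (d / 2) * ((1 / u) powr N * exp (- (1 / 128) * (1 / u))) * (exp (- r\<^sup>2 / 2) * exp (- r / 32))"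
    proof -
      have a: "exp (- r\<^sup>2 / 2 + (- (1 / 128) * (1 / u) - r / 32)) = exp (- (1 / 128) * (1 / u)) * (exp (- r\<^sup>2 / 2) * exp (- r / 32))"
        by (simp flip: exp_add)
      have b: "(1 / u) powr N = (1 / u) powr (d / 2) * (1 / u) powr (1 + \<nu>)"
        by (simp add: N_def add.assoc flip: powr_add)
      show ?thesis unfolding a b by (simp only: mult_ac)
    qed
    also have "\<dots> \<le> 2 powr (d / 2) * K * (exp (- r\<^sup>2 / 2) * exp (- r / 32))"
      using u by (intro mult_right_mono mult_left_mono K) auto
    finally show "heat_kernel m u x y * u powr (- 1 - \<nu>)
        \<le> 2 powr (d / 2) * K * (exp (- (norm y)\<^sup>2 / 2) * exp (- norm y / 32))"
      by (simp add: r_def)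
  qed
qed

text \<open>
  Here \<open>tanh u\<close> is bounded below, so the linear term is absorbed by completing the square at the cost of the
  constant \<open>e\<^bsup>10k\<^sup>2\<^esup>\<close>.
\<close>
lemma large_time_bound:
  fixes k u m :: real and x y :: "real ^ 'n"
  assumes u: "1 / 4 \<le> u" and x: "norm x \<le> k"
  shows "heat_kernel m u x y \<le> 5 powr (real CARD('n) / 2) * exp (10 * k\<^sup>2) * exp (- (norm y)\<^sup>2 / 2)
    * (exp (- u * (real CARD('n) + m)) * exp (- exp (- 4 * u) * (norm y)\<^sup>2 / 8))"
proof -
  define d where "d = real CARD('n)"
  define s where "s = tanh u"
  define z where "z = (1 - s) * norm y"
  have u0: "0 < u" using u by simp
  have "1 / u \<le> 4" using u by (simp add: field_simps)
  then have s: "0 < s" "s < 1" "1 / s \<le> 5" "exp (- 2 * u) \<le> 1 - s"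
    using tanh_bounds[OF u0] by (auto simp: s_def)
  have "(k * z - z\<^sup>2 / 4) / s \<le> (2 * k\<^sup>2 - z\<^sup>2 / 8) / s"
  proof (intro divide_right_mono)
    have "0 \<le> (4 * k - z)\<^sup>2" by simp
    then show "k * z - z\<^sup>2 / 4 \<le> 2 * k\<^sup>2 - z\<^sup>2 / 8" by (simp add: power2_eq_square algebra_simps)
  qed (use s in auto)
  also have "\<dots> = 1 / s * (2 * k\<^sup>2) - 1 / s * (z\<^sup>2 / 8)" by (simp add: diff_divide_distrib)
  also have "\<dots> \<le> 5 * (2 * k\<^sup>2) - 1 * (z\<^sup>2 / 8)"
    using s by (intro diff_mono mult_right_mono) (auto simp: field_simps)
  also have "\<dots> \<le> 10 * k\<^sup>2 - exp (- 4 * u) * (norm y)\<^sup>2 / 8"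
  proof -
    have "exp (- 2 * u) * norm y \<le> z" unfolding z_def using s by (intro mult_right_mono) auto
    then have "(exp (- 2 * u) * norm y)\<^sup>2 \<le> z\<^sup>2" by (intro power_mono) auto
    also have "(exp (- 2 * u) * norm y)\<^sup>2 = exp (- 4 * u) * (norm y)\<^sup>2"
      by (simp add: power_mult_distrib flip: exp_double)
    finally show ?thesis by simp
  qed
  finally have E: "- (norm (x - y))\<^sup>2 / (2 * tanh (2 * u)) - tanh u * (x \<bullet> y)
      \<le> - (norm y)\<^sup>2 / 2 + (10 * k\<^sup>2 - exp (- 4 * u) * (norm y)\<^sup>2 / 8)"
    using mehler_exponent_upper[OF u0 x, of y] by (simp add: s_def z_def)
  have "exp (- u * m) * (2 * pi * sinh (2 * u)) powr (- d / 2) \<le> (pi * s) powr (- d / 2) * exp (- u * (d + m))"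
    unfolding s_def using u0 by (intro prefactor_upper) (auto simp: d_def)
  also have "\<dots> \<le> (1 / 5) powr (- d / 2) * exp (- u * (d + m))"
  proof (intro mult_right_mono powr_mono2')
    have "1 / 5 \<le> s" using s by (simp add: field_simps)
    also have "s \<le> pi * s" using s pi_ge_two by simp
    finally show "1 / 5 \<le> pi * s" .
  qed (auto simp: d_def)
  also have "(1 / 5) powr (- d / 2) = 5 powr (d / 2)"
    by (simp add: powr_divide powr_minus_divide)
  finally have pre: "exp (- u * m) * (2 * pi * sinh (2 * u)) powr (- d / 2) \<le> 5 powr (d / 2) * exp (- u * (d + m))" .
  have "heat_kernel m u x y \<le> 5 powr (d / 2) * exp (- u * (d + m)) * exp (- (norm y)\<^sup>2 / 2 + (10 * k\<^sup>2 - exp (- 4 * u) * (norm y)\<^sup>2 / 8))"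
    unfolding heat_kernel_def d_def by (intro mult_mono[OF pre[unfolded d_def]]) (use E in auto)
  also have "exp (- (norm y)\<^sup>2 / 2 + (10 * k\<^sup>2 - exp (- 4 * u) * (norm y)\<^sup>2 / 8))
      = exp (10 * k\<^sup>2) * exp (- (norm y)\<^sup>2 / 2) * exp (- exp (- 4 * u) * (norm y)\<^sup>2 / 8)"
    by (simp flip: exp_add)
  finally show ?thesis by (simp add: d_def mult_ac)
qed

lemma time_integral_heat_kernel_upper:
  fixes \<nu> k m :: real
  assumes \<nu>: "0 < \<nu>" and k: "0 \<le> k" and m: "- real CARD('n) \<le> m"
  obtains C where "0 < C" "\<And>x (y :: real ^ 'n). norm x \<le> k \<Longrightarrow> 1 \<le> norm y \<Longrightarrow> 16 * k \<le> norm y \<Longrightarrow>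
      (\<integral>\<^sup>+u\<in>{0<..}. ennreal (heat_kernel m u x y * u powr (- 1 - \<nu>)) \<partial>lborel) \<le> ennreal (C * phi m \<nu> y)"
proof -
  define b where "b = real CARD('n) + m"
  have b: "0 \<le> b" using m by (simp add: b_def)
  obtain C1 where C1: "0 < C1" "\<And>u x (y :: real ^ 'n). 0 < u \<Longrightarrow> u \<le> 1 / 4 \<Longrightarrow>
      norm x \<le> k \<Longrightarrow> 1 \<le> norm y \<Longrightarrow> 16 * k \<le> norm y \<Longrightarrow>
      heat_kernel m u x y * u powr (- 1 - \<nu>) \<le> C1 * (exp (- (norm y)\<^sup>2 / 2) * exp (- norm y / 32))"
    by (rule small_time_bound[OF \<nu> k, where 'n = 'n]) (use m in blast)
  obtain C2 where C2: "0 < C2" "\<And>r. 0 \<le> r \<Longrightarrow> exp (- r / 32) \<le> C2 * phi_radial b \<nu> r"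
    using phi_radial_ge_exp b \<nu> by blast
  let ?G = "\<lambda>r u. exp (- u * b) * exp (- exp (- 4 * u) * r\<^sup>2 / 8) * u powr (- 1 - \<nu>)"
  obtain C3 where C3: "0 < C3" "\<And>r. 1 \<le> r \<Longrightarrow>
    (\<integral>\<^sup>+u. ennreal (?G r u) * indicator {1 / 4..} u \<partial>lborel) \<le> ennreal (C3 * phi_radial b \<nu> r)"
    using large_time_integral b \<nu> by blast
  define D where "D = 5 powr (real CARD('n) / 2) * exp (10 * k\<^sup>2)"
  have D: "0 < D" by (simp add: D_def)
  show thesis
  proof (rule that)
    show "0 < C1 * C2 + D * C3" using C1 C2 C3 D by (simp add: add_pos_pos)
    fix x y :: "real ^ 'n"
    assume x: "norm x \<le> k" and y: "1 \<le> norm y" "16 * k \<le> norm y"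
    let ?g = "exp (- (norm y)\<^sup>2 / 2)"
    let ?h = "\<lambda>u. ennreal (heat_kernel m u x y * u powr (- 1 - \<nu>))"
    have "(\<integral>\<^sup>+u\<in>{0<..}. ?h u \<partial>lborel) \<le> (\<integral>\<^sup>+u. ennreal (C1 * (?g * exp (- norm y / 32))) * indicator {0..1} u
        + ennreal (D * ?g) * (ennreal (?G (norm y) u) * indicator {1 / 4..} u) \<partial>lborel)"
    proof (intro nn_integral_mono)
      fix u :: real
      consider "u \<le> 0" | "0 < u" "u \<le> 1 / 4" | "1 / 4 < u" by linarith
      then show "?h u * indicator {0<..} u \<le> ennreal (C1 * (?g * exp (- norm y / 32))) * indicator {0..1} u
        + ennreal (D * ?g) * (ennreal (?G (norm y) u) * indicator {1 / 4..} u)"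
      proof cases
        case 2
        have "?h u \<le> ennreal (C1 * (?g * exp (- norm y / 32)))"
          using C1(2)[OF 2 x y] by (rule ennreal_leI)
        with 2 show ?thesis by (simp add: add_increasing2)
      next
        case 3
        have "heat_kernel m u x y * u powr (- 1 - \<nu>)
            \<le> D * ?g * (exp (- u * b) * exp (- exp (- 4 * u) * (norm y)\<^sup>2 / 8)) * u powr (- 1 - \<nu>)"
          unfolding D_def b_def using 3 x by (intro mult_right_mono large_time_bound) auto
        then have "?h u \<le> ennreal (D * ?g * ?G (norm y) u)"
          by (intro ennreal_leI) (simp add: mult.assoc)
        also have "\<dots> = ennreal (D * ?g) * ennreal (?G (norm y) u)"
          using D by (subst ennreal_mult[symmetric]) auto
        finally show ?thesis
          using 3 by (simp add: add_increasing)
      qed auto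
    qed
    also have "\<dots> = ennreal (C1 * (?g * exp (- norm y / 32)))
        + ennreal (D * ?g) * (\<integral>\<^sup>+u. ennreal (?G (norm y) u) * indicator {1 / 4..} u \<partial>lborel)"
      by (subst nn_integral_add; measurable; simp add: nn_integral_cmult nn_integral_cmult_indicator)
    also have "\<dots> \<le> ennreal (C1 * (?g * (C2 * phi_radial b \<nu> (norm y)))) + ennreal (D * ?g) * ennreal (C3 * phi_radial b \<nu> (norm y))"
      using C1 C2 y by (intro add_mono mult_left_mono C3 ennreal_leI) auto
    also have "\<dots> = ennreal ((C1 * C2 + D * C3) * phi m \<nu> y)"
      using C1 C2 C3 D phi_radial_pos[of "norm y" b \<nu>]
      by (simp add: phi_eq_radial b_def algebra_simps flip: ennreal_mult ennreal_plus)
    finally show "(\<integral>\<^sup>+u\<in>{0<..}. ?h u \<partial>lborel) \<le> ennreal ((C1 * C2 + D * C3) * phi m \<nu> y)" .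
  qed
qed

abbreviation subordinator :: "real \<Rightarrow> real \<Rightarrow> real \<Rightarrow> real" where
  "subordinator \<nu> t u \<equiv> exp (- t\<^sup>2 / (4 * u)) / u powr (1 + \<nu>)"

text \<open>The kernel of \<open>P\<^sub>t\<close> up to a factor that depends on \<open>t\<close> only.\<close>
abbreviation poisson_kernel :: "real \<Rightarrow> real \<Rightarrow> real \<Rightarrow> real ^ 'n \<Rightarrow> real ^ 'n \<Rightarrow> ennreal" where
  "poisson_kernel m \<nu> t x y \<equiv> \<integral>\<^sup>+u\<in>{0<..}. ennreal (subordinator \<nu> t u * heat_kernel m u x y) \<partial>lborel"

text \<open>
  Only the times \<open>u \<ge> ln (e + \<bar>y\<bar>) / 2\<close> are used, where the kernel is bounded below by the ground state times
  \<open>e\<^bsup>-u(d+m)\<^esup>\<close>. If \<open>d + m > 0\<close> an interval of length one at the lower end already has the right mass; if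
  \<open>d + m = 0\<close> the whole half line is needed.
\<close>
lemma time_integral_heat_kernel_lower:
  fixes \<nu> m t :: real
  assumes \<nu>: "0 < \<nu>" and m: "- real CARD('n) \<le> m" 
  obtains c where "0 < c" "\<And>x (y :: real ^ 'n). norm x \<le> 1 \<Longrightarrow>
      ennreal (c * phi m \<nu> y) \<le> poisson_kernel m \<nu> t x y"
proof -
  define d where "d = real CARD('n)"
  define b where "b = d + m"
  have b: "0 \<le> b" using m by (simp add: b_def d_def)
  define c0 where "c0 = exp (- t\<^sup>2 / 2) * pi powr (- d / 2) * exp (- 13)"
  have c0: "0 < c0" by (simp add: c0_def)
  obtain c1 where c1: "0 < c1" "\<And>r. 0 \<le> r \<Longrightarrow> ennreal (c1 * phi_radial b \<nu> r)
      \<le> (\<integral>\<^sup>+u. ennreal (exp (- u * b) * u powr (- 1 - \<nu>)) * indicator {ln (exp 1 + r) / 2..} u \<partial>lborel)"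
  proof (cases "b = 0")
    case True
    show thesis
    proof (rule that)
      show "0 < 2 powr \<nu> / \<nu>" using \<nu> by simp
      fix r :: real assume r: "0 \<le> r"
      have "(\<integral>\<^sup>+u. ennreal (u powr (- 1 - \<nu>)) * indicator {ln (exp 1 + r) / 2..} u \<partial>lborel)
          = ennreal ((ln (exp 1 + r) / 2) powr (- \<nu>) / \<nu>)"
        using ln_e_plus(1)[OF r] \<nu> by (intro nn_integral_powr_to_infinity) auto
      also have "(ln (exp 1 + r) / 2) powr (- \<nu>) / \<nu> = 2 powr \<nu> / \<nu> * phi_radial b \<nu> r"
        using True ln_e_plus(1)[OF r] by (simp add: phi_radial_def powr_divide powr_minus_divide mult.commute)
      finally show "ennreal (2 powr \<nu> / \<nu> * phi_radial b \<nu> r)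
        \<le> (\<integral>\<^sup>+u. ennreal (exp (- u * b) * u powr (- 1 - \<nu>)) * indicator {ln (exp 1 + r) / 2..} u \<partial>lborel)"
        using True by simp
    qed
  next
    case False
    show thesis
    proof (rule that)
      show "0 < exp (- (3 / 2) * b) * 2 powr (- 1 - \<nu>)" by simp
      fix r :: real assume r: "0 \<le> r"
      define l where "l = ln (exp 1 + r)"
      have l: "1 \<le> l" using ln_e_plus(1)[OF r] by (simp add: l_def)
      have "(exp 1 * (1 + r)) powr (- b / 2) \<le> (exp 1 + r) powr (- b / 2)"
        using ln_e_plus(3)[OF r] b r by (intro powr_mono2') (auto simp: add_pos_nonneg)
      also have "exp 1 + r = exp l" using r by (simp add: l_def add_pos_nonneg)
      finally have A: "exp (- b / 2) * (1 + r) powr (- b / 2) \<le> exp (- b * l / 2)"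
        using r by (simp add: powr_mult exp_powr_real mult.commute)
      have "exp (- (3 / 2) * b) * 2 powr (- 1 - \<nu>) * phi_radial b \<nu> r
          = exp (- b) * (exp (- b / 2) * (1 + r) powr (- b / 2)) * (2 * l) powr (- 1 - \<nu>)"
        using False l by (simp add: phi_radial_def l_def[symmetric] powr_mult mult_ac flip: exp_add)
      also have "\<dots> \<le> exp (- b) * exp (- b * l / 2) * (2 * l) powr (- 1 - \<nu>)"
        using A by (intro mult_right_mono mult_left_mono) auto
      finally have le: "exp (- (3 / 2) * b) * 2 powr (- 1 - \<nu>) * phi_radial b \<nu> r
          \<le> exp (- b) * exp (- b * l / 2) * (2 * l) powr (- 1 - \<nu>)" .
      have "ennreal (exp (- (3 / 2) * b) * 2 powr (- 1 - \<nu>) * phi_radial b \<nu> r)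
          \<le> (\<integral>\<^sup>+u. ennreal (exp (- b) * exp (- b * l / 2) * (2 * l) powr (- 1 - \<nu>)) * indicator {l / 2..l / 2 + 1} u \<partial>lborel)"
        using le by (subst nn_integral_cmult_indicator) (auto intro!: ennreal_leI)
      also have "\<dots> \<le> (\<integral>\<^sup>+u. ennreal (exp (- u * b) * u powr (- 1 - \<nu>)) * indicator {l / 2..} u \<partial>lborel)"
      proof (intro nn_integral_mono)
        fix u :: real
        have "exp (- b) * exp (- b * l / 2) * (2 * l) powr (- 1 - \<nu>) \<le> exp (- u * b) * u powr (- 1 - \<nu>)"
          if u: "l / 2 \<le> u" "u \<le> l / 2 + 1"
        proof (intro mult_mono)
          have "u * b \<le> (l / 2 + 1) * b" using u b by (intro mult_right_mono) auto
          then show "exp (- b) * exp (- b * l / 2) \<le> exp (- u * b)"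
            by (simp add: algebra_simps flip: exp_add)
          show "(2 * l) powr (- 1 - \<nu>) \<le> u powr (- 1 - \<nu>)"
            using u l \<nu> by (intro powr_mono2') auto
        qed auto
        then show "ennreal (exp (- b) * exp (- b * l / 2) * (2 * l) powr (- 1 - \<nu>)) * indicator {l / 2..l / 2 + 1} u
            \<le> ennreal (exp (- u * b) * u powr (- 1 - \<nu>)) * indicator {l / 2..} u"
          by (auto simp: indicator_def intro!: ennreal_leI)
      qed
      finally show "ennreal (exp (- (3 / 2) * b) * 2 powr (- 1 - \<nu>) * phi_radial b \<nu> r)
        \<le> (\<integral>\<^sup>+u. ennreal (exp (- u * b) * u powr (- 1 - \<nu>)) * indicator {ln (exp 1 + r) / 2..} u \<partial>lborel)"
        by (simp add: l_def)
    qed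
  qed
  show thesis
  proof (rule that)
    show "0 < c0 * c1" using c0 c1 by simp
    fix x y :: "real ^ 'n" assume x: "norm x \<le> 1"
    define r where "r = norm y"
    define l where "l = ln (exp 1 + r)"
    have r: "0 \<le> r" by (simp add: r_def)
    have l: "1 \<le> l" using ln_e_plus(1)[OF r] by (simp add: l_def)
    let ?g = "exp (- r\<^sup>2 / 2)"
    have "ennreal (c0 * c1 * phi m \<nu> y) = ennreal (c0 * ?g) * ennreal (c1 * phi_radial b \<nu> r)"
      using c0 c1 phi_radial_pos[OF r, of b \<nu>]
      by (simp add: phi_eq_radial b_def d_def r_def mult_ac flip: ennreal_mult)
    also have "\<dots> \<le> ennreal (c0 * ?g) * (\<integral>\<^sup>+u. ennreal (exp (- u * b) * u powr (- 1 - \<nu>)) * indicator {l / 2..} u \<partial>lborel)"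
      unfolding l_def by (intro mult_left_mono c1 r) auto
    also have "\<dots> = (\<integral>\<^sup>+u. ennreal (c0 * ?g) * (ennreal (exp (- u * b) * u powr (- 1 - \<nu>)) * indicator {l / 2..} u) \<partial>lborel)"
      by (subst nn_integral_cmult) auto
    also have "\<dots> \<le> poisson_kernel m \<nu> t x y"
    proof (intro nn_integral_mono)
      fix u :: real
      have "c0 * ?g * (exp (- u * b) * u powr (- 1 - \<nu>)) \<le> subordinator \<nu> t u * heat_kernel m u x y"
        if u: "l / 2 \<le> u"
      proof -
        have u2: "1 / 2 \<le> u" using u l by simp
        have "1 + norm y \<le> exp l"
          using r by (simp add: l_def r_def add_pos_nonneg)
        also have "\<dots> \<le> exp (2 * u)" using u by simp
        finally have y: "1 + norm y \<le> exp (2 * u)" .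
        have "pi powr (- d / 2) * exp (- u * b) * exp (- r\<^sup>2 / 2 - 13) \<le> heat_kernel m u x y"
          unfolding heat_kernel_def d_def[symmetric] b_def r_def
          using u2 by (intro mult_mono[OF prefactor_lower] iffD2[OF exp_le_cancel_iff] mehler_exponent_lower x y) (auto simp: d_def)
        moreover have "exp (- t\<^sup>2 / 2) \<le> exp (- t\<^sup>2 / (4 * u))"
        proof -
          have "t\<^sup>2 / (4 * u) \<le> t\<^sup>2 / 2" using u2 by (intro divide_left_mono) auto
          then show ?thesis by simp
        qed
        ultimately have "exp (- t\<^sup>2 / 2) * (pi powr (- d / 2) * exp (- u * b) * exp (- r\<^sup>2 / 2 - 13))
            \<le> exp (- t\<^sup>2 / (4 * u)) * heat_kernel m u x y"
          by (intro mult_mono) auto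
        then have "exp (- t\<^sup>2 / 2) * (pi powr (- d / 2) * exp (- u * b) * exp (- r\<^sup>2 / 2 - 13)) * u powr (- 1 - \<nu>)
            \<le> exp (- t\<^sup>2 / (4 * u)) * heat_kernel m u x y * u powr (- 1 - \<nu>)"
          by (intro mult_right_mono) auto
        moreover have "exp (- r\<^sup>2 / 2 - 13) = ?g * exp (- 13)" by (simp flip: exp_add)
        moreover have "u powr (- 1 - \<nu>) = 1 / u powr (1 + \<nu>)"
          using powr_minus_divide[of u "1 + \<nu>"] by simp
        ultimately show ?thesis by (simp add: c0_def mult_ac)
      qed
      then show "ennreal (c0 * ?g) * (ennreal (exp (- u * b) * u powr (- 1 - \<nu>)) * indicator {l / 2..} u)
        \<le> ennreal (subordinator \<nu> t u * heat_kernel m u x y) * indicator {0<..} u"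
        using c0 l by (auto simp: indicator_def ennreal_mult[symmetric] intro!: ennreal_leI)
    qed
    finally show "ennreal (c0 * c1 * phi m \<nu> y)
      \<le> poisson_kernel m \<nu> t x y" .
  qed
qed

section \<open>Domination of Poisson integrals by the Hardy-Littlewood maximal function\<close>

text \<open>
  On the annulus of radii \<open>2\<^bsup>j-1\<^esup> \<surd>s\<close> and \<open>2\<^sup>j \<surd>s\<close> the Gaussian is at most \<open>exp (-4\<^sup>j / 16)\<close>; the factor \<open>2\<close>
  takes care of the innermost ball.
\<close>
lemma gaussian_le_dyadic_sum:
  fixes x y :: "'a::euclidean_space" and s :: real
  assumes s: "0 < s"
  shows "ennreal (exp (- (norm (x - y))\<^sup>2 / (4 * s)))
    \<le> (\<Sum>j. ennreal (2 * exp (- (4 ^ j) / 16)) * indicator (cball x (2 ^ j * sqrt s)) y)"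
proof -
  define r where "r = norm (x - y)"
  have "\<exists>j::nat. r \<le> 2 ^ j * sqrt s"
  proof -
    obtain j where "r / sqrt s < 2 ^ j" using real_arch_pow[of 2 "r / sqrt s"] by auto
    then show ?thesis using s by (intro exI[of _ j]) (simp add: field_simps less_imp_le)
  qed
  then obtain j where j: "r \<le> 2 ^ j * sqrt s" "\<And>i. i < j \<Longrightarrow> \<not> r \<le> 2 ^ i * sqrt s"
    using exists_least_iff[of "\<lambda>j. r \<le> 2 ^ j * sqrt s"] by auto
  have "exp (- r\<^sup>2 / (4 * s)) \<le> 2 * exp (- (4 ^ j) / 16)"
  proof (cases j)
    case 0
    have "exp (- r\<^sup>2 / (4 * s)) \<le> 1" using s by simp
    also have "1 \<le> 2 * exp (- (1::real) / 16)"
      using exp_ge_add_one_self[of "- (1::real) / 16"] by simp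
    finally show ?thesis using 0 by simp
  next
    case (Suc i)
    then have "2 ^ i * sqrt s \<le> r" using j(2)[of i] by simp
    then have "(2 ^ i * sqrt s)\<^sup>2 \<le> r\<^sup>2" using s by (intro power_mono) auto
    moreover have "(2 ^ i)\<^sup>2 = (4 :: real) ^ i"
      by (simp add: power2_eq_square flip: power_mult_distrib)
    ultimately have "4 ^ i * s \<le> r\<^sup>2"
      using s by (simp add: power_mult_distrib)
    then have "4 ^ j / 16 \<le> r\<^sup>2 / (4 * s)" using s Suc by (simp add: field_simps)
    then have "exp (- r\<^sup>2 / (4 * s)) \<le> exp (- (4 ^ j) / 16)" by simp
    then show ?thesis using exp_ge_zero[of "- (4 ^ j) / 16 :: real"] by linarith
  qed
  moreover define F where "F = (\<lambda>i. ennreal (2 * exp (- (4 ^ i) / 16)) * indicator (cball x (2 ^ i * sqrt s)) y)"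
  ultimately have "ennreal (exp (- r\<^sup>2 / (4 * s))) \<le> F j"
    using j(1) by (simp add: r_def F_def dist_norm ennreal_leI)
  also have "F j = sum F {j}" by simp
  also have "\<dots> \<le> suminf F"
    by (rule sum_le_suminf) (auto intro: summableI)
  finally show ?thesis unfolding r_def F_def .
qed

text \<open>
  A Gaussian of width \<open>\<surd>s\<close> is a superposition of normalised indicators of balls with summable coefficients,
  and the bound is uniform in \<open>u\<close> because \<open>d + m \<ge> 0\<close>.
\<close>
lemma heat_le_hl_maximal:
  obtains C where "0 < C" "\<And>m u (x :: real ^ 'n) g. - real CARD('n) \<le> m \<Longrightarrow> 0 < u \<Longrightarrow> g \<in> borel_measurable borel \<Longrightarrow>
    (\<integral>\<^sup>+y. ennreal (heat_kernel m u x y) * g y \<partial>lborel) \<le> ennreal C * hl_maximal g x"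
proof -
  define d where "d = CARD('n)"
  have d: "0 < d" by (simp add: d_def)
  obtain K where K: "0 < K" "\<And>v. 0 < v \<Longrightarrow> v powr real d * exp (- (1 / 16) * v) \<le> K"
    using powr_exp_bounded[of "real d" "1 / 16"] by auto
  have coeff: "2 * exp (- (4 ^ j) / 16) * (2 ^ j) ^ d \<le> 2 * K * (1 / 2) ^ j" for j :: nat
  proof -
    have "(4 ^ j) ^ d * exp (- (4 ^ j) / 16) \<le> K"
      using K(2)[of "4 ^ j"] by (simp add: powr_realpow)
    then have "2 * exp (- (4 ^ j) / 16) * (2 ^ j) ^ d \<le> 2 * (K / (4 ^ j) ^ d) * (2 ^ j) ^ d"
      by (intro mult_right_mono mult_left_mono) (auto simp: field_simps)
    also have "\<dots> = 2 * K * (((2 ^ j) / (4 ^ j)) ^ d)"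
      by (simp add: power_divide)
    also have "(2 ^ j) / (4 ^ j) = (1 / 2 :: real) ^ j"
      by (simp flip: power_divide)
    also have "((1 / 2 :: real) ^ j) ^ d \<le> ((1 / 2) ^ j) ^ 1"
      using d by (intro power_decreasing) (auto simp: power_le_one)
    finally show ?thesis using K(1) by simp
  qed
  show thesis
  proof (rule that)
    show "0 < pi powr (- real d / 2) * (4 * K)" using K by simp
    fix m u :: real and x :: "real ^ 'n" and g :: "real ^ 'n \<Rightarrow> ennreal"
    assume m: "- real CARD('n) \<le> m" and u: "0 < u" and [measurable]: "g \<in> borel_measurable borel"
    have [measurable]: "cball x r \<in> sets borel" for r by simp
    define s where "s = tanh u"
    have s: "0 < s" using u by (simp add: s_def)
    define A where "A = (pi * s) powr (- real d / 2)"
    have "(\<integral>\<^sup>+y. ennreal (heat_kernel m u x y) * g y \<partial>lborel)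
       \<le> (\<integral>\<^sup>+y. (\<Sum>j. ennreal A * ennreal (2 * exp (- (4 ^ j) / 16)) * (indicator (cball x (2 ^ j * sqrt s)) y * g y)) \<partial>lborel)"
    proof (intro nn_integral_mono)
      fix y
      have "ennreal (heat_kernel m u x y) \<le> ennreal (A * exp (- (norm (x - y))\<^sup>2 / (4 * s)))"
        using heat_kernel_le_gauss[OF u m, of x y] by (intro ennreal_leI) (simp add: A_def s_def d_def)
      also have "\<dots> \<le> ennreal A * (\<Sum>j. ennreal (2 * exp (- (4 ^ j) / 16)) * indicator (cball x (2 ^ j * sqrt s)) y)"
        using gaussian_le_dyadic_sum[OF s, of x y] by (simp add: A_def ennreal_mult mult_left_mono)
      finally have "ennreal (heat_kernel m u x y) * g y
          \<le> ennreal A * (\<Sum>j. ennreal (2 * exp (- (4 ^ j) / 16)) * indicator (cball x (2 ^ j * sqrt s)) y) * g y"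
        by (rule mult_right_mono) simp
      then show "ennreal (heat_kernel m u x y) * g y
          \<le> (\<Sum>j. ennreal A * ennreal (2 * exp (- (4 ^ j) / 16)) * (indicator (cball x (2 ^ j * sqrt s)) y * g y))"
        by (simp add: mult.assoc flip: ennreal_suminf_cmult ennreal_suminf_multc)
    qed
    also have "\<dots> = (\<Sum>j. \<integral>\<^sup>+y. ennreal A * ennreal (2 * exp (- (4 ^ j) / 16)) * (indicator (cball x (2 ^ j * sqrt s)) y * g y) \<partial>lborel)"
      by (rule nn_integral_suminf) measurable
    also have "\<dots> = (\<Sum>j. ennreal A * ennreal (2 * exp (- (4 ^ j) / 16)) * (\<integral>\<^sup>+y\<in>cball x (2 ^ j * sqrt s). g y \<partial>lborel))"
      by (intro suminf_cong, subst nn_integral_cmult) (measurable, simp only: mult.commute[of _ "g _"])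
    also have "\<dots> \<le> (\<Sum>j. ennreal (pi powr (- real d / 2) * (2 * K * (1 / 2) ^ j)) * hl_maximal g x)"
    proof (intro suminf_le summableI)
      fix j :: nat
      have "ennreal A * ennreal (2 * exp (- (4 ^ j) / 16)) * (\<integral>\<^sup>+y\<in>cball x (2 ^ j * sqrt s). g y \<partial>lborel)
          \<le> ennreal A * ennreal (2 * exp (- (4 ^ j) / 16)) * (ennreal ((2 ^ j * sqrt s) ^ d) * hl_maximal g x)"
        using s ball_integral_le_hl_maximal[of "2 ^ j * sqrt s" g x] by (intro mult_left_mono) (auto simp: d_def)
      also have "\<dots> = ennreal (A * (2 * exp (- (4 ^ j) / 16)) * (2 ^ j * sqrt s) ^ d) * hl_maximal g x"
        using s by (simp add: A_def ennreal_mult mult.assoc)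
      also have "A * (2 * exp (- (4 ^ j) / 16)) * (2 ^ j * sqrt s) ^ d = pi powr (- real d / 2) * (2 * exp (- (4 ^ j) / 16) * (2 ^ j) ^ d)"
      proof -
        have "s powr (- real d / 2) * sqrt s ^ d = 1"
          using s by (simp add: powr_realpow[symmetric] powr_half_sqrt[symmetric] powr_powr powr_add[symmetric])
        then show ?thesis
          using s by (simp add: A_def powr_mult power_mult_distrib mult_ac)
      qed
      also have "ennreal \<dots> \<le> ennreal (pi powr (- real d / 2) * (2 * K * (1 / 2) ^ j))"
        by (intro ennreal_leI mult_left_mono coeff) auto
      finally show "ennreal A * ennreal (2 * exp (- (4 ^ j) / 16)) * (\<integral>\<^sup>+y\<in>cball x (2 ^ j * sqrt s). g y \<partial>lborel)
          \<le> ennreal (pi powr (- real d / 2) * (2 * K * (1 / 2) ^ j)) * hl_maximal g x"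
        by (simp add: mult_right_mono)
    qed
    also have "\<dots> = (\<Sum>j. ennreal (pi powr (- real d / 2) * (2 * K * (1 / 2) ^ j))) * hl_maximal g x"
      by simp
    also have "(\<Sum>j. ennreal (pi powr (- real d / 2) * (2 * K * (1 / 2) ^ j))) = ennreal (pi powr (- real d / 2) * (2 * K * 2))"
      using K(1) geometric_sums[of "1 / 2 :: real"] by (intro suminf_ennreal_eq sums_mult) auto
    finally show "(\<integral>\<^sup>+y. ennreal (heat_kernel m u x y) * g y \<partial>lborel) \<le> ennreal (pi powr (- real d / 2) * (4 * K)) * hl_maximal g x"
      by (simp add: mult.assoc[symmetric])
  qed
qed

definition poisson_factor :: "real \<Rightarrow> real \<Rightarrow> real" where
  "poisson_factor \<nu> t = t powr (2 * \<nu>) / (4 powr \<nu> * Gamma \<nu>)"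

lemma poisson_factor_pos: "0 < \<nu> \<Longrightarrow> 0 < t \<Longrightarrow> 0 < poisson_factor \<nu> t"
  by (simp add: poisson_factor_def Gamma_real_pos)

lemma poisson_factor_mono: "0 < \<nu> \<Longrightarrow> 0 < t \<Longrightarrow> t \<le> a \<Longrightarrow> poisson_factor \<nu> t \<le> poisson_factor \<nu> a"
  unfolding poisson_factor_def by (intro divide_right_mono powr_mono2) (auto simp: Gamma_real_pos less_imp_le)

text \<open>
  The substitution \<open>u = t\<^sup>2 v\<close> removes \<open>t\<close>.
\<close>
lemma poisson_time_integral_bounded:
  fixes \<nu> :: real
  assumes \<nu>: "0 < \<nu>"
  obtains K where "0 < K" "\<And>t. 0 < t \<Longrightarrow>
    ennreal (poisson_factor \<nu> t) * (\<integral>\<^sup>+u\<in>{0<..}. ennreal (subordinator \<nu> t u) \<partial>lborel) \<le> ennreal K"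
proof -
  obtain K1 where K1: "0 < K1" "\<And>v. 0 < v \<Longrightarrow> v powr (1 + \<nu>) * exp (- (1 / 4) * v) \<le> K1"
    using powr_exp_bounded[of "1 + \<nu>" "1 / 4"] \<nu> by auto
  define K0 where "K0 = K1 + 1 / \<nu>"
  have K0: "0 < K0" using K1 \<nu> by (simp add: K0_def add_pos_pos)
  have "(\<integral>\<^sup>+v\<in>{0<..}. ennreal (exp (- 1 / (4 * v)) / v powr (1 + \<nu>)) \<partial>lborel)
      \<le> (\<integral>\<^sup>+v. ennreal K1 * indicator {0..1} v + ennreal (v powr (- 1 - \<nu>)) * indicator {1..} v \<partial>lborel)"
  proof (intro nn_integral_mono)
    fix v :: real
    have inv: "v powr (- 1 - \<nu>) = 1 / v powr (1 + \<nu>)"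
      using powr_minus_divide[of v "1 + \<nu>"] by simp
    consider "v \<le> 0" | "0 < v" "v \<le> 1" | "1 < v" by linarith
    then show "ennreal (exp (- 1 / (4 * v)) / v powr (1 + \<nu>)) * indicator {0<..} v
        \<le> ennreal K1 * indicator {0..1} v + ennreal (v powr (- 1 - \<nu>)) * indicator {1..} v"
    proof cases
      case 2
      have "ennreal (exp (- 1 / (4 * v)) / v powr (1 + \<nu>)) \<le> ennreal K1"
        using K1(2)[of "1 / v"] 2 by (intro ennreal_leI) (simp add: powr_divide mult.commute)
      then show ?thesis using 2 by (simp add: add_increasing2)
    next
      case 3
      then have "ennreal (exp (- 1 / (4 * v)) / v powr (1 + \<nu>)) \<le> ennreal (v powr (- 1 - \<nu>))"
        unfolding inv by (intro ennreal_leI divide_right_mono) auto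
      then show ?thesis using 3 by (simp add: add_increasing)
    qed auto
  qed
  also have "\<dots> = ennreal K1 + ennreal (1 / \<nu>)"
    using \<nu> nn_integral_powr_to_infinity[OF \<nu>, of 1]
    by (subst nn_integral_add) (auto simp: nn_integral_cmult_indicator)
  also have "\<dots> = ennreal K0" using K1 \<nu> by (simp add: K0_def)
  finally have unit: "(\<integral>\<^sup>+v\<in>{0<..}. ennreal (exp (- 1 / (4 * v)) / v powr (1 + \<nu>)) \<partial>lborel) \<le> ennreal K0" .
  show thesis
  proof (rule that)
    show "0 < K0 / (4 powr \<nu> * Gamma \<nu>)" using K0 \<nu> by (simp add: Gamma_real_pos)
    fix t :: real assume t: "0 < t"
    have scaled: "ennreal (exp (- t\<^sup>2 / (4 * (t\<^sup>2 * v))) / (t\<^sup>2 * v) powr (1 + \<nu>)) * indicator {0<..} (t\<^sup>2 * v)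
        = ennreal (t powr (- 2 - 2 * \<nu>)) * (ennreal (exp (- 1 / (4 * v)) / v powr (1 + \<nu>)) * indicator {0<..} v)" for v
      proof (cases "0 < v")
        case True
        have "(t\<^sup>2 * v) powr (1 + \<nu>) = t powr (2 * (1 + \<nu>)) * v powr (1 + \<nu>)"
          using t True powr_powr[of t 2 "1 + \<nu>"] by (simp add: powr_mult powr_numeral)
        moreover have "t powr (- 2 - 2 * \<nu>) = 1 / t powr (2 * (1 + \<nu>))"
          using powr_minus_divide[of t "2 * (1 + \<nu>)"] by simp
        moreover have "- t\<^sup>2 / (4 * (t\<^sup>2 * v)) = - 1 / (4 * v)"
          using t by (simp add: field_simps)
        ultimately show ?thesis
          using t True by (simp add: ennreal_mult[symmetric] mult.commute del: ennreal_mult)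
      qed (use t in \<open>auto simp: zero_less_mult_iff\<close>)
    have "(\<integral>\<^sup>+u\<in>{0<..}. ennreal (subordinator \<nu> t u) \<partial>lborel)
       = ennreal (t\<^sup>2) * (\<integral>\<^sup>+v. ennreal (exp (- t\<^sup>2 / (4 * (t\<^sup>2 * v))) / (t\<^sup>2 * v) powr (1 + \<nu>)) * indicator {0<..} (t\<^sup>2 * v) \<partial>lborel)"
      using t by (subst nn_integral_real_affine[where c = "t\<^sup>2" and t = 0]) auto
    also have "\<dots> = ennreal (t\<^sup>2) * (\<integral>\<^sup>+v. ennreal (t powr (- 2 - 2 * \<nu>)) * (ennreal (exp (- 1 / (4 * v)) / v powr (1 + \<nu>)) * indicator {0<..} v) \<partial>lborel)"
      by (simp only: scaled)
    also have "\<dots> = ennreal (t\<^sup>2) * (ennreal (t powr (- 2 - 2 * \<nu>)) * (\<integral>\<^sup>+v\<in>{0<..}. ennreal (exp (- 1 / (4 * v)) / v powr (1 + \<nu>)) \<partial>lborel))"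
      by (subst nn_integral_cmult) auto
    also have "\<dots> \<le> ennreal (t\<^sup>2) * (ennreal (t powr (- 2 - 2 * \<nu>)) * ennreal K0)"
      by (intro mult_left_mono unit) auto
    also have "\<dots> = ennreal (t powr (- (2 * \<nu>)) * K0)"
    proof -
      have "t\<^sup>2 * t powr (- 2 - 2 * \<nu>) = t powr (- (2 * \<nu>))"
        using t powr_add[of t 2 "- 2 - 2 * \<nu>"] by (simp add: powr_numeral)
      then show ?thesis
        using K0 t by (simp add: mult.assoc[symmetric] flip: ennreal_mult)
    qed
    finally have "ennreal (poisson_factor \<nu> t) * (\<integral>\<^sup>+u\<in>{0<..}. ennreal (subordinator \<nu> t u) \<partial>lborel)
       \<le> ennreal (poisson_factor \<nu> t) * ennreal (t powr (- (2 * \<nu>)) * K0)"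
      by (rule mult_left_mono) simp
    also have "\<dots> = ennreal (K0 / (4 powr \<nu> * Gamma \<nu>))"
    proof -
      have "t powr (2 * \<nu>) * t powr (- (2 * \<nu>)) = 1" using t by (simp flip: powr_add)
      then have "poisson_factor \<nu> t * (t powr (- (2 * \<nu>)) * K0) = K0 / (4 powr \<nu> * Gamma \<nu>)"
        by (simp add: poisson_factor_def)
      then show ?thesis
        using K0 t poisson_factor_pos[OF \<nu> t] by (simp flip: ennreal_mult)
    qed
    finally show "ennreal (poisson_factor \<nu> t) * (\<integral>\<^sup>+u\<in>{0<..}. ennreal (subordinator \<nu> t u) \<partial>lborel)
       \<le> ennreal (K0 / (4 powr \<nu> * Gamma \<nu>))" .
  qed
qed

section \<open>Poisson integrals of absolute values\<close>

abbreviation heat_nn :: "real \<Rightarrow> real \<Rightarrow> (real ^ 'n \<Rightarrow> real) \<Rightarrow> real ^ 'n \<Rightarrow> ennreal" where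
  "heat_nn m u f x \<equiv> \<integral>\<^sup>+y. ennreal (heat_kernel m u x y) * ennreal \<bar>f y\<bar> \<partial>lborel"

abbreviation phi_norm :: "real \<Rightarrow> real \<Rightarrow> (real ^ 'n \<Rightarrow> real) \<Rightarrow> ennreal" where
  "phi_norm m \<nu> f \<equiv> \<integral>\<^sup>+y. ennreal (\<bar>f y\<bar> * phi m \<nu> y) \<partial>lborel"

lemma poisson_nn_borel:
  fixes f :: "real ^ 'n \<Rightarrow> real"
  shows "poisson_nn m \<nu> t f x = ennreal (poisson_factor \<nu> t) *
     (\<integral>\<^sup>+u\<in>{0<..}. ennreal (subordinator \<nu> t u)
        * heat_nn m u f x \<partial>lborel)"
  unfolding poisson_nn_def poisson_factor_def
  by (simp add: nn_integral_completion ennreal_mult)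

text \<open>Tonelli's theorem gives the representation by the Poisson kernel, on which \<open>\<phi>\<close>-bounds act.\<close>
lemma poisson_nn_kernel:
  fixes f :: "real ^ 'n \<Rightarrow> real"
  assumes [measurable]: "f \<in> borel_measurable borel"
  shows "poisson_nn m \<nu> t f x = ennreal (poisson_factor \<nu> t) *
    (\<integral>\<^sup>+y. poisson_kernel m \<nu> t x y * ennreal \<bar>f y\<bar> \<partial>lborel)"
proof -
  let ?F = "\<lambda>u y. ennreal (subordinator \<nu> t u) * ennreal (heat_kernel m u x y) * ennreal \<bar>f y\<bar> * indicator {0<..} u"
  have "(\<integral>\<^sup>+u\<in>{0<..}. ennreal (subordinator \<nu> t u)
        * heat_nn m u f x \<partial>lborel)
      = (\<integral>\<^sup>+u. (\<integral>\<^sup>+y. ?F u y \<partial>lborel) \<partial>lborel)"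
  proof (intro nn_integral_cong)
    fix u :: real
    let ?e = "ennreal (subordinator \<nu> t u)"
    let ?hf = "\<lambda>y. ennreal (heat_kernel m u x y) * ennreal \<bar>f y\<bar>"
    have A: "(\<integral>\<^sup>+y. ?e * ?hf y \<partial>lborel) = ?e * (\<integral>\<^sup>+y. ?hf y \<partial>lborel)"
      by (rule nn_integral_cmult) measurable
    have B: "(\<integral>\<^sup>+y. (?e * ?hf y) * indicator {0<..} u \<partial>lborel) = (\<integral>\<^sup>+y. ?e * ?hf y \<partial>lborel) * indicator {0<..} u"
      by (rule nn_integral_multc) measurable
    show "?e * (\<integral>\<^sup>+y. ?hf y \<partial>lborel) * indicator {0<..} u = (\<integral>\<^sup>+y. ?F u y \<partial>lborel)"
      unfolding A[symmetric] B[symmetric] by (simp only: mult.assoc)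
  qed
  also have "\<dots> = (\<integral>\<^sup>+y. (\<integral>\<^sup>+u. ?F u y \<partial>lborel) \<partial>lborel)"
    by (rule lborel_pair.Fubini'[symmetric]) measurable
  also have "\<dots> = (\<integral>\<^sup>+y. poisson_kernel m \<nu> t x y * ennreal \<bar>f y\<bar> \<partial>lborel)"
  proof (intro nn_integral_cong)
    fix y
    have "(\<integral>\<^sup>+u. ?F u y \<partial>lborel) = (\<integral>\<^sup>+u. ennreal (subordinator \<nu> t u * heat_kernel m u x y) * indicator {0<..} u * ennreal \<bar>f y\<bar> \<partial>lborel)"
    proof (intro nn_integral_cong)
      fix u :: real
      have "ennreal (subordinator \<nu> t u * heat_kernel m u x y)
          = ennreal (subordinator \<nu> t u) * ennreal (heat_kernel m u x y)"
        by (rule ennreal_mult) auto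
      then show "?F u y = ennreal (subordinator \<nu> t u * heat_kernel m u x y) * indicator {0<..} u * ennreal \<bar>f y\<bar>"
        by (simp only: mult_ac)
    qed
    also have "\<dots> = poisson_kernel m \<nu> t x y * ennreal \<bar>f y\<bar>"
      by (rule nn_integral_multc) measurable
    finally show "(\<integral>\<^sup>+u. ?F u y \<partial>lborel) = \<dots>" .
  qed
  finally show ?thesis unfolding poisson_nn_borel by simp
qed

lemma poisson_nn_measurable [measurable]:
  fixes f :: "real ^ 'n \<Rightarrow> real"
  assumes [measurable]: "f \<in> borel_measurable borel"
  shows "poisson_nn m \<nu> t f \<in> borel_measurable borel"
proof -
  have "poisson_nn m \<nu> t f = (\<lambda>x. ennreal (poisson_factor \<nu> t) *
     (\<integral>\<^sup>+u. ennreal (subordinator \<nu> t u)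
        * heat_nn m u f x * indicator {0<..} u \<partial>lborel))"
    by (simp add: fun_eq_iff poisson_nn_borel)
  also have "\<dots> \<in> borel_measurable borel" by measurable
  finally show ?thesis .
qed

lemma poisson_nn_mono:
  fixes f g :: "real ^ 'n \<Rightarrow> real"
  assumes "\<And>y. \<bar>f y\<bar> \<le> \<bar>g y\<bar>"
  shows "poisson_nn m \<nu> t f x \<le> poisson_nn m \<nu> t g x"
  unfolding poisson_nn_borel
  by (intro mult_left_mono nn_integral_mono mult_right_mono ennreal_leI assms) auto

lemma poisson_nn_add:
  fixes f g :: "real ^ 'n \<Rightarrow> real"
  assumes [measurable]: "f \<in> borel_measurable borel" "g \<in> borel_measurable borel"
  shows "poisson_nn m \<nu> t (\<lambda>y. f y + g y) x \<le> poisson_nn m \<nu> t f x + poisson_nn m \<nu> t g x"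
proof -
  let ?k = "\<lambda>y. poisson_kernel m \<nu> t x y"
  have "(\<integral>\<^sup>+y. ?k y * ennreal \<bar>f y + g y\<bar> \<partial>lborel) \<le> (\<integral>\<^sup>+y. ?k y * ennreal \<bar>f y\<bar> + ?k y * ennreal \<bar>g y\<bar> \<partial>lborel)"
  proof (intro nn_integral_mono)
    fix y
    have "ennreal \<bar>f y + g y\<bar> \<le> ennreal \<bar>f y\<bar> + ennreal \<bar>g y\<bar>"
      by (simp add: abs_triangle_ineq ennreal_leI flip: ennreal_plus)
    then show "?k y * ennreal \<bar>f y + g y\<bar> \<le> ?k y * ennreal \<bar>f y\<bar> + ?k y * ennreal \<bar>g y\<bar>"
      unfolding distrib_left[symmetric] by (rule mult_left_mono) simp
  qed
  also have "\<dots> = (\<integral>\<^sup>+y. ?k y * ennreal \<bar>f y\<bar> \<partial>lborel) + (\<integral>\<^sup>+y. ?k y * ennreal \<bar>g y\<bar> \<partial>lborel)"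
    by (intro nn_integral_add) measurable
  finally have "ennreal (poisson_factor \<nu> t) * (\<integral>\<^sup>+y. ?k y * ennreal \<bar>f y + g y\<bar> \<partial>lborel)
     \<le> ennreal (poisson_factor \<nu> t) * ((\<integral>\<^sup>+y. ?k y * ennreal \<bar>f y\<bar> \<partial>lborel) + (\<integral>\<^sup>+y. ?k y * ennreal \<bar>g y\<bar> \<partial>lborel))"
    by (rule mult_left_mono) simp
  then show ?thesis
    by (simp add: poisson_nn_kernel distrib_left)
qed

lemma poisson_nn_scale:
  fixes f :: "real ^ 'n \<Rightarrow> real"
  assumes [measurable]: "f \<in> borel_measurable borel" and c: "0 \<le> c"
  shows "poisson_nn m \<nu> t (\<lambda>y. c * f y) x = ennreal c * poisson_nn m \<nu> t f x"
proof -
  let ?k = "\<lambda>y. poisson_kernel m \<nu> t x y"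
  have "(\<integral>\<^sup>+y. ?k y * ennreal \<bar>c * f y\<bar> \<partial>lborel) = (\<integral>\<^sup>+y. ennreal c * (?k y * ennreal \<bar>f y\<bar>) \<partial>lborel)"
    using c by (intro nn_integral_cong) (simp add: abs_mult ennreal_mult mult_ac)
  also have "\<dots> = ennreal c * (\<integral>\<^sup>+y. ?k y * ennreal \<bar>f y\<bar> \<partial>lborel)"
    by (intro nn_integral_cmult) measurable
  finally show ?thesis
    by (simp add: poisson_nn_kernel mult_ac)
qed

lemma poisson_nn_le_hl_maximal:
  fixes \<nu> m :: real
  assumes \<nu>: "0 < \<nu>" and m: "- real CARD('n) \<le> m"
  obtains C where "0 < C" "\<And>t x (f :: real ^ 'n \<Rightarrow> real). 0 < t \<Longrightarrow> f \<in> borel_measurable borel \<Longrightarrow>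
    poisson_nn m \<nu> t f x \<le> ennreal C * hl_maximal (\<lambda>y. ennreal \<bar>f y\<bar>) x"
proof -
  obtain C where C: "0 < C" "\<And>m u (x :: real ^ 'n) g. - real CARD('n) \<le> m \<Longrightarrow> 0 < u \<Longrightarrow> g \<in> borel_measurable borel \<Longrightarrow>
    (\<integral>\<^sup>+y. ennreal (heat_kernel m u x y) * g y \<partial>lborel) \<le> ennreal C * hl_maximal g x"
    by (rule heat_le_hl_maximal) blast
  obtain K where K: "0 < K" "\<And>t. 0 < t \<Longrightarrow>
    ennreal (poisson_factor \<nu> t) * (\<integral>\<^sup>+u\<in>{0<..}. ennreal (subordinator \<nu> t u) \<partial>lborel) \<le> ennreal K"
    using poisson_time_integral_bounded[OF \<nu>] by blast
  show thesis
  proof (rule that)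
    show "0 < K * C" using K C by simp
    fix t :: real and x :: "real ^ 'n" and f :: "real ^ 'n \<Rightarrow> real"
    assume t: "0 < t" and [measurable]: "f \<in> borel_measurable borel"
    let ?M = "ennreal C * hl_maximal (\<lambda>y. ennreal \<bar>f y\<bar>) x"
    let ?e = "\<lambda>u. ennreal (subordinator \<nu> t u)"
    have "poisson_nn m \<nu> t f x \<le> ennreal (poisson_factor \<nu> t) * (\<integral>\<^sup>+u. ?e u * indicator {0<..} u * ?M \<partial>lborel)"
      unfolding poisson_nn_borel
    proof (intro mult_left_mono nn_integral_mono)
      fix u :: real
      have "?e u * heat_nn m u f x \<le> ?e u * ?M" if "0 < u"
        using that m by (intro mult_left_mono C) auto
      then show "?e u * heat_nn m u f x * indicator {0<..} u
          \<le> ?e u * indicator {0<..} u * ?M"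
        by (auto simp: indicator_def)
    qed simp
    also have "\<dots> = ennreal (poisson_factor \<nu> t) * (\<integral>\<^sup>+u\<in>{0<..}. ?e u \<partial>lborel) * ?M"
      by (subst nn_integral_multc) (simp_all add: mult.assoc)
    also have "\<dots> \<le> ennreal K * ?M"
      by (intro mult_right_mono K t) simp
    also have "\<dots> = ennreal (K * C) * hl_maximal (\<lambda>y. ennreal \<bar>f y\<bar>) x"
      using K C by (simp add: ennreal_mult mult.assoc)
    finally show "poisson_nn m \<nu> t f x \<le> ennreal (K * C) * hl_maximal (\<lambda>y. ennreal \<bar>f y\<bar>) x" .
  qed
qed

lemma phi_measurable [measurable]: "phi m \<nu> \<in> borel_measurable borel"
  unfolding phi_eq_radial phi_radial_def by measurable

text \<open>
  Far from the ball the kernel bound holds down to time zero, so \<open>e\<^bsup>-t\<^sup>2/4u\<^esup>\<close> may be dropped and the estimate is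
  uniform in \<open>0 < t \<le> a\<close>.
\<close>
lemma poisson_nn_nonlocal:
  fixes \<nu> m k a :: real
  assumes \<nu>: "0 < \<nu>" and m: "- real CARD('n) \<le> m" and k: "0 \<le> k" and a: "0 < a"
  obtains C where "0 < C" "\<And>t x (f :: real ^ 'n \<Rightarrow> real). 0 < t \<Longrightarrow> t \<le> a \<Longrightarrow> norm x \<le> k \<Longrightarrow> f \<in> borel_measurable borel \<Longrightarrow>
    (\<And>y. norm y < max 1 (16 * k) \<Longrightarrow> f y = 0) \<Longrightarrow>
    poisson_nn m \<nu> t f x \<le> ennreal C * phi_norm m \<nu> f"
proof -
  obtain C where C: "0 < C" "\<And>x (y :: real ^ 'n). norm x \<le> k \<Longrightarrow> 1 \<le> norm y \<Longrightarrow> 16 * k \<le> norm y \<Longrightarrow>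
      (\<integral>\<^sup>+u\<in>{0<..}. ennreal (heat_kernel m u x y * u powr (- 1 - \<nu>)) \<partial>lborel) \<le> ennreal (C * phi m \<nu> y)"
    using time_integral_heat_kernel_upper[OF \<nu> k m] by blast
  show thesis
  proof (rule that)
    show "0 < poisson_factor \<nu> a * C" using poisson_factor_pos[OF \<nu> a] C by simp
    fix t :: real and x :: "real ^ 'n" and f :: "real ^ 'n \<Rightarrow> real"
    assume t: "0 < t" "t \<le> a" and x: "norm x \<le> k" and [measurable]: "f \<in> borel_measurable borel"
      and supp: "\<And>y. norm y < max 1 (16 * k) \<Longrightarrow> f y = 0"
    let ?k = "\<lambda>y. poisson_kernel m \<nu> t x y"
    have "(\<integral>\<^sup>+y. ?k y * ennreal \<bar>f y\<bar> \<partial>lborel) \<le> (\<integral>\<^sup>+y. ennreal C * ennreal (\<bar>f y\<bar> * phi m \<nu> y) \<partial>lborel)"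
    proof (intro nn_integral_mono)
      fix y
      show "?k y * ennreal \<bar>f y\<bar> \<le> ennreal C * ennreal (\<bar>f y\<bar> * phi m \<nu> y)"
      proof (cases "norm y < max 1 (16 * k)")
        case False
        have "?k y \<le> (\<integral>\<^sup>+u\<in>{0<..}. ennreal (heat_kernel m u x y * u powr (- 1 - \<nu>)) \<partial>lborel)"
        proof (intro nn_integral_mono)
          fix u :: real
          have "subordinator \<nu> t u * heat_kernel m u x y \<le> heat_kernel m u x y * u powr (- 1 - \<nu>)" if "0 < u"
          proof -
            have "u powr (- 1 - \<nu>) = 1 / u powr (1 + \<nu>)"
              using powr_minus_divide[of u "1 + \<nu>"] by simp
            moreover have "exp (- t\<^sup>2 / (4 * u)) * (heat_kernel m u x y / u powr (1 + \<nu>)) \<le> 1 * (heat_kernel m u x y / u powr (1 + \<nu>))"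
              using that by (intro mult_right_mono) auto
            ultimately show ?thesis by simp
          qed
          then show "ennreal (subordinator \<nu> t u * heat_kernel m u x y) * indicator {0<..} u
              \<le> ennreal (heat_kernel m u x y * u powr (- 1 - \<nu>)) * indicator {0<..} u"
            by (auto simp: indicator_def intro!: ennreal_leI)
        qed
        also have "\<dots> \<le> ennreal (C * phi m \<nu> y)" using False x by (intro C) auto
        finally have "?k y * ennreal \<bar>f y\<bar> \<le> ennreal (C * phi m \<nu> y) * ennreal \<bar>f y\<bar>"
          by (rule mult_right_mono) simp
        then show ?thesis
          using C(1) phi_pos[of m \<nu> y] by (simp add: ennreal_mult[symmetric] mult_ac less_imp_le)
      qed (simp add: supp)
    qed
    also have "\<dots> = ennreal C * phi_norm m \<nu> f"
      by (intro nn_integral_cmult) measurable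
    finally have "poisson_nn m \<nu> t f x \<le> ennreal (poisson_factor \<nu> t) * (ennreal C * phi_norm m \<nu> f)"
      by (simp add: poisson_nn_kernel mult_left_mono)
    also have "\<dots> \<le> ennreal (poisson_factor \<nu> a) * (ennreal C * phi_norm m \<nu> f)"
      using t by (intro mult_right_mono ennreal_leI poisson_factor_mono \<nu>) auto
    also have "\<dots> = ennreal (poisson_factor \<nu> a * C) * phi_norm m \<nu> f"
      using C poisson_factor_pos[OF \<nu> a] by (simp add: ennreal_mult mult.assoc)
    finally show "poisson_nn m \<nu> t f x \<le> ennreal (poisson_factor \<nu> a * C) * phi_norm m \<nu> f" .
  qed
qed

lemma poisson_nn_lower:
  fixes \<nu> m t :: real
  assumes \<nu>: "0 < \<nu>" and m: "- real CARD('n) \<le> m" and t: "0 < t"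
  obtains c where "0 < c" "\<And>x (f :: real ^ 'n \<Rightarrow> real). norm x \<le> 1 \<Longrightarrow> f \<in> borel_measurable borel \<Longrightarrow>
    ennreal c * phi_norm m \<nu> f \<le> poisson_nn m \<nu> t f x"
proof -
  obtain c where c: "0 < c" "\<And>x (y :: real ^ 'n). norm x \<le> 1 \<Longrightarrow>
      ennreal (c * phi m \<nu> y) \<le> poisson_kernel m \<nu> t x y"
    using time_integral_heat_kernel_lower[OF \<nu> m, of t] by blast
  show thesis
  proof (rule that)
    show "0 < poisson_factor \<nu> t * c" using poisson_factor_pos[OF \<nu> t] c by simp
    fix x :: "real ^ 'n" and f :: "real ^ 'n \<Rightarrow> real"
    assume x: "norm x \<le> 1" and [measurable]: "f \<in> borel_measurable borel"
    have "ennreal (poisson_factor \<nu> t * c) * phi_norm m \<nu> f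
        = ennreal (poisson_factor \<nu> t) * (\<integral>\<^sup>+y. ennreal c * ennreal (\<bar>f y\<bar> * phi m \<nu> y) \<partial>lborel)"
      using c poisson_factor_pos[OF \<nu> t] by (simp add: nn_integral_cmult ennreal_mult mult.assoc)
    also have "\<dots> = ennreal (poisson_factor \<nu> t) * (\<integral>\<^sup>+y. ennreal (c * phi m \<nu> y) * ennreal \<bar>f y\<bar> \<partial>lborel)"
      using c phi_pos[where m = m and \<nu> = \<nu> and ?'a = 'n]
      by (intro arg_cong[where f = "\<lambda>z. ennreal (poisson_factor \<nu> t) * z"] nn_integral_cong) (simp add: less_imp_le mult_ac flip: ennreal_mult)
    also have "\<dots> \<le> poisson_nn m \<nu> t f x"
      unfolding poisson_nn_kernel[OF \<open>f \<in> borel_measurable borel\<close>]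
      using x by (intro mult_left_mono nn_integral_mono mult_right_mono c) auto
    finally show "ennreal (poisson_factor \<nu> t * c) * phi_norm m \<nu> f \<le> poisson_nn m \<nu> t f x" .
  qed
qed

section \<open>Weak type bound for the maximal operator\<close>

text \<open>
  The maximal operator for absolute values. A countable set of times keeps it measurable.
\<close>
definition poisson_sup :: "real \<Rightarrow> real \<Rightarrow> real \<Rightarrow> (real ^ 'n \<Rightarrow> real) \<Rightarrow> real ^ 'n \<Rightarrow> ennreal" where
  "poisson_sup m \<nu> a f x = (SUP t\<in>{0<..<a} \<inter> \<rat>. poisson_nn m \<nu> t f x)"

lemma countable_rational_times: "countable ({0<..<a :: real} \<inter> \<rat>)"
  by (intro countable_Int2 countable_rat)

lemma poisson_sup_measurable [measurable]:
  fixes f :: "real ^ 'n \<Rightarrow> real"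
  assumes [measurable]: "f \<in> borel_measurable borel"
  shows "poisson_sup m \<nu> a f \<in> borel_measurable borel"
proof -
  have "(\<lambda>x. SUP t\<in>{0<..<a} \<inter> \<rat>. poisson_nn m \<nu> t f x) \<in> borel_measurable borel"
    by (intro borel_measurable_SUP countable_rational_times) measurable
  then show ?thesis by (simp add: poisson_sup_def[abs_def])
qed

lemma phi_lower_on_ball:
  fixes m \<nu> R :: real
  assumes \<nu>: "0 < \<nu>" and m: "- real CARD('n) \<le> m"
  obtains c where "0 < c" "\<And>y :: real ^ 'n. norm y \<le> R \<Longrightarrow> c \<le> phi m \<nu> y"
proof -
  define b where "b = real CARD('n) + m"
  define R' where "R' = max R 0"
  have b: "0 \<le> b" using m by (simp add: b_def)
  have anti: "phi_radial b \<nu> R' \<le> phi_radial b \<nu> r" if r: "0 \<le> r" "r \<le> R'" for r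
  proof -
    have l: "1 \<le> ln (exp 1 + r)" "ln (exp 1 + r) \<le> ln (exp 1 + R')"
      using r ln_e_plus(1)[of r] by (auto simp: add_pos_nonneg)
    show ?thesis
      unfolding phi_radial_def using r l b \<nu>
      by (auto intro!: mult_mono powr_mono2')
  qed
  show thesis
  proof (rule that)
    show "0 < exp (- R'\<^sup>2 / 2) * phi_radial b \<nu> R'" by (simp add: phi_radial_pos R'_def)
    fix y :: "real ^ 'n" assume y: "norm y \<le> R"
    have "(norm y)\<^sup>2 \<le> R'\<^sup>2" using y by (intro power_mono) (auto simp: R'_def)
    then show "exp (- R'\<^sup>2 / 2) * phi_radial b \<nu> R' \<le> phi m \<nu> y"
      unfolding phi_eq_radial b_def[symmetric] using y
      by (intro mult_mono anti) (auto simp: R'_def phi_radial_pos less_imp_le)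
  qed
qed

text \<open>
  \<open>f\<close> is split at \<open>\<bar>y\<bar> = max 1 (16k)\<close>: the outer part contributes a bounded function on the ball, the inner part
  is integrable because \<open>\<phi>\<close> is bounded below on bounded sets.
\<close>
lemma poisson_sup_weak_type_on_ball:
  fixes \<nu> m k a :: real
  assumes \<nu>: "0 < \<nu>" and m: "- real CARD('n) \<le> m" and k: "0 \<le> k" and a: "0 < a"
  obtains C where "0 < C" "\<And>l (f :: real ^ 'n \<Rightarrow> real). 0 < l \<Longrightarrow> f \<in> borel_measurable borel \<Longrightarrow>
    ennreal l * emeasure lborel {x. norm x \<le> k \<and> ennreal l < poisson_sup m \<nu> a f x}
      \<le> ennreal C * phi_norm m \<nu> f"
proof -
  define R where "R = max 1 (16 * k)"
  obtain C1 where C1: "0 < C1" "\<And>t x (f :: real ^ 'n \<Rightarrow> real). 0 < t \<Longrightarrow> f \<in> borel_measurable borel \<Longrightarrow>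
    poisson_nn m \<nu> t f x \<le> ennreal C1 * hl_maximal (\<lambda>y. ennreal \<bar>f y\<bar>) x"
    using poisson_nn_le_hl_maximal[OF \<nu> m] by blast
  obtain C2 where C2: "0 < C2" "\<And>t x (f :: real ^ 'n \<Rightarrow> real). 0 < t \<Longrightarrow> t \<le> a \<Longrightarrow> norm x \<le> k \<Longrightarrow> f \<in> borel_measurable borel \<Longrightarrow>
    (\<And>y. norm y < max 1 (16 * k) \<Longrightarrow> f y = 0) \<Longrightarrow>
    poisson_nn m \<nu> t f x \<le> ennreal C2 * phi_norm m \<nu> f"
    using poisson_nn_nonlocal[OF \<nu> m k a] by blast
  obtain c where c: "0 < c" "\<And>y :: real ^ 'n. norm y \<le> R \<Longrightarrow> c \<le> phi m \<nu> y"
    using phi_lower_on_ball[OF \<nu> m] by blast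
  define K where "K = 5 ^ CARD('n) * unit_ball_vol (real CARD('n))"
  define B where "B = measure lborel (cball (0 :: real ^ 'n) k)"
  have K: "0 \<le> K" by (simp add: K_def)
  have B: "0 \<le> B" "emeasure lborel (cball (0 :: real ^ 'n) k) = ennreal B"
    unfolding B_def by (auto simp: emeasure_eq_ennreal_measure emeasure_cball k)
  show thesis
  proof (rule that)
    show "0 < 2 * C1 * K / c + 2 * C2 * B + 1" using K C1 C2 B c by (simp add: add_nonneg_pos)
    fix l :: real and f :: "real ^ 'n \<Rightarrow> real"
    assume l: "0 < l" and [measurable]: "f \<in> borel_measurable borel"
    define I where "I = phi_norm m \<nu> f"
    define f1 where "f1 = (\<lambda>y. if norm y < R then f y else 0)"
    define f2 where "f2 = (\<lambda>y. if norm y < R then 0 else f y)"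
    have [measurable]: "f1 \<in> borel_measurable borel" "f2 \<in> borel_measurable borel"
      unfolding f1_def f2_def by measurable
    have f12: "f = (\<lambda>y. f1 y + f2 y)" by (auto simp: f1_def f2_def)
    have norm1: "(\<integral>\<^sup>+y. ennreal \<bar>f1 y\<bar> \<partial>lborel) \<le> ennreal (1 / c) * I"
    proof -
      have "(\<integral>\<^sup>+y. ennreal \<bar>f1 y\<bar> \<partial>lborel) \<le> (\<integral>\<^sup>+y. ennreal (1 / c) * ennreal (\<bar>f y\<bar> * phi m \<nu> y) \<partial>lborel)"
      proof (intro nn_integral_mono)
        fix y
        have "\<bar>f1 y\<bar> \<le> 1 / c * (\<bar>f y\<bar> * phi m \<nu> y)"
        proof (cases "norm y < R")
          case True
          then have "\<bar>f y\<bar> * c \<le> \<bar>f y\<bar> * phi m \<nu> y" by (intro mult_left_mono c) auto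
          then show ?thesis using c(1) True by (simp add: f1_def field_simps)
        next
          case False
          then show ?thesis using c(1) phi_pos[of m \<nu> y] by (simp add: f1_def)
        qed
        then show "ennreal \<bar>f1 y\<bar> \<le> ennreal (1 / c) * ennreal (\<bar>f y\<bar> * phi m \<nu> y)"
          using c(1) phi_pos[of m \<nu> y] by (subst ennreal_mult[symmetric]) (auto intro!: ennreal_leI)
      qed
      also have "\<dots> = ennreal (1 / c) * I"
        unfolding I_def by (rule nn_integral_cmult) measurable
      finally show ?thesis .
    qed
    have norm2: "phi_norm m \<nu> f2 \<le> I"
      unfolding I_def using phi_pos[where m = m and \<nu> = \<nu> and ?'a = 'n]
      by (intro nn_integral_mono ennreal_leI mult_right_mono) (auto simp: f2_def less_imp_le)
    obtain E where E: "E \<in> sets lborel" "{x. ennreal (l / (2 * C1)) < hl_maximal (\<lambda>y. ennreal \<bar>f1 y\<bar>) x} \<subseteq> E"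
      "ennreal (l / (2 * C1)) * emeasure lborel E \<le> ennreal K * (\<integral>\<^sup>+y. ennreal \<bar>f1 y\<bar> \<partial>lborel)"
      using hl_maximal_weak_type[of "\<lambda>y. ennreal \<bar>f1 y\<bar>" "l / (2 * C1)"] l C1(1) by (auto simp: K_def)
    \<comment> \<open>the bound for the outer part does not depend on the point of the ball, so it exceeds half the height everywhere or nowhere\<close>
    define E2 where "E2 = (if ennreal (l / 2) < ennreal C2 * I then cball (0 :: real ^ 'n) k else {})"
    have incl: "{x. norm x \<le> k \<and> ennreal l < poisson_sup m \<nu> a f x} \<subseteq> E \<union> E2"
    proof
      fix x assume x: "x \<in> {x. norm x \<le> k \<and> ennreal l < poisson_sup m \<nu> a f x}"
      then obtain t where t: "0 < t" "t < a" "ennreal l < poisson_nn m \<nu> t f x"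
        by (auto simp: poisson_sup_def less_SUP_iff)
      show "x \<in> E \<union> E2"
      proof (rule ccontr)
        assume n: "x \<notin> E \<union> E2"
        then have h: "hl_maximal (\<lambda>y. ennreal \<bar>f1 y\<bar>) x \<le> ennreal (l / (2 * C1))"
          using E(2) by (auto simp: not_less[symmetric])
        have i: "ennreal C2 * I \<le> ennreal (l / 2)"
          using n x by (auto simp: E2_def not_less[symmetric] split: if_splits)
        have "poisson_nn m \<nu> t f x \<le> poisson_nn m \<nu> t f1 x + poisson_nn m \<nu> t f2 x"
          unfolding f12 by (rule poisson_nn_add) measurable
        also have "\<dots> \<le> ennreal C1 * hl_maximal (\<lambda>y. ennreal \<bar>f1 y\<bar>) x
            + ennreal C2 * phi_norm m \<nu> f2"
          using t x by (intro add_mono C1 C2) (auto simp: f2_def R_def)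
        also have "\<dots> \<le> ennreal C1 * ennreal (l / (2 * C1)) + ennreal (l / 2)"
          using h i norm2 by (intro add_mono mult_left_mono order.trans[OF mult_left_mono[OF norm2] i]) auto
        also have "\<dots> = ennreal l"
          using C1(1) l by (simp flip: ennreal_mult ennreal_plus)
        finally show False using t(3) by simp
      qed
    qed
    have m1: "ennreal l * emeasure lborel E \<le> ennreal (2 * C1 * K / c) * I"
    proof -
      have "ennreal l * emeasure lborel E = ennreal (2 * C1) * (ennreal (l / (2 * C1)) * emeasure lborel E)"
        using C1(1) l by (simp add: mult.assoc[symmetric] flip: ennreal_mult)
      also have "\<dots> \<le> ennreal (2 * C1) * (ennreal K * (ennreal (1 / c) * I))"
        by (intro mult_left_mono order.trans[OF E(3)] norm1) auto
      also have "\<dots> = ennreal (2 * C1 * K / c) * I"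
        using C1(1) K c(1) by (simp add: mult.assoc[symmetric] flip: ennreal_mult)
      finally show ?thesis .
    qed
    have m2: "ennreal l * emeasure lborel E2 \<le> ennreal (2 * C2 * B) * I"
    proof (cases "ennreal (l / 2) < ennreal C2 * I")
      case True
      have "ennreal l = 2 * ennreal (l / 2)"
        using l by (simp flip: ennreal_numeral ennreal_mult)
      then have "ennreal l * emeasure lborel E2 = 2 * (ennreal (l / 2) * ennreal B)"
        using True B by (simp add: E2_def mult.assoc)
      also have "\<dots> \<le> 2 * (ennreal C2 * I * ennreal B)"
        using True by (intro mult_left_mono mult_right_mono) auto
      also have "\<dots> = ennreal (2 * C2 * B) * I"
        using C2(1) B by (simp add: ennreal_mult mult_ac)
      finally show ?thesis .
    qed (simp add: E2_def)
    have "ennreal l * emeasure lborel {x. norm x \<le> k \<and> ennreal l < poisson_sup m \<nu> a f x}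
        \<le> ennreal l * (emeasure lborel E + emeasure lborel E2)"
    proof (intro mult_left_mono)
      have E_sets: "E \<in> sets borel" "E2 \<in> sets borel" using E by (auto simp: E2_def)
      have "emeasure lborel {x. norm x \<le> k \<and> ennreal l < poisson_sup m \<nu> a f x} \<le> emeasure lborel (E \<union> E2)"
        using incl by (rule emeasure_mono) (simp add: E_sets sets.Un)
      also have "\<dots> \<le> emeasure lborel E + emeasure lborel E2"
        by (rule emeasure_subadditive) (simp_all add: E_sets)
      finally show "emeasure lborel {x. norm x \<le> k \<and> ennreal l < poisson_sup m \<nu> a f x} \<le> emeasure lborel E + emeasure lborel E2" .
    qed simp
    also have "\<dots> \<le> ennreal (2 * C1 * K / c) * I + ennreal (2 * C2 * B) * I"
      unfolding distrib_left by (intro add_mono m1 m2)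
    also have "\<dots> = ennreal (2 * C1 * K / c + 2 * C2 * B) * I"
      using C1(1) K c(1) C2(1) B by (simp flip: distrib_right ennreal_plus)
    also have "\<dots> \<le> ennreal (2 * C1 * K / c + 2 * C2 * B + 1) * I"
      by (intro mult_right_mono ennreal_leI) auto
    finally show "ennreal l * emeasure lborel {x. norm x \<le> k \<and> ennreal l < poisson_sup m \<nu> a f x}
        \<le> ennreal (2 * C1 * K / c + 2 * C2 * B + 1) * phi_norm m \<nu> f"
      by (simp add: I_def)
  qed
qed

text \<open>
  The constants on the balls of radius \<open>k\<close> are compensated by a weight that is small enough on the \<open>k\<close>-th annulus
  to sum the estimates geometrically.
\<close>
lemma poisson_sup_weak_type:
  fixes \<nu> m a :: real
  assumes \<nu>: "0 < \<nu>" and m: "- real CARD('n) \<le> m" and a: "0 < a"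
  obtains \<rho> :: "real ^ 'n \<Rightarrow> real" where "\<rho> \<in> borel_measurable borel" "\<And>x. 0 < \<rho> x"
    "\<And>l (f :: real ^ 'n \<Rightarrow> real). 0 < l \<Longrightarrow> f \<in> borel_measurable borel \<Longrightarrow>
      ennreal l * emeasure (density lborel \<rho>) {x. ennreal l < poisson_sup m \<nu> a f x}
        \<le> phi_norm m \<nu> f"
proof -
  have "\<forall>k::nat. \<exists>C. 0 < C \<and> (\<forall>l (f :: real ^ 'n \<Rightarrow> real). 0 < l \<longrightarrow> f \<in> borel_measurable borel \<longrightarrow>
    ennreal l * emeasure lborel {x. norm x \<le> real k \<and> ennreal l < poisson_sup m \<nu> a f x}
      \<le> ennreal C * phi_norm m \<nu> f)"
  proof
    fix k :: nat
    show "\<exists>C. 0 < C \<and> (\<forall>l (f :: real ^ 'n \<Rightarrow> real). 0 < l \<longrightarrow> f \<in> borel_measurable borel \<longrightarrow>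
      ennreal l * emeasure lborel {x. norm x \<le> real k \<and> ennreal l < poisson_sup m \<nu> a f x}
        \<le> ennreal C * phi_norm m \<nu> f)"
      by (rule poisson_sup_weak_type_on_ball[OF \<nu> m, of "real k" a]) (use a in auto)
  qed
  from choice[OF this] obtain C where C: "\<And>k::nat. 0 < C k"
    "\<And>k l (f :: real ^ 'n \<Rightarrow> real). 0 < l \<Longrightarrow> f \<in> borel_measurable borel \<Longrightarrow>
    ennreal l * emeasure lborel {x. norm x \<le> real k \<and> ennreal l < poisson_sup m \<nu> a f x}
      \<le> ennreal (C k) * phi_norm m \<nu> f"
    by blast
  define r where "r = (\<lambda>k::nat. (1 / 2) ^ Suc k / C k)"
  define \<rho> where "\<rho> = (\<lambda>x :: real ^ 'n. r (nat \<lceil>norm x\<rceil>))"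
  have r: "0 < r k" for k using C(1) by (simp add: r_def)
  have [measurable]: "\<rho> \<in> borel_measurable borel" unfolding \<rho>_def by measurable
  show thesis
  proof (rule that)
    show "\<rho> \<in> borel_measurable borel" by measurable
    show "0 < \<rho> x" for x using r by (simp add: \<rho>_def)
    fix l :: real and f :: "real ^ 'n \<Rightarrow> real"
    assume l: "0 < l" and [measurable]: "f \<in> borel_measurable borel"
    let ?I = "phi_norm m \<nu> f"
    let ?A = "\<lambda>k::nat. {x. norm x \<le> real k \<and> ennreal l < poisson_sup m \<nu> a f x}"
    have [measurable]: "?A k \<in> sets lborel" for k by measurable
    have "emeasure (density lborel \<rho>) {x. ennreal l < poisson_sup m \<nu> a f x}
        = (\<integral>\<^sup>+x. ennreal (\<rho> x) * indicator {x. ennreal l < poisson_sup m \<nu> a f x} x \<partial>lborel)"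
      by (rule emeasure_density) measurable
    also have "\<dots> \<le> (\<integral>\<^sup>+x. (\<Sum>k. ennreal (r k) * indicator (?A k) x) \<partial>lborel)"
    proof (intro nn_integral_mono)
      fix x :: "real ^ 'n"
      define k where "k = nat \<lceil>norm x\<rceil>"
      define F where "F = (\<lambda>k. ennreal (r k) * indicator (?A k) x)"
      have "norm x \<le> real k" by (simp add: k_def)
      then have "ennreal (\<rho> x) * indicator {x. ennreal l < poisson_sup m \<nu> a f x} x = sum F {k}"
        by (simp add: F_def \<rho>_def k_def indicator_def)
      also have "\<dots> \<le> suminf F"
        by (rule sum_le_suminf) (auto intro: summableI)
      finally show "ennreal (\<rho> x) * indicator {x. ennreal l < poisson_sup m \<nu> a f x} x \<le> (\<Sum>k. ennreal (r k) * indicator (?A k) x)"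
        unfolding F_def .
    qed
    also have "\<dots> = (\<Sum>k. \<integral>\<^sup>+x. ennreal (r k) * indicator (?A k) x \<partial>lborel)"
      by (rule nn_integral_suminf) measurable
    also have "\<dots> = (\<Sum>k. ennreal (r k) * emeasure lborel (?A k))"
      by (intro suminf_cong nn_integral_cmult_indicator) measurable
    finally have "ennreal l * emeasure (density lborel \<rho>) {x. ennreal l < poisson_sup m \<nu> a f x}
        \<le> ennreal l * (\<Sum>k. ennreal (r k) * emeasure lborel (?A k))"
      by (rule mult_left_mono) simp
    also have "\<dots> = (\<Sum>k. ennreal (r k) * (ennreal l * emeasure lborel (?A k)))"
      by (subst ennreal_suminf_cmult[symmetric]) (simp only: mult_ac)
    also have "\<dots> \<le> (\<Sum>k. ennreal (r k) * (ennreal (C k) * ?I))"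
      by (intro suminf_le summableI mult_left_mono C(2) l) auto
    also have "\<dots> = (\<Sum>k. ennreal ((1 / 2) ^ Suc k) * ?I)"
    proof (intro suminf_cong)
      fix k
      have "ennreal (r k) * ennreal (C k) = ennreal ((1 / 2) ^ Suc k)"
        using C(1)[of k] r[of k] by (subst ennreal_mult[symmetric]) (auto simp: r_def)
      then show "ennreal (r k) * (ennreal (C k) * ?I) = ennreal ((1 / 2) ^ Suc k) * ?I"
        by (simp only: mult.assoc[symmetric])
    qed
    also have "\<dots> = (\<Sum>k. ennreal ((1 / 2) ^ Suc k)) * ?I"
      by (rule ennreal_suminf_multc)
    also have "(\<Sum>k. ennreal ((1 / 2) ^ Suc k)) = ennreal 1"
      by (intro suminf_ennreal_eq power_half_series) auto
    finally show "ennreal l * emeasure (density lborel \<rho>) {x. ennreal l < poisson_sup m \<nu> a f x} \<le> ?I"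
      by simp
  qed
qed

lemma poisson_sup_weak_type_operator:
  fixes \<nu> m a :: real and \<rho> :: "real ^ 'n \<Rightarrow> real"
  assumes [measurable]: "\<rho> \<in> borel_measurable borel" and \<rho>: "\<And>x. 0 < \<rho> x"
    and weak: "\<And>l (f :: real ^ 'n \<Rightarrow> real). 0 < l \<Longrightarrow> f \<in> borel_measurable borel \<Longrightarrow>
      ennreal l * emeasure (density lborel \<rho>) {x. ennreal l < poisson_sup m \<nu> a f x}
        \<le> phi_norm m \<nu> f"
  shows "weak_type_operator (density lborel (phi m \<nu>)) (density lborel \<rho>) (poisson_sup m \<nu> a) 1"
proof -
  interpret M: sigma_finite_measure "density lborel (phi m \<nu> :: real ^ 'n \<Rightarrow> real)"
    by (subst sigma_finite_measure.sigma_finite_iff_density_finite[OF lborel.sigma_finite_measure_axioms]) auto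
  interpret N: sigma_finite_measure "density lborel \<rho>"
    by (subst sigma_finite_measure.sigma_finite_iff_density_finite[OF lborel.sigma_finite_measure_axioms]) auto
  show ?thesis
  proof
    fix f g :: "real ^ 'n \<Rightarrow> real" and x :: "real ^ 'n" and c l :: real
    assume f: "f \<in> borel_measurable (density lborel (phi m \<nu>))"
    then have [measurable]: "f \<in> borel_measurable borel" by simp
    show "poisson_sup m \<nu> a f \<in> borel_measurable (density lborel \<rho>)" by simp
    show "poisson_sup m \<nu> a (\<lambda>y. c * f y) x \<le> ennreal c * poisson_sup m \<nu> a f x" if "0 \<le> c"
      unfolding poisson_sup_def
      by (intro SUP_least) (auto simp: poisson_nn_scale that intro!: mult_left_mono SUP_upper)
    show "ennreal l * emeasure (density lborel \<rho>) {x \<in> space (density lborel \<rho>). ennreal l < poisson_sup m \<nu> a f x}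
        \<le> ennreal 1 * (\<integral>\<^sup>+y. ennreal \<bar>f y\<bar> \<partial>density lborel (phi m \<nu>))" if "0 < l"
    proof -
      have "(\<integral>\<^sup>+y. ennreal \<bar>f y\<bar> \<partial>density lborel (phi m \<nu>)) = (\<integral>\<^sup>+y. ennreal (phi m \<nu> y) * ennreal \<bar>f y\<bar> \<partial>lborel)"
        by (rule nn_integral_density) measurable
      also have "\<dots> = phi_norm m \<nu> f"
        using phi_pos[where m = m and \<nu> = \<nu> and ?'a = 'n]
        by (intro nn_integral_cong) (simp add: mult.commute less_imp_le flip: ennreal_mult)
      finally show ?thesis using weak[OF that, of f] by simp
    qed
    assume g: "g \<in> borel_measurable (density lborel (phi m \<nu>))"
    then have [measurable]: "g \<in> borel_measurable borel" by simp
    show "poisson_sup m \<nu> a f x \<le> poisson_sup m \<nu> a g x" if "\<And>y. \<bar>f y\<bar> \<le> \<bar>g y\<bar>"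
      unfolding poisson_sup_def by (intro SUP_mono' poisson_nn_mono that)
    show "poisson_sup m \<nu> a (\<lambda>y. f y + g y) x \<le> poisson_sup m \<nu> a f x + poisson_sup m \<nu> a g x"
      unfolding poisson_sup_def
      by (intro SUP_least order.trans[OF poisson_nn_add] add_mono SUP_upper) auto
  qed simp
qed

section \<open>Poisson integrals of functions of varying sign\<close>

lemma heat_eq_lborel:
  fixes f :: "real ^ 'n \<Rightarrow> real"
  assumes [measurable]: "f \<in> borel_measurable borel"
  shows "heat m u f x = (\<integral>y. heat_kernel m u x y * f y \<partial>lborel)"
  unfolding heat_def by (rule integral_completion) measurable

lemma heat_measurable [measurable]:
  fixes f :: "real ^ 'n \<Rightarrow> real"
  assumes [measurable]: "f \<in> borel_measurable borel" "h \<in> borel_measurable M" "g \<in> borel_measurable M"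
  shows "(\<lambda>w. heat m (h w) f (g w)) \<in> borel_measurable M"
  unfolding heat_eq_lborel[OF assms(1)] by measurable

lemma poisson_measurable:
  fixes f :: "real ^ 'n \<Rightarrow> real"
  assumes [measurable]: "f \<in> borel_measurable borel"
  shows "poisson m \<nu> t f \<in> borel_measurable borel"
  unfolding poisson_def[abs_def] set_lebesgue_integral_def by measurable

lemma ennreal_abs_integral_le: "ennreal \<bar>integral\<^sup>L M f\<bar> \<le> (\<integral>\<^sup>+x. ennreal \<bar>f x\<bar> \<partial>M)"
proof (cases "integrable M f")
  case True
  then show ?thesis using integral_norm_bound_ennreal[of M f] by simp
qed (simp add: not_integrable_integral_eq)

lemma abs_heat_le:
  fixes f :: "real ^ 'n \<Rightarrow> real"
  shows "ennreal \<bar>heat m u f x\<bar> \<le> heat_nn m u f x"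
proof -
  have "ennreal \<bar>heat m u f x\<bar> \<le> (\<integral>\<^sup>+y. ennreal \<bar>heat_kernel m u x y * f y\<bar> \<partial>lebesgue)"
    unfolding heat_def by (rule ennreal_abs_integral_le)
  also have "\<dots> = heat_nn m u f x"
    unfolding nn_integral_completion by (intro nn_integral_cong) (simp add: abs_mult ennreal_mult)
  finally show ?thesis .
qed

lemma poisson_integrand_le:
  fixes f :: "real ^ 'n \<Rightarrow> real"
  shows "(\<integral>\<^sup>+u. ennreal \<bar>indicator {0<..} u * (exp (- t\<^sup>2 / (4 * u)) * heat m u f x / u powr (1 + \<nu>))\<bar> \<partial>lborel)
    \<le> (\<integral>\<^sup>+u\<in>{0<..}. ennreal (subordinator \<nu> t u)
        * heat_nn m u f x \<partial>lborel)"
proof (intro nn_integral_mono)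
  fix u :: real
  let ?e = "subordinator \<nu> t u"
  have "\<bar>exp (- t\<^sup>2 / (4 * u)) * heat m u f x / u powr (1 + \<nu>)\<bar> = ?e * \<bar>heat m u f x\<bar>"
    by (simp add: abs_mult)
  also have "ennreal \<dots> = ennreal ?e * ennreal \<bar>heat m u f x\<bar>"
    by (rule ennreal_mult) auto
  also have "\<dots> \<le> ennreal ?e * heat_nn m u f x"
    by (intro mult_left_mono abs_heat_le) simp
  finally show "ennreal \<bar>indicator {0<..} u * (exp (- t\<^sup>2 / (4 * u)) * heat m u f x / u powr (1 + \<nu>))\<bar>
      \<le> ennreal ?e * heat_nn m u f x * indicator {0<..} u"
    by (auto simp: indicator_def)
qed

lemma poisson_alt:
  "poisson m \<nu> t f x = poisson_factor \<nu> t * (\<integral>u. indicator {0<..} u * (exp (- t\<^sup>2 / (4 * u)) * heat m u f x / u powr (1 + \<nu>)) \<partial>lborel)"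
  by (simp add: poisson_def poisson_factor_def set_lebesgue_integral_def)

lemma abs_poisson_le:
  fixes f :: "real ^ 'n \<Rightarrow> real"
  assumes "0 < \<nu>" "0 < t"
  shows "ennreal \<bar>poisson m \<nu> t f x\<bar> \<le> poisson_nn m \<nu> t f x"
proof -
  let ?S = "\<integral>u. indicator {0<..} u * (exp (- t\<^sup>2 / (4 * u)) * heat m u f x / u powr (1 + \<nu>)) \<partial>lborel"
  have "ennreal \<bar>poisson m \<nu> t f x\<bar> = ennreal (poisson_factor \<nu> t) * ennreal \<bar>?S\<bar>"
    using poisson_factor_pos[OF assms] by (simp add: poisson_alt abs_mult ennreal_mult)
  also have "\<dots> \<le> poisson_nn m \<nu> t f x"
    unfolding poisson_nn_borel
    by (intro mult_left_mono order.trans[OF ennreal_abs_integral_le poisson_integrand_le]) simp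
  finally show ?thesis .
qed

lemma poisson_nn_finite_iff:
  fixes f :: "real ^ 'n \<Rightarrow> real"
  assumes "0 < \<nu>" "0 < t"
  shows "poisson_nn m \<nu> t f x < \<infinity> \<longleftrightarrow>
    (\<integral>\<^sup>+u\<in>{0<..}. ennreal (subordinator \<nu> t u)
        * heat_nn m u f x \<partial>lborel) < \<infinity>"
  using poisson_factor_pos[OF assms] unfolding poisson_nn_borel
  by (auto simp: ennreal_mult_less_top)

lemma poisson_nn_finite_mono:
  fixes f :: "real ^ 'n \<Rightarrow> real"
  assumes \<nu>: "0 < \<nu>" and st: "0 < s" "s \<le> t" and fin: "poisson_nn m \<nu> s f x < \<infinity>"
  shows "poisson_nn m \<nu> t f x < \<infinity>"
proof -
  let ?H = "\<lambda>u. heat_nn m u f x"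
  have "(\<integral>\<^sup>+u\<in>{0<..}. ennreal (subordinator \<nu> t u) * ?H u \<partial>lborel)
     \<le> (\<integral>\<^sup>+u\<in>{0<..}. ennreal (subordinator \<nu> s u) * ?H u \<partial>lborel)"
  proof (intro nn_integral_mono)
    fix u :: real
    have "subordinator \<nu> t u \<le> subordinator \<nu> s u" if "0 < u"
      using that st by (intro divide_right_mono) (auto intro!: divide_right_mono power_mono)
    then show "ennreal (subordinator \<nu> t u) * ?H u * indicator {0<..} u
        \<le> ennreal (subordinator \<nu> s u) * ?H u * indicator {0<..} u"
      by (auto simp: indicator_def intro!: mult_right_mono ennreal_leI)
  qed
  also have "\<dots> < \<infinity>" using fin poisson_nn_finite_iff[of \<nu> s m f x] \<nu> st by simp
  finally show ?thesis using poisson_nn_finite_iff[of \<nu> t m f x] \<nu> st by simp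
qed

text \<open>
  Dominated convergence: the factors \<open>e\<^bsup>-t\<^sup>2/4u\<^esup>\<close> decrease in \<open>t\<close>, so the integrand at time \<open>s\<close> dominates
  those at all later times.
\<close>
lemma poisson_continuous_time:
  fixes f :: "real ^ 'n \<Rightarrow> real" and T :: "nat \<Rightarrow> real"
  assumes [measurable]: "f \<in> borel_measurable borel" and \<nu>: "0 < \<nu>" and s: "0 < s"
    and fin: "poisson_nn m \<nu> s f x < \<infinity>" and T: "\<And>n. s \<le> T n" "T \<longlonglongrightarrow> t"
  shows "(\<lambda>n. poisson m \<nu> (T n) f x) \<longlonglongrightarrow> poisson m \<nu> t f x"
proof -
  have t: "0 < t" using LIMSEQ_le_const[OF T(2), of s] T(1) s by force
  let ?g = "\<lambda>t u. indicator {0<..} u * (exp (- t\<^sup>2 / (4 * u)) * heat m u f x / u powr (1 + \<nu>))"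
  have int: "integrable lborel (\<lambda>u. \<bar>?g s u\<bar>)"
  proof (rule integrableI_bounded)
    show "(\<integral>\<^sup>+u. ennreal (norm \<bar>?g s u\<bar>) \<partial>lborel) < \<infinity>"
      using poisson_integrand_le[of s m f x \<nu>] fin poisson_nn_finite_iff[of \<nu> s m f x] \<nu> s
      by (simp add: le_less_trans)
  qed measurable
  have "(\<lambda>n. \<integral>u. ?g (T n) u \<partial>lborel) \<longlonglongrightarrow> (\<integral>u. ?g t u \<partial>lborel)"
  proof (rule integral_dominated_convergence[OF _ _ int])
    show "AE u in lborel. (\<lambda>n. ?g (T n) u) \<longlonglongrightarrow> ?g t u"
    proof (rule AE_I2)
      fix u :: real
      show "(\<lambda>n. ?g (T n) u) \<longlonglongrightarrow> ?g t u"
      proof (cases "0 < u")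
        case True
        then show ?thesis by (auto intro!: tendsto_intros T(2))
      qed simp
    qed
    show "AE u in lborel. norm (?g (T n) u) \<le> \<bar>?g s u\<bar>" for n
    proof (rule AE_I2)
      fix u :: real
      have "exp (- (T n)\<^sup>2 / (4 * u)) * (\<bar>heat m u f x\<bar> / u powr (1 + \<nu>)) \<le> exp (- s\<^sup>2 / (4 * u)) * (\<bar>heat m u f x\<bar> / u powr (1 + \<nu>))" if "0 < u"
        using that s T(1)[of n] by (intro mult_right_mono) (auto intro!: divide_right_mono power_mono)
      then show "norm (?g (T n) u) \<le> \<bar>?g s u\<bar>"
        by (auto simp: indicator_def abs_mult)
    qed
  qed measurable
  moreover have "(\<lambda>n. poisson_factor \<nu> (T n)) \<longlonglongrightarrow> poisson_factor \<nu> t"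
    unfolding poisson_factor_def using t Gamma_real_pos[OF \<nu>]
    by (intro tendsto_intros T(2)) (auto simp del: Gamma_eq_zero_iff)
  ultimately show ?thesis
    unfolding poisson_alt by (rule tendsto_mult[rotated])
qed

text \<open>
  Where the maximal operator for absolute values is finite, all integrals converge absolutely and \<open>P\<^sub>t f(x)\<close> is
  continuous in \<open>t\<close>. This is what makes the maximal function of a signed \<open>f\<close> measurable.
\<close>
lemma poisson_max_eq_rational_SUP:
  fixes f :: "real ^ 'n \<Rightarrow> real"
  assumes [measurable]: "f \<in> borel_measurable borel" and \<nu>: "0 < \<nu>"
    and fin: "poisson_sup m \<nu> a f x < \<infinity>"
  shows "poisson_max m \<nu> a f x = (SUP t\<in>{0<..<a} \<inter> \<rat>. ennreal \<bar>poisson m \<nu> t f x\<bar>)"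
proof -
  have rat: "poisson_nn m \<nu> t f x < \<infinity>" if "t \<in> {0<..<a} \<inter> \<rat>" for t
    using fin SUP_upper[OF that, of "\<lambda>t. poisson_nn m \<nu> t f x"] by (simp add: poisson_sup_def le_less_trans)
  have below: "\<exists>s\<in>{0<..<a} \<inter> \<rat>. s < t" if t: "t \<in> {0<..<a}" for t
  proof -
    have "0 < t" using t by simp
    then obtain s where "s \<in> \<rat>" "0 < s" "s < t" using Rats_dense_in_real by blast
    then show ?thesis using t by (intro bexI[of _ s]) auto
  qed
  have all: "poisson_nn m \<nu> t f x < \<infinity>" if t: "t \<in> {0<..<a}" for t
  proof -
    obtain s where "s \<in> {0<..<a} \<inter> \<rat>" "s < t" using below[OF t] by blast
    then show ?thesis using poisson_nn_finite_mono[OF \<nu>, of s t m f x] rat[of s] by simp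
  qed
  have "poisson_max m \<nu> a f x = (SUP t\<in>{0<..<a}. ennreal \<bar>poisson m \<nu> t f x\<bar>)"
    unfolding poisson_max_def using all by (intro SUP_cong) auto
  also have "\<dots> = (SUP t\<in>{0<..<a} \<inter> \<rat>. ennreal \<bar>poisson m \<nu> t f x\<bar>)" (is "_ = ?S")
  proof (rule antisym)
    show "?S \<le> (SUP t\<in>{0<..<a}. ennreal \<bar>poisson m \<nu> t f x\<bar>)"
      by (rule SUP_subset_mono) auto
    show "(SUP t\<in>{0<..<a}. ennreal \<bar>poisson m \<nu> t f x\<bar>) \<le> ?S"
    proof (rule SUP_least)
      fix t assume t: "t \<in> {0<..<a}"
      obtain s where s: "s \<in> {0<..<a} \<inter> \<rat>" "s < t" using below[OF t] by blast
      \<comment> \<open>times bounded away from zero, so that one integrand dominates all of them\<close>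
      have "\<exists>q. q \<in> \<rat> \<and> s \<le> q \<and> 0 < q \<and> q < t \<and> t - 1 / real (Suc n) < q" for n
      proof -
        have "max s (t - 1 / real (Suc n)) < t" using s by simp
        then obtain q where "q \<in> \<rat>" "max s (t - 1 / real (Suc n)) < q" "q < t"
          using Rats_dense_in_real by blast
        then show ?thesis using s by (intro exI[of _ q]) auto
      qed
      then obtain T where T: "\<And>n. T n \<in> \<rat> \<and> s \<le> T n \<and> 0 < T n \<and> T n < t \<and> t - 1 / real (Suc n) < T n"
        by metis
      have "T \<longlonglongrightarrow> t"
      proof (rule tendsto_sandwich)
        show "eventually (\<lambda>n. t - 1 / real (Suc n) \<le> T n) sequentially" using T by (simp add: less_imp_le)
        show "eventually (\<lambda>n. T n \<le> t) sequentially" using T by (simp add: less_imp_le)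
        show "(\<lambda>n. t - 1 / real (Suc n)) \<longlonglongrightarrow> t"
          using tendsto_diff[OF tendsto_const[of t] LIMSEQ_inverse_real_of_nat] by (simp add: inverse_eq_divide)
      qed simp
      then have "(\<lambda>n. poisson m \<nu> (T n) f x) \<longlonglongrightarrow> poisson m \<nu> t f x"
        using s rat[of s] T by (intro poisson_continuous_time[where s = s] \<nu>) auto
      then have "(\<lambda>n. ennreal \<bar>poisson m \<nu> (T n) f x\<bar>) \<longlonglongrightarrow> ennreal \<bar>poisson m \<nu> t f x\<bar>"
        by (intro tendsto_ennrealI tendsto_rabs)
      then show "ennreal \<bar>poisson m \<nu> t f x\<bar> \<le> ?S"
      proof (rule LIMSEQ_le_const2)
        have "T n \<in> {0<..<a} \<inter> \<rat>" for n using T[of n] t by auto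
        then show "\<exists>N. \<forall>n\<ge>N. ennreal \<bar>poisson m \<nu> (T n) f x\<bar> \<le> ?S"
          by (intro exI[of _ 0] allI impI SUP_upper)
      qed
    qed
  qed
  finally show ?thesis .
qed

lemma poisson_max_le_poisson_sup:
  fixes f :: "real ^ 'n \<Rightarrow> real"
  assumes "f \<in> borel_measurable borel" and \<nu>: "0 < \<nu>" and "poisson_sup m \<nu> a f x < \<infinity>"
  shows "poisson_max m \<nu> a f x \<le> poisson_sup m \<nu> a f x"
  unfolding poisson_max_eq_rational_SUP[OF assms] poisson_sup_def
  by (rule SUP_mono) (use \<nu> in \<open>auto intro!: bexI abs_poisson_le\<close>)

lemma borel_measurable_lebesgue_cong_AE:
  fixes f g :: "'a::euclidean_space \<Rightarrow> 'b::topological_space"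
  assumes f: "f \<in> borel_measurable lebesgue" and ae: "AE x in lebesgue. f x = g x"
  shows "g \<in> borel_measurable lebesgue"
proof (rule measurableI)
  fix A :: "'b set" assume "A \<in> sets borel"
  then have A: "f -` A \<inter> space lebesgue \<in> sets lebesgue" by (rule measurable_sets[OF f])
  have eq: "AE x in lebesgue. x \<in> f -` A \<inter> space lebesgue \<longleftrightarrow> x \<in> g -` A \<inter> space lebesgue"
    using ae by eventually_elim simp
  show "g -` A \<inter> space lebesgue \<in> sets lebesgue"
    by (rule completion.in_sets_AE[OF eq A]) auto
qed simp

lemma poisson_max_measurable:
  fixes f :: "real ^ 'n \<Rightarrow> real"
  assumes [measurable]: "f \<in> borel_measurable borel" and \<nu>: "0 < \<nu>"
    and fin: "AE x in lborel. poisson_sup m \<nu> a f x < \<infinity>"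
  shows "poisson_max m \<nu> a f \<in> borel_measurable lebesgue"
proof -
  have [measurable]: "poisson m \<nu> t f \<in> borel_measurable borel" for t
    by (rule poisson_measurable) fact
  have "(\<lambda>x. SUP t\<in>{0<..<a} \<inter> \<rat>. ennreal \<bar>poisson m \<nu> t f x\<bar>) \<in> borel_measurable lborel"
    by (intro borel_measurable_SUP countable_rational_times) measurable
  then have "(\<lambda>x. SUP t\<in>{0<..<a} \<inter> \<rat>. ennreal \<bar>poisson m \<nu> t f x\<bar>) \<in> borel_measurable lebesgue"
    by (rule measurable_completion)
  moreover have "AE x in lebesgue. (SUP t\<in>{0<..<a} \<inter> \<rat>. ennreal \<bar>poisson m \<nu> t f x\<bar>) = poisson_max m \<nu> a f x"
  proof (rule AE_completion)
    show "AE x in lborel. (SUP t\<in>{0<..<a} \<inter> \<rat>. ennreal \<bar>poisson m \<nu> t f x\<bar>) = poisson_max m \<nu> a f x"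
      using fin by eventually_elim (simp add: poisson_max_eq_rational_SUP \<nu>)
  qed
  ultimately show ?thesis
    by (rule borel_measurable_lebesgue_cong_AE)
qed

text \<open>For \<open>f \<ge> 0\<close> the Bochner integrals agree with the integrals in \<open>[0, \<infinity>]\<close> as soon as the latter are finite.\<close>
lemma poisson_nn_le_poisson_max:
  fixes f :: "real ^ 'n \<Rightarrow> real"
  assumes [measurable]: "f \<in> borel_measurable borel" and f: "\<And>y. 0 \<le> f y"
    and \<nu>: "0 < \<nu>" and t: "0 < t" "t < a"
  shows "poisson_nn m \<nu> t f x \<le> poisson_max m \<nu> a f x"
proof -
  have "poisson_nn m \<nu> t f x \<le> (if poisson_nn m \<nu> t f x < \<infinity> then ennreal \<bar>poisson m \<nu> t f x\<bar> else \<infinity>)"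
  proof (cases "poisson_nn m \<nu> t f x < \<infinity>")
    case True
    let ?H = "\<lambda>u. heat_nn m u f x"
    let ?e = "\<lambda>u. subordinator \<nu> t u"
    let ?g = "\<lambda>u. indicator {0<..} u * (exp (- t\<^sup>2 / (4 * u)) * heat m u f x / u powr (1 + \<nu>))"
    have fin: "(\<integral>\<^sup>+u. ennreal (?e u) * ?H u * indicator {0<..} u \<partial>lborel) < \<infinity>"
      using True poisson_nn_finite_iff[OF \<nu> t(1)] by blast
    have heat: "heat m u f x = enn2real (?H u)" for u
    proof -
      have "heat m u f x = enn2real (\<integral>\<^sup>+y. ennreal (heat_kernel m u x y * f y) \<partial>lborel)"
        unfolding heat_eq_lborel[OF assms(1)] by (rule integral_eq_nn_integral) (auto simp: f)
      then show ?thesis using f by (simp add: ennreal_mult)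
    qed
    have "AE u in lborel. ennreal (?e u) * ?H u * indicator {0<..} u \<noteq> \<infinity>"
      using fin by (intro nn_integral_PInf_AE) auto
    then have "AE u in lborel. ennreal (?g u) = ennreal (?e u) * ?H u * indicator {0<..} u"
    proof eventually_elim
      case (elim u)
      show ?case
      proof (cases "0 < u")
        case True
        have "0 < ?e u" using True by simp
        then have "?H u \<noteq> \<infinity>" using elim True by (auto simp: ennreal_mult_eq_top_iff)
        then have "ennreal (heat m u f x) = ?H u" by (simp add: heat less_top)
        moreover have "ennreal (?g u) = ennreal (?e u) * ennreal (heat m u f x)"
          using True by (subst ennreal_mult[symmetric]) (auto simp: heat)
        ultimately show ?thesis using True by simp
      qed simp
    qed
    then have "(\<integral>\<^sup>+u. ennreal (?g u) \<partial>lborel) = (\<integral>\<^sup>+u. ennreal (?e u) * ?H u * indicator {0<..} u \<partial>lborel)"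
      by (rule nn_integral_cong_AE)
    moreover have "(\<integral>u. ?g u \<partial>lborel) = enn2real (\<integral>\<^sup>+u. ennreal (?g u) \<partial>lborel)"
      by (rule integral_eq_nn_integral) (auto simp: heat indicator_def)
    ultimately have "ennreal (\<integral>u. ?g u \<partial>lborel) = (\<integral>\<^sup>+u. ennreal (?e u) * ?H u * indicator {0<..} u \<partial>lborel)"
      using fin by (simp add: less_top)
    then have "poisson_nn m \<nu> t f x = ennreal (poisson_factor \<nu> t) * ennreal (\<integral>u. ?g u \<partial>lborel)"
      unfolding poisson_nn_borel by simp
    also have "\<dots> = ennreal (poisson m \<nu> t f x)"
      using poisson_factor_pos[OF \<nu> t(1)] unfolding poisson_alt by (subst ennreal_mult') auto
    also have "\<dots> \<le> ennreal \<bar>poisson m \<nu> t f x\<bar>" by (rule ennreal_leI) simp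
    finally show ?thesis using True by simp
  qed (simp add: less_top)
  also have "\<dots> \<le> poisson_max m \<nu> a f x"
    unfolding poisson_max_def using t by (intro SUP_upper) auto
  finally show ?thesis .
qed

lemma poisson_max_cong_AE:
  fixes f g :: "real ^ 'n \<Rightarrow> real"
  assumes f: "f \<in> borel_measurable lebesgue" and g: "g \<in> borel_measurable lebesgue"
    and eq: "AE y in lborel. f y = g y"
  shows "poisson_max m \<nu> a f = poisson_max m \<nu> a g"
proof -
  have eq': "AE y in lebesgue. f y = g y" using eq by (rule AE_completion)
  have h: "heat_kernel m u x \<in> borel_measurable lebesgue" for u and x :: "real ^ 'n"
    by (rule measurable_completion) measurable
  have "heat m u f x = heat m u g x" for u x
    unfolding heat_def
    by (intro integral_cong_AE borel_measurable_times h f g) (use eq' in eventually_elim, simp)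
  moreover have "poisson_nn m \<nu> t f x = poisson_nn m \<nu> t g x" for t x
  proof -
    have "(\<integral>\<^sup>+y. ennreal (heat_kernel m u x y * \<bar>f y\<bar>) \<partial>lebesgue) = (\<integral>\<^sup>+y. ennreal (heat_kernel m u x y * \<bar>g y\<bar>) \<partial>lebesgue)" for u
      by (rule nn_integral_cong_AE, use eq' in eventually_elim) simp
    then show ?thesis by (simp add: poisson_nn_def)
  qed
  ultimately show ?thesis
    by (simp add: fun_eq_iff poisson_max_def poisson_def)
qed

section \<open>Powers of extended nonnegative numbers and representatives of weights\<close>

lemma ennpowr_mono: "0 < q \<Longrightarrow> A \<le> B \<Longrightarrow> ennpowr A q \<le> ennpowr B q"
  by (cases A; cases B) (auto simp: ennpowr_def top_unique intro!: ennreal_leI powr_mono2)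

lemma ennpowr_ennreal: "0 \<le> r \<Longrightarrow> ennpowr (ennreal r) q = ennreal (r powr q)"
  by (simp add: ennpowr_def)

lemma ennpowr_finite_iff: "ennpowr A q < \<infinity> \<longleftrightarrow> A < \<infinity>"
  by (cases A) (auto simp: ennpowr_def)

lemma ennpowr_ennpowr: "0 < q \<Longrightarrow> 0 < r \<Longrightarrow> ennpowr (ennpowr A q) r = ennpowr A (q * r)"
  by (cases A) (auto simp: ennpowr_def powr_powr)

lemma ennpowr_one: "ennpowr A 1 = A"
  by (cases A) (auto simp: ennpowr_def)

lemma ennpowr_mult_ennreal: "0 < c \<Longrightarrow> 0 < q \<Longrightarrow> ennpowr (ennreal c * A) q = ennreal (c powr q) * ennpowr A q"
  by (cases A) (auto simp: ennpowr_def ennreal_mult_top powr_mult simp flip: ennreal_mult)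

text \<open>Translates inequalities between norms into inequalities between integrals of \<open>p\<close>-th powers.\<close>
lemma ennpowr_le_iff:
  assumes p: "0 < p" and C: "0 < C"
  shows "ennpowr A (1 / p) \<le> ennreal C * ennpowr B (1 / p) \<longleftrightarrow> A \<le> ennreal (C powr p) * B"
proof
  assume "ennpowr A (1 / p) \<le> ennreal C * ennpowr B (1 / p)"
  then have "ennpowr (ennpowr A (1 / p)) p \<le> ennpowr (ennreal C * ennpowr B (1 / p)) p"
    using p by (intro ennpowr_mono)
  then show "A \<le> ennreal (C powr p) * B"
    using p C by (simp add: ennpowr_mult_ennreal ennpowr_ennpowr ennpowr_one)
next
  assume "A \<le> ennreal (C powr p) * B"
  then have "ennpowr A (1 / p) \<le> ennpowr (ennreal (C powr p) * B) (1 / p)"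
    using p by (intro ennpowr_mono) auto
  then show "ennpowr A (1 / p) \<le> ennreal C * ennpowr B (1 / p)"
    using p C by (simp add: ennpowr_mult_ennreal powr_powr)
qed

lemma weight_borel_representative:
  fixes w :: "real ^ 'n \<Rightarrow> real"
  assumes "weight w"
  obtains w' where "w' \<in> borel_measurable borel" "\<And>x. 0 < w' x" "AE x in lborel. w x = w' x"
proof -
  obtain w0 where w0 [measurable]: "w0 \<in> borel_measurable lborel" and eq: "AE x in lborel. w x = w0 x"
    using assms completion_ex_borel_measurable_real[of w lborel] by (auto simp: weight_def)
  have pos: "AE x in lborel. 0 < w x"
    using assms by (simp add: weight_def AE_completion_iff)
  show thesis
  proof (rule that[of "\<lambda>x. if 0 < w0 x then w0 x else 1"])
    show "(\<lambda>x. if 0 < w0 x then w0 x else 1) \<in> borel_measurable borel"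
      using w0 by simp
    show "AE x in lborel. w x = (if 0 < w0 x then w0 x else 1)"
      using eq pos by eventually_elim auto
  qed auto
qed

section \<open>Sufficiency of the weight condition\<close>

text \<open>Since the weight \<open>v\<close> contains the factor \<open>min(1, T\<sigma>)\<^sup>2\<close>, it is positive only where \<open>T\<sigma>\<close> is.\<close>
lemma poisson_nn_pos:
  fixes \<sigma> :: "real ^ 'n \<Rightarrow> real"
  assumes [measurable]: "\<sigma> \<in> borel_measurable borel" and \<sigma>: "\<And>y. 0 < \<sigma> y" and \<nu>: "0 < \<nu>" and t: "0 < t"
  shows "0 < poisson_nn m \<nu> t \<sigma> x"
proof (rule ccontr)
  assume "\<not> ?thesis"
  then have "poisson_nn m \<nu> t \<sigma> x = 0" by simp
  then have "(\<integral>\<^sup>+u\<in>{0<..}. ennreal (subordinator \<nu> t u)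
        * heat_nn m u \<sigma> x \<partial>lborel) = 0"
    using poisson_factor_pos[OF \<nu> t] unfolding poisson_nn_borel by auto
  then have zero: "AE u in lborel. ennreal (subordinator \<nu> t u)
        * heat_nn m u \<sigma> x * indicator {0<..} u = 0"
    by (subst (asm) nn_integral_0_iff_AE) auto
  have nonzero: "heat_nn m u \<sigma> x \<noteq> 0" if u: "0 < u" for u
  proof
    assume "heat_nn m u \<sigma> x = 0"
    then have "AE y in lborel. ennreal (heat_kernel m u x y) * ennreal \<bar>\<sigma> y\<bar> = 0"
      by (subst (asm) nn_integral_0_iff_AE) auto
    moreover have "ennreal (heat_kernel m u x y) * ennreal \<bar>\<sigma> y\<bar> \<noteq> 0" for y
      using heat_kernel_pos[OF u, of m x y] \<sigma>[of y] by simp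
    ultimately have "AE y in (lborel :: (real ^ 'n) measure). False" by auto
    then show False
      by (auto simp: AE_iff_null_sets[symmetric] trivial_limit_def[symmetric] ae_filter_eq_bot_iff)
  qed
  from zero have "AE u in lborel. \<not> (0 < (u :: real))"
  proof eventually_elim
    case (elim u)
    then show ?case using nonzero[of u] by (cases "0 < u") auto
  qed
  then have "emeasure lborel {u \<in> space lborel. 0 < (u :: real)} = 0"
    by (rule emeasure_eq_0_AE)
  moreover have "emeasure lborel {0<..1::real} \<le> emeasure lborel {u \<in> space lborel. 0 < (u :: real)}"
    by (rule emeasure_mono) auto
  ultimately show False by simp
qed

lemma density_measurable_iff [simp]: "borel_measurable (density lborel g) = borel_measurable borel"
  by (rule measurable_cong_sets) auto

text \<open>
  With \<open>\<sigma> = (\<phi> / w)\<^bsup>p' - 1\<^esup>\<close> the two exponent identities \<open>\<phi> \<sigma> = (w\<^bsup>-1/p\<^esup> \<phi>)\<^bsup>p'\<^esup>\<close> and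
  \<open>\<phi> \<sigma>\<^bsup>1-p\<^esup> = w\<close> turn the hypothesis into \<open>\<sigma> \<in> L\<^sup>1(\<phi>)\<close> and the factorized strong type bound into a
  bound on \<open>L\<^sup>p(w)\<close>.
\<close>
lemma weighted_bound_exists:
  fixes m \<nu> p p' a :: real and w :: "real ^ 'n \<Rightarrow> real"
  assumes m: "- real CARD('n) \<le> m" and \<nu>: "0 < \<nu>" and p: "1 < p" and pp: "1 / p + 1 / p' = 1" and a: "0 < a"
    and [measurable]: "w \<in> borel_measurable borel" and w: "\<And>x. 0 < w x"
    and fin: "(\<integral>\<^sup>+y. ennreal ((w y powr (- 1 / p) * phi m \<nu> y) powr p') \<partial>lborel) < \<infinity>"
  obtains v C where "v \<in> borel_measurable borel" "AE x in lborel. 0 < v x" "0 < C"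
    "\<And>f :: real ^ 'n \<Rightarrow> real. f \<in> borel_measurable borel \<Longrightarrow>
      (\<integral>\<^sup>+x. ennpowr (poisson_sup m \<nu> a f x) p * ennreal (v x) \<partial>lborel)
        \<le> ennreal C * (\<integral>\<^sup>+y. ennreal (\<bar>f y\<bar> powr p * w y) \<partial>lborel)"
proof -
  have p': "0 < p'" "p' - 1 = 1 / (p - 1)" "p' / p = p' - 1"
  proof -
    have "p' \<noteq> 0" using pp p by auto
    have "1 / p' = (p - 1) / p" using pp p by (simp add: field_simps)
    then have q: "p' = p / (p - 1)" using p \<open>p' \<noteq> 0\<close> by (simp add: field_simps)
    show "0 < p'" "p' - 1 = 1 / (p - 1)" "p' / p = p' - 1"
      unfolding q using p by (simp_all add: field_simps)
  qed
  obtain \<rho> :: "real ^ 'n \<Rightarrow> real" where \<rho>: "\<rho> \<in> borel_measurable borel" "\<And>x. 0 < \<rho> x"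
    "\<And>l (f :: real ^ 'n \<Rightarrow> real). 0 < l \<Longrightarrow> f \<in> borel_measurable borel \<Longrightarrow>
      ennreal l * emeasure (density lborel \<rho>) {x. ennreal l < poisson_sup m \<nu> a f x}
        \<le> phi_norm m \<nu> f"
    using poisson_sup_weak_type[OF \<nu> m a] by blast
  note [measurable] = \<rho>(1)
  interpret weak_type_operator "density lborel (phi m \<nu>)" "density lborel \<rho>" "poisson_sup m \<nu> a" 1
    using \<rho> by (rule poisson_sup_weak_type_operator)
  have \<phi>: "0 < phi m \<nu> y" for y :: "real ^ 'n" by (rule phi_pos)
  define \<sigma> where "\<sigma> = (\<lambda>y. (phi m \<nu> y / w y) powr (p' - 1))"
  have \<sigma>_pos: "0 < \<sigma> y" for y using \<phi>[of y] w[of y] by (simp add: \<sigma>_def)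
  have [measurable]: "\<sigma> \<in> borel_measurable borel" unfolding \<sigma>_def by measurable
  have \<sigma>_int: "(\<integral>\<^sup>+y. ennreal \<bar>\<sigma> y\<bar> \<partial>density lborel (phi m \<nu>)) < \<infinity>"
  proof -
    have "(\<integral>\<^sup>+y. ennreal \<bar>\<sigma> y\<bar> \<partial>density lborel (phi m \<nu>)) = (\<integral>\<^sup>+y. ennreal (phi m \<nu> y) * ennreal \<bar>\<sigma> y\<bar> \<partial>lborel)"
      by (rule nn_integral_density) measurable
    also have "\<dots> = (\<integral>\<^sup>+y. ennreal ((w y powr (- 1 / p) * phi m \<nu> y) powr p') \<partial>lborel)"
    proof (intro nn_integral_cong)
      fix y
      have "phi m \<nu> y * \<sigma> y = (phi m \<nu> y powr 1 * phi m \<nu> y powr (p' - 1)) * w y powr (- (p' - 1))"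
        using \<phi>[of y] w[of y] powr_minus_divide[of "w y" "p' - 1"] by (simp add: \<sigma>_def powr_divide)
      also have "\<dots> = phi m \<nu> y powr p' * w y powr (- 1 / p * p')"
        unfolding powr_add[symmetric] using p'(3) by simp
      also have "\<dots> = (w y powr (- 1 / p) * phi m \<nu> y) powr p'"
        using \<phi>[of y] w[of y] by (simp add: powr_mult powr_powr)
      finally show "ennreal (phi m \<nu> y) * ennreal \<bar>\<sigma> y\<bar> = ennreal ((w y powr (- 1 / p) * phi m \<nu> y) powr p')"
        using \<phi>[of y] \<sigma>_pos[of y] by (simp add: less_imp_le flip: ennreal_mult)
    qed
    finally show ?thesis using fin by simp
  qed
  define v where "v = (\<lambda>x. \<rho> x * (damp \<sigma> x / enn2real (poisson_sup m \<nu> a \<sigma> x) powr p))"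
  have dm: "damp \<sigma> \<in> borel_measurable borel"
    using damp_measurable[of \<sigma>] by simp
  note [measurable] = dm
  define C where "C = 4 * 1 * p / (p - 1) * 2 powr (p - 1)"
  show thesis
  proof (rule that)
    show "0 < C" using p by (simp add: C_def)
    show "v \<in> borel_measurable borel" unfolding v_def by measurable
    have "AE x in density lborel \<rho>. poisson_sup m \<nu> a \<sigma> x < \<infinity>"
      by (rule finite_AE[OF _ \<sigma>_int]) simp
    then have "AE x in lborel. poisson_sup m \<nu> a \<sigma> x < \<infinity>"
      using \<rho>(2) by (subst (asm) AE_density) auto
    then show "AE x in lborel. 0 < v x"
    proof eventually_elim
      case (elim x)
      obtain t where t: "t \<in> \<rat>" "0 < t" "t < a" using Rats_dense_in_real[OF a] by blast
      have "0 < poisson_nn m \<nu> t \<sigma> x" by (rule poisson_nn_pos) (use \<sigma>_pos \<nu> t in auto)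
      also have "\<dots> \<le> poisson_sup m \<nu> a \<sigma> x"
        unfolding poisson_sup_def using t by (intro SUP_upper) auto
      finally have "0 < enn2real (poisson_sup m \<nu> a \<sigma> x)"
        using elim by (simp add: enn2real_positive_iff)
      then show ?case using \<rho>(2)[of x] by (simp add: v_def damp_def)
    qed
    fix f :: "real ^ 'n \<Rightarrow> real" assume [measurable]: "f \<in> borel_measurable borel"
    let ?F = "\<lambda>x. ennpowr (poisson_sup m \<nu> a f x) p * ennreal (damp \<sigma> x / enn2real (poisson_sup m \<nu> a \<sigma> x) powr p)"
    have [measurable]: "(\<lambda>x. ennpowr (poisson_sup m \<nu> a f x) p) \<in> borel_measurable borel"
      unfolding ennpowr_def by measurable
    have "(\<integral>\<^sup>+x. ennpowr (poisson_sup m \<nu> a f x) p * ennreal (v x) \<partial>lborel) = (\<integral>\<^sup>+x. ennreal (\<rho> x) * ?F x \<partial>lborel)"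
    proof (intro nn_integral_cong)
      fix x
      have "ennreal (v x) = ennreal (\<rho> x) * ennreal (damp \<sigma> x / enn2real (poisson_sup m \<nu> a \<sigma> x) powr p)"
        unfolding v_def using \<rho>(2)[of x] by (intro ennreal_mult) (auto simp: damp_def)
      then show "ennpowr (poisson_sup m \<nu> a f x) p * ennreal (v x) = ennreal (\<rho> x) * ?F x"
        by (simp only: mult_ac)
    qed
    also have "\<dots> = (\<integral>\<^sup>+x. ?F x \<partial>density lborel \<rho>)"
      by (rule nn_integral_density[symmetric]) measurable
    also have "\<dots> \<le> ennreal C * (\<integral>\<^sup>+y. ennreal (\<bar>f y\<bar> powr p * \<sigma> y powr (1 - p)) \<partial>density lborel (phi m \<nu>))"
      unfolding C_def by (rule factorized_strong_type) (use \<sigma>_pos p in auto)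
    also have "(\<integral>\<^sup>+y. ennreal (\<bar>f y\<bar> powr p * \<sigma> y powr (1 - p)) \<partial>density lborel (phi m \<nu>))
        = (\<integral>\<^sup>+y. ennreal (phi m \<nu> y) * ennreal (\<bar>f y\<bar> powr p * \<sigma> y powr (1 - p)) \<partial>lborel)"
      by (rule nn_integral_density) measurable
    also have "\<dots> = (\<integral>\<^sup>+y. ennreal (\<bar>f y\<bar> powr p * w y) \<partial>lborel)"
    proof (intro nn_integral_cong)
      fix y
      have "\<sigma> y powr (1 - p) = (phi m \<nu> y / w y) powr ((p' - 1) * (1 - p))"
        by (simp add: \<sigma>_def powr_powr)
      also have "(p' - 1) * (1 - p) = - 1" unfolding p'(2) using p by (simp add: field_simps)
      finally have "phi m \<nu> y * \<sigma> y powr (1 - p) = w y"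
        using \<phi>[of y] w[of y] by (simp add: powr_minus_divide)
      then have "phi m \<nu> y * (\<bar>f y\<bar> powr p * \<sigma> y powr (1 - p)) = \<bar>f y\<bar> powr p * w y"
        by (simp only: mult.left_commute[of "phi m \<nu> y"])
      moreover have "ennreal (phi m \<nu> y) * ennreal (\<bar>f y\<bar> powr p * \<sigma> y powr (1 - p))
          = ennreal (phi m \<nu> y * (\<bar>f y\<bar> powr p * \<sigma> y powr (1 - p)))"
        using \<phi>[of y] by (intro ennreal_mult[symmetric]) auto
      ultimately show "ennreal (phi m \<nu> y) * ennreal (\<bar>f y\<bar> powr p * \<sigma> y powr (1 - p)) = ennreal (\<bar>f y\<bar> powr p * w y)"
        by (simp only:)
    qed
    finally show "(\<integral>\<^sup>+x. ennpowr (poisson_sup m \<nu> a f x) p * ennreal (v x) \<partial>lborel)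
        \<le> ennreal C * (\<integral>\<^sup>+y. ennreal (\<bar>f y\<bar> powr p * w y) \<partial>lborel)" .
  qed
qed

section \<open>Necessity of the weight condition\<close>

text \<open>
  The converse of Hoelder's inequality. With \<open>g = w\<^bsup>-1/p\<^esup> \<phi>\<close>, the function \<open>f = w\<^bsup>-1/p\<^esup> g\<^bsup>p' - 1\<^esup>\<close> satisfies
  \<open>f \<phi> = f\<^sup>p w = g\<^bsup>p'\<^esup>\<close>. Restricting \<open>f\<close> to sets where \<open>g\<close> and \<open>\<bar>y\<bar>\<close> are bounded makes the common integral
  \<open>J\<close> finite, and \<open>J\<^sup>p \<le> K J\<close> bounds it independently of the set.
\<close>
lemma weight_condition_necessary:
  fixes m \<nu> p p' K :: real and w :: "real ^ 'n \<Rightarrow> real"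
  assumes p: "1 < p" and pp: "1 / p + 1 / p' = 1"
    and [measurable]: "w \<in> borel_measurable borel" and w: "\<And>x. 0 < w x"
    and bound: "\<And>f :: real ^ 'n \<Rightarrow> real. f \<in> borel_measurable borel \<Longrightarrow> (\<And>y. 0 \<le> f y) \<Longrightarrow>
      (\<integral>\<^sup>+y. ennreal (f y powr p * w y) \<partial>lborel) < \<infinity> \<Longrightarrow>
      ennpowr (\<integral>\<^sup>+y. ennreal (f y * phi m \<nu> y) \<partial>lborel) p \<le> ennreal K * (\<integral>\<^sup>+y. ennreal (f y powr p * w y) \<partial>lborel)"
  shows "(\<integral>\<^sup>+y. ennreal ((w y powr (- 1 / p) * phi m \<nu> y) powr p') \<partial>lborel) < \<infinity>"
proof -
  have p': "0 < p'" "(p' - 1) * p = p'"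
  proof -
    have "p' \<noteq> 0" using pp p by auto
    have "1 / p' = (p - 1) / p" using pp p by (simp add: field_simps)
    then have q: "p' = p / (p - 1)" using p \<open>p' \<noteq> 0\<close> by (simp add: field_simps)
    show "0 < p'" "(p' - 1) * p = p'" unfolding q using p by (simp_all add: field_simps)
  qed
  define K' where "K' = max K 0"
  define g where "g = (\<lambda>y. w y powr (- 1 / p) * phi m \<nu> y)"
  have g: "0 < g y" for y using w[of y] phi_pos[of m \<nu> y] by (simp add: g_def)
  have [measurable]: "g \<in> borel_measurable borel" unfolding g_def by measurable
  define A where "A = (\<lambda>k::nat. {y. norm y \<le> real k \<and> g y \<le> real k})"
  have [measurable]: "A k \<in> sets borel" for k unfolding A_def by measurable
  define J where "J = (\<lambda>k. \<integral>\<^sup>+y. ennreal (g y powr p') * indicator (A k) y \<partial>lborel)"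
  have J_bound: "J k \<le> ennreal (K' powr (1 / (p - 1)))" for k
  proof -
    define f where "f = (\<lambda>y. indicator (A k) y * (w y powr (- 1 / p) * g y powr (p' - 1)))"
    have [measurable]: "f \<in> borel_measurable borel" unfolding f_def by measurable
    have f0: "0 \<le> f y" for y by (simp add: f_def)
    have f1: "ennreal (f y * phi m \<nu> y) = ennreal (g y powr p') * indicator (A k) y" for y
    proof -
      have "w y powr (- 1 / p) * g y powr (p' - 1) * phi m \<nu> y = g y powr (p' - 1) * g y powr 1"
        using g[of y] by (simp add: g_def)
      also have "\<dots> = g y powr p'" unfolding powr_add[symmetric] by simp
      finally show ?thesis by (simp add: f_def indicator_def)
    qed
    have f2: "ennreal (f y powr p * w y) = ennreal (g y powr p') * indicator (A k) y" for y
    proof -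
      have "(w y powr (- 1 / p) * g y powr (p' - 1)) powr p * w y = (w y powr (- 1) * w y) * g y powr ((p' - 1) * p)"
        using g[of y] w[of y] p by (simp add: powr_mult powr_powr)
      also have "\<dots> = g y powr p'" using w[of y] p'(2) by (simp add: powr_minus_divide)
      finally show ?thesis by (simp add: f_def indicator_def)
    qed
    have "J k \<le> (\<integral>\<^sup>+y. ennreal (real k powr p') * indicator (cball (0 :: real ^ 'n) (real k)) y \<partial>lborel)"
      unfolding J_def
    proof (intro nn_integral_mono)
      fix y
      have "g y powr p' \<le> real k powr p'" if "g y \<le> real k"
        using that g[of y] p' by (intro powr_mono2) auto
      then show "ennreal (g y powr p') * indicator (A k) y \<le> ennreal (real k powr p') * indicator (cball (0 :: real ^ 'n) (real k)) y"
        by (auto simp: A_def indicator_def intro!: ennreal_leI)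
    qed
    also have "\<dots> < \<infinity>"
      by (subst nn_integral_cmult_indicator) (auto simp: emeasure_cball ennreal_mult_less_top)
    finally have fin: "J k < \<infinity>" .
    then obtain j where j: "J k = ennreal j" "0 \<le> j" by (cases "J k") auto
    have "ennpowr (J k) p \<le> ennreal K * J k"
      using bound[of f] fin f0 unfolding J_def f1 f2 by simp
    then have "ennreal (j powr p) \<le> ennreal K * ennreal j"
      using j by (simp add: ennpowr_ennreal)
    also have "\<dots> \<le> ennreal K' * ennreal j"
      by (intro mult_right_mono ennreal_leI) (auto simp: K'_def)
    also have "\<dots> = ennreal (K' * j)" using j by (simp add: K'_def ennreal_mult)
    finally have le: "j powr p \<le> K' * j" using j by (simp add: K'_def)
    have "j \<le> K' powr (1 / (p - 1))"
    proof (cases "j = 0")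
      case False
      then have j0: "0 < j" using j by simp
      have "j powr (p - 1) * j = j powr p" using j0 powr_add[of j "p - 1" 1] by simp
      then have "j powr (p - 1) * j \<le> K' * j" using le by simp
      then have "j powr (p - 1) \<le> K'" using j0 by simp
      then have "(j powr (p - 1)) powr (1 / (p - 1)) \<le> K' powr (1 / (p - 1))"
        using p by (intro powr_mono2) auto
      then show ?thesis using p j0 by (simp add: powr_powr)
    qed simp
    then show ?thesis using j by (simp add: ennreal_leI)
  qed
  have "(\<integral>\<^sup>+y. ennreal (g y powr p') \<partial>lborel) = (\<integral>\<^sup>+y. (SUP k. ennreal (g y powr p') * indicator (A k) y) \<partial>lborel)"
  proof (intro nn_integral_cong antisym SUP_least)
    fix y
    obtain k :: nat where "max (norm y) (g y) \<le> real k" using real_arch_simple by blast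
    then have "ennreal (g y powr p') = ennreal (g y powr p') * indicator (A k) y" by (simp add: A_def)
    also have "\<dots> \<le> (SUP k. ennreal (g y powr p') * indicator (A k) y)" by (rule SUP_upper) simp
    finally show "ennreal (g y powr p') \<le> (SUP k. ennreal (g y powr p') * indicator (A k) y)" .
  qed (auto simp: indicator_def)
  also have "\<dots> = (SUP k. J k)"
    unfolding J_def
  proof (rule nn_integral_monotone_convergence_SUP)
    show "incseq (\<lambda>k y. ennreal (g y powr p') * indicator (A k) y)"
      by (auto simp: incseq_def le_fun_def A_def indicator_def)
  qed measurable
  also have "\<dots> \<le> ennreal (K' powr (1 / (p - 1)))"
    by (intro SUP_least J_bound)
  also have "\<dots> < \<infinity>" by simp
  finally show ?thesis by (simp add: g_def)
qed

section \<open>The characterisation\<close>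

lemma Lp_norm_borel:
  fixes f g w w' :: "real ^ 'n \<Rightarrow> real"
  assumes p: "0 < p" and w: "AE y in lborel. w y = w' y" "\<And>y. 0 < w' y" and fg: "AE y in lborel. f y = g y"
  shows "Lp_norm p w (\<lambda>y. ennreal \<bar>f y\<bar>) = ennpowr (\<integral>\<^sup>+y. ennreal (\<bar>g y\<bar> powr p * w' y) \<partial>lborel) (1 / p)"
proof -
  have "(\<integral>\<^sup>+y. ennpowr (ennreal \<bar>f y\<bar>) p * ennreal (w y) \<partial>lborel) = (\<integral>\<^sup>+y. ennreal (\<bar>g y\<bar> powr p * w' y) \<partial>lborel)"
    by (rule nn_integral_cong_AE, use w(1) fg in eventually_elim)
       (simp add: ennpowr_ennreal ennreal_mult w(2) less_imp_le)
  then show ?thesis by (simp add: Lp_norm_def nn_integral_completion)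
qed

theorem theorem1p2:
  fixes m \<nu> p p' a :: real and w :: "real ^ 'n \<Rightarrow> real"
  assumes "- real CARD('n) \<le> m" and "0 < \<nu>"
    and "1 < p" and "1 / p + 1 / p' = 1" and "0 < a"
    and "weight w"
  shows "Lp_norm p' (\<lambda>_. 1) (\<lambda>x. ennreal \<bar>w x powr (- 1 / p) * phi m \<nu> x\<bar>) < \<infinity>
     \<longleftrightarrow> (\<exists>v :: real ^ 'n \<Rightarrow> real. weight v \<and> poisson_max_bounded m \<nu> a p w v)"
proof -
  note m = assms(1) and \<nu> = assms(2) and p = assms(3) and pp = assms(4) and a = assms(5)
  obtain w' where w' [measurable]: "w' \<in> borel_measurable borel" and w'_pos: "\<And>x. 0 < w' x"
    and ww': "AE x in lborel. w x = w' x"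
    using weight_borel_representative[OF assms(6)] by blast
  have p0: "0 < p" using p by simp
  have p'0: "0 < p'"
  proof -
    have "p' \<noteq> 0" using pp p by auto
    moreover have "1 / p' = (p - 1) / p" using pp p by (simp add: field_simps)
    then have "0 < 1 / p'" using p by simp
    ultimately show ?thesis by simp
  qed
  let ?cond = "(\<integral>\<^sup>+y. ennreal ((w' y powr (- 1 / p) * phi m \<nu> y) powr p') \<partial>lborel) < \<infinity>"
  have "Lp_norm p' (\<lambda>_. 1) (\<lambda>x. ennreal \<bar>w x powr (- 1 / p) * phi m \<nu> x\<bar>)
      = ennpowr (\<integral>\<^sup>+y. ennreal (\<bar>w' y powr (- 1 / p) * phi m \<nu> y\<bar> powr p' * 1) \<partial>lborel) (1 / p')"
    by (rule Lp_norm_borel[OF p'0]) (use ww' in \<open>auto elim!: eventually_mono\<close>)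
  also have "(\<lambda>y. ennreal (\<bar>w' y powr (- 1 / p) * phi m \<nu> y\<bar> powr p' * 1)) = (\<lambda>y. ennreal ((w' y powr (- 1 / p) * phi m \<nu> y) powr p'))"
    using phi_pos[where m = m and \<nu> = \<nu> and ?'a = 'n] by (simp add: fun_eq_iff abs_mult less_imp_le)
  finally have cond_iff: "Lp_norm p' (\<lambda>_. 1) (\<lambda>x. ennreal \<bar>w x powr (- 1 / p) * phi m \<nu> x\<bar>) < \<infinity> \<longleftrightarrow> ?cond"
    by (simp only: ennpowr_finite_iff)
  show ?thesis
    unfolding cond_iff
  proof
    assume ?cond
    then obtain v C where v [measurable]: "v \<in> borel_measurable borel" and v_pos: "AE x in lborel. 0 < v x" and C: "0 < C"
      and bound: "\<And>f :: real ^ 'n \<Rightarrow> real. f \<in> borel_measurable borel \<Longrightarrow>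
        (\<integral>\<^sup>+x. ennpowr (poisson_sup m \<nu> a f x) p * ennreal (v x) \<partial>lborel)
          \<le> ennreal C * (\<integral>\<^sup>+y. ennreal (\<bar>f y\<bar> powr p * w' y) \<partial>lborel)"
      by (rule weighted_bound_exists[OF m \<nu> p pp a w' w'_pos]) blast
    have "weight v"
      unfolding weight_def using v_pos by (auto intro: AE_completion measurable_completion)
    moreover have "poisson_max_bounded m \<nu> a p w v"
      unfolding poisson_max_bounded_def
    proof (intro exI[of _ "C powr (1 / p)"] ballI conjI)
      fix f :: "real ^ 'n \<Rightarrow> real" assume f: "f \<in> Lp_space p w"
      then have f_meas: "f \<in> borel_measurable lebesgue" by (simp add: Lp_space_def)
      then obtain g where g [measurable]: "g \<in> borel_measurable lborel" and fg: "AE y in lborel. f y = g y"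
        using completion_ex_borel_measurable_real[of f lborel] by auto
      have norm: "Lp_norm p w (\<lambda>x. ennreal \<bar>f x\<bar>) = ennpowr (\<integral>\<^sup>+y. ennreal (\<bar>g y\<bar> powr p * w' y) \<partial>lborel) (1 / p)"
        by (rule Lp_norm_borel[OF p0 ww' w'_pos fg])
      have fin: "(\<integral>\<^sup>+y. ennreal (\<bar>g y\<bar> powr p * w' y) \<partial>lborel) < \<infinity>"
        using f by (simp add: Lp_space_def norm ennpowr_finite_iff del: infinity_ennreal_def)
      have max_eq: "poisson_max m \<nu> a f = poisson_max m \<nu> a g"
        by (intro poisson_max_cong_AE f_meas fg measurable_completion g)
      have [measurable]: "(\<lambda>x. ennpowr (poisson_sup m \<nu> a g x) p) \<in> borel_measurable lborel"
        using g unfolding ennpowr_def by measurable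
      have sup_fin: "AE x in lborel. poisson_sup m \<nu> a g x < \<infinity>"
      proof -
        have "(\<integral>\<^sup>+x. ennpowr (poisson_sup m \<nu> a g x) p * ennreal (v x) \<partial>lborel) < \<infinity>"
          using bound[of g] fin by (auto simp: ennreal_mult_less_top intro: le_less_trans)
        then have "AE x in lborel. ennpowr (poisson_sup m \<nu> a g x) p * ennreal (v x) \<noteq> \<infinity>"
          by (intro nn_integral_PInf_AE) auto
        then show ?thesis using v_pos
        proof eventually_elim
          case (elim x)
          then have "ennpowr (poisson_sup m \<nu> a g x) p < \<infinity>"
            by (auto simp: ennreal_mult_eq_top_iff less_top)
          then show ?case by (simp add: ennpowr_finite_iff del: infinity_ennreal_def)
        qed
      qed
      show "poisson_max m \<nu> a f \<in> borel_measurable lebesgue"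
        unfolding max_eq by (rule poisson_max_measurable) (use \<nu> sup_fin in auto)
      have "(\<integral>\<^sup>+x. ennpowr (poisson_max m \<nu> a f x) p * ennreal (v x) \<partial>lebesgue)
          \<le> (\<integral>\<^sup>+x. ennpowr (poisson_sup m \<nu> a g x) p * ennreal (v x) \<partial>lborel)"
        unfolding nn_integral_completion max_eq
      proof (rule nn_integral_mono_AE, use sup_fin in eventually_elim)
        case (elim x)
        then have "poisson_max m \<nu> a g x \<le> poisson_sup m \<nu> a g x"
          by (intro poisson_max_le_poisson_sup \<nu>) auto
        then show ?case using p0 by (intro mult_right_mono ennpowr_mono) auto
      qed
      also have "\<dots> \<le> ennreal C * (\<integral>\<^sup>+y. ennreal (\<bar>g y\<bar> powr p * w' y) \<partial>lborel)"
        by (rule bound) simp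
      also have "ennreal C = ennreal ((C powr (1 / p)) powr p)"
        using C p0 by (simp add: powr_powr)
      finally show "Lp_norm p v (poisson_max m \<nu> a f) \<le> ennreal (C powr (1 / p)) * Lp_norm p w (\<lambda>x. ennreal \<bar>f x\<bar>)"
        unfolding norm unfolding Lp_norm_def using C p0 by (subst ennpowr_le_iff) auto
    qed
    ultimately show "\<exists>v :: real ^ 'n \<Rightarrow> real. weight v \<and> poisson_max_bounded m \<nu> a p w v"
      by blast
  next
    assume "\<exists>v :: real ^ 'n \<Rightarrow> real. weight v \<and> poisson_max_bounded m \<nu> a p w v"
    then obtain v :: "real ^ 'n \<Rightarrow> real" where "weight v" and bdd: "poisson_max_bounded m \<nu> a p w v" by blast
    obtain v' where v' [measurable]: "v' \<in> borel_measurable borel" and v'_pos: "\<And>x. 0 < v' x"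
      and vv': "AE x in lborel. v x = v' x"
      using weight_borel_representative[OF \<open>weight v\<close>] by blast
    obtain C0 where C0: "\<And>f. f \<in> Lp_space p w \<Longrightarrow>
        Lp_norm p v (poisson_max m \<nu> a f) \<le> ennreal C0 * Lp_norm p w (\<lambda>x. ennreal \<bar>f x\<bar>)"
      using bdd unfolding poisson_max_bounded_def by blast
    \<comment> \<open>the constant in the boundedness hypothesis may be negative\<close>
    define C where "C = max C0 1"
    have C: "0 < C" by (simp add: C_def)
    obtain c where c: "0 < c" "\<And>x (f :: real ^ 'n \<Rightarrow> real). norm x \<le> 1 \<Longrightarrow> f \<in> borel_measurable borel \<Longrightarrow>
        ennreal c * phi_norm m \<nu> f \<le> poisson_nn m \<nu> (a / 2) f x"
      using poisson_nn_lower[OF \<nu> m, of "a / 2"] a by auto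
    have V_meas: "(\<lambda>x. ennreal (v' x) * indicator (cball (0 :: real ^ 'n) 1) x) \<in> borel_measurable lborel"
    proof (rule borel_measurable_times_ennreal)
      show "(\<lambda>x. ennreal (v' x)) \<in> borel_measurable lborel" using v' by simp
      show "indicator (cball (0 :: real ^ 'n) 1) \<in> borel_measurable lborel" by (rule borel_measurable_indicator) auto
    qed
    define V where "V = (\<integral>\<^sup>+x. ennreal (v' x) * indicator (cball (0 :: real ^ 'n) 1) x \<partial>lborel)"
    have "V \<noteq> 0"
    proof
      assume "V = 0"
      then have "AE x in lborel. ennreal (v' x) * indicator (cball (0 :: real ^ 'n) 1) x = 0"
        unfolding V_def by (subst (asm) nn_integral_0_iff_AE[OF V_meas])
      then have "AE x in lborel. \<not> (x \<in> cball (0 :: real ^ 'n) 1)"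
      proof eventually_elim
        case (elim x)
        then show ?case using v'_pos[of x] by (auto simp: indicator_def split: if_splits)
      qed
      then have "emeasure lborel {x \<in> space lborel. x \<in> cball (0 :: real ^ 'n) 1} = 0"
        by (rule emeasure_eq_0_AE)
      moreover have "{x \<in> space lborel. x \<in> cball (0 :: real ^ 'n) 1} = cball 0 1" by auto
      moreover have "emeasure lborel (cball (0 :: real ^ 'n) 1) \<noteq> 0"
        using unit_ball_vol_pos[of "real CARD('n)"] by (subst emeasure_cball) (auto simp: ennreal_eq_0_iff not_le)
      ultimately show False by simp
    qed
    \<comment> \<open>\<open>V\<close> may be infinite\<close>
    define V0 where "V0 = enn2real (min V 1)"
    have V0: "0 < V0" "ennreal V0 \<le> V"
      using \<open>V \<noteq> 0\<close> unfolding V0_def by (auto simp: enn2real_positive_iff min_less_iff_disj zero_less_iff_neq_zero)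
    define K where "K = C powr p / (c powr p * V0)"
    show ?cond
    proof (rule weight_condition_necessary[OF p pp w' w'_pos, where K = K])
      fix f :: "real ^ 'n \<Rightarrow> real"
      assume f [measurable]: "f \<in> borel_measurable borel" and f0: "\<And>y. 0 \<le> f y"
        and fin: "(\<integral>\<^sup>+y. ennreal (f y powr p * w' y) \<partial>lborel) < \<infinity>"
      let ?B = "\<integral>\<^sup>+y. ennreal (f y powr p * w' y) \<partial>lborel"
      let ?I = "\<integral>\<^sup>+y. ennreal (f y * phi m \<nu> y) \<partial>lborel"
      have f_meas: "f \<in> borel_measurable lebesgue" by (rule measurable_completion) simp
      have norm: "Lp_norm p w (\<lambda>x. ennreal \<bar>f x\<bar>) = ennpowr ?B (1 / p)"
        using Lp_norm_borel[OF p0 ww' w'_pos, of f f] f0 by simp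
      have "f \<in> Lp_space p w"
        using f_meas fin by (simp add: Lp_space_def norm ennpowr_finite_iff del: infinity_ennreal_def)
      from C0[OF this] have "Lp_norm p v (poisson_max m \<nu> a f) \<le> ennreal C0 * ennpowr ?B (1 / p)"
        unfolding norm .
      also have "\<dots> \<le> ennreal C * ennpowr ?B (1 / p)"
        by (intro mult_right_mono ennreal_leI) (auto simp: C_def)
      finally have upper: "(\<integral>\<^sup>+x. ennpowr (poisson_max m \<nu> a f x) p * ennreal (v x) \<partial>lborel) \<le> ennreal (C powr p) * ?B"
        unfolding Lp_norm_def nn_integral_completion using C p0 by (subst (asm) ennpowr_le_iff) auto
      have "ennreal (c powr p) * ennpowr ?I p * V = (\<integral>\<^sup>+x. ennpowr (ennreal c * ?I) p * (ennreal (v' x) * indicator (cball (0 :: real ^ 'n) 1) x) \<partial>lborel)"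
        unfolding V_def using c(1) p0 by (subst nn_integral_cmult[OF V_meas]) (simp add: ennpowr_mult_ennreal)
      also have "\<dots> \<le> (\<integral>\<^sup>+x. ennpowr (poisson_max m \<nu> a f x) p * ennreal (v x) \<partial>lborel)"
      proof (rule nn_integral_mono_AE, use vv' in eventually_elim)
        case (elim x)
        show ?case
        proof (cases "norm x \<le> 1")
          case True
          have "ennreal c * ?I \<le> poisson_nn m \<nu> (a / 2) f x"
            using c(2)[OF True f] f0 by simp
          also have "\<dots> \<le> poisson_max m \<nu> a f x"
            using a f0 by (intro poisson_nn_le_poisson_max \<nu>) auto
          finally show ?thesis
            using elim p0 True by (auto intro!: mult_right_mono ennpowr_mono)
        qed simp
      qed
      also note upper
      finally have main: "ennreal (c powr p) * ennpowr ?I p * V \<le> ennreal (C powr p) * ?B" .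
      have "ennpowr ?I p = ennreal (1 / (c powr p * V0)) * (ennreal (c powr p) * ennpowr ?I p * ennreal V0)"
      proof -
        have "ennreal (1 / (c powr p * V0)) * ennreal (c powr p) * ennreal V0 = 1"
          using c(1) V0(1) by (simp flip: ennreal_mult)
        then show ?thesis by (simp only: mult.assoc mult.commute[of "ennpowr ?I p"] mult.left_commute[of "ennpowr ?I p"]) (simp add: mult.assoc[symmetric])
      qed
      also have "\<dots> \<le> ennreal (1 / (c powr p * V0)) * (ennreal (c powr p) * ennpowr ?I p * V)"
        by (intro mult_left_mono V0) auto
      also have "\<dots> \<le> ennreal (1 / (c powr p * V0)) * (ennreal (C powr p) * ?B)"
        by (intro mult_left_mono main) auto
      also have "\<dots> = ennreal K * ?B"
        using c(1) V0(1) by (simp add: K_def mult.assoc[symmetric] flip: ennreal_mult)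
      finally show "ennpowr ?I p \<le> ennreal K * ?B" .
    qed
  qed
qed

end
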